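(* Let $M$ and $N$ be atomic JBW-algebras with units $e_M$ and $e_N$, and suppose that $M$ does not contain any central atoms. Then a map $f\colon[0,e_M]\to[0,e_N]$ is an order isomorphism such that $f((0,e_M])=(0,e_N]$ if and only if $f$ is of the form $$f(x)=\varphi_t\left(U_{(z^2+e_N)^{1/2}}\left(e_N-(e_N+U_{z^{-1}}Jx)^{-1}\right)\right)\qquad (x\in[0,e_M])$$ for some $t<1$, $z\in N_+^\circ$, and a Jordan isomorphism $J\colon M\to N$.
   Context: A JB-algebra is a real Banach space $A$ with a commutative bilinear product $\circ$ satisfying $x\circ(y\circ x^2)=(x\circ y)\circ x^2$, $\|x\circ y\|\le\|x\|\|y\|$, $\|x^2\|=\|x\|^2$ and $\|x^2\|\le\|x^2+y^2\|$ for all $x,y\in A$. A JBW-algebra is a JB-algebra that is a dual Banach space; it has a unit, denoted $e$ (with a subscript indicating the algebra). $A_+$ denotes the cone of squares (equivalently, the elements with non-negative spectrum), and $x\le y$ means $y-x\in A_+$; $A_+^\circ$ is the interior of $A_+$ (the elements with strictly positive spectrum). $[x,y]=\{w: x\le w\le y\}$. In a unital JB-algebra, an element $x$ is invertible if it is invertible in the JB-subalgebra generated by $x$ and $e$, which is isomorphic to $C(\sigma(x))$; $x^{-1}$, $x^{1/2}$ etc. are defined by the continuous functional calculus there. $(0,e]$ denotes the set of invertible elements of $[0,e]$. The quadratic representation of $x$ is $U_xy=2x\circ(x\circ y)-x^2\circ y$. An order isomorphism is a bijection $f$ with $x\le y\iff f(x)\le f(y)$. A Jordan isomorphism is a linear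 bijection preserving $\circ$. A projection is an element $p$ with $p^2=p$; an atom is a minimal non-zero projection; $M$ is atomic if every non-zero projection dominates an atom. Elements $x,y$ operator commute if $x\circ(y\circ w)=y\circ(x\circ w)$ for all $w$; an element is central if it operator commutes with all elements; a central atom is an atom that is central. For $t<1$, $\varphi_t\colon[0,e_N]\to[0,e_N]$ is defined by $\varphi_t(x)=x\circ(tx+(1-t)e_N)^{-1}$. *)

theory Defs
  imports "HOL-Analysis.Bounded_Linear_Function"
begin

class jb_algebra = banach +
  fixes jprod :: "'a \<Rightarrow> 'a \<Rightarrow> 'a"  (infixl "\<odot>" 70)
  assumes jprod_commute: "x \<odot> y = y \<odot> x"
    and jprod_add_left: "(x + y) \<odot> z = x \<odot> z + y \<odot> z"
    and jprod_scaleR_left: "(c *\<^sub>R x) \<odot> y = c *\<^sub>R (x \<odot> y)"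
    and jordan_identity: "x \<odot> (y \<odot> (x \<odot> x)) = (x \<odot> y) \<odot> (x \<odot> x)"
    and norm_jprod_le: "norm (x \<odot> y) \<le> norm x * norm y"
    and norm_jsquare: "norm (x \<odot> x) = (norm x)\<^sup>2"
    and norm_jsquare_le: "norm (x \<odot> x) \<le> norm (x \<odot> x + y \<odot> y)"

text \<open>A JBW-algebra is a JB-algebra that is isometrically the dual of some Banach space.
  HOL cannot quantify existentially over types, so the predual is a type parameter \<open>'p\<close>; in a
  hypothesis, a free \<open>'p\<close> amounts to assuming that some predual exists.\<close>

definition jbw_algebra :: "'a::jb_algebra itself \<Rightarrow> 'p::banach itself \<Rightarrow> bool" where
  "jbw_algebra _ _ \<longleftrightarrow>
     (\<exists>D :: 'a \<Rightarrow> ('p \<Rightarrow>\<^sub>L real). linear D \<and> bij D \<and> (\<forall>x. norm (D x) = norm x))"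

text \<open>The unit is not part of the class; it is passed as an argument to the notions that use it.\<close>

definition is_junit :: "'a::jb_algebra \<Rightarrow> bool" where
  "is_junit e \<longleftrightarrow> (\<forall>x. e \<odot> x = x)"

definition jpos :: "'a::jb_algebra set" where
  "jpos = {x \<odot> x | x. True}"

definition jle :: "'a::jb_algebra \<Rightarrow> 'a \<Rightarrow> bool"  (infix "\<preceq>" 50) where
  "x \<preceq> y \<longleftrightarrow> y - x \<in> jpos"

definition jinterval :: "'a::jb_algebra \<Rightarrow> 'a \<Rightarrow> 'a set" where
  "jinterval x y = {w. x \<preceq> w \<and> w \<preceq> y}"

text \<open>The JB-subalgebra generated by \<open>x\<close> and \<open>e\<close>.\<close>

definition jb_gen :: "'a::jb_algebra \<Rightarrow> 'a \<Rightarrow> 'a set" where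
  "jb_gen e x = \<Inter>{S. subspace S \<and> closed S \<and> (\<forall>a\<in>S. \<forall>b\<in>S. a \<odot> b \<in> S) \<and> x \<in> S \<and> e \<in> S}"

definition jinvertible :: "'a::jb_algebra \<Rightarrow> 'a \<Rightarrow> bool" where
  "jinvertible e x \<longleftrightarrow> (\<exists>y\<in>jb_gen e x. x \<odot> y = e)"

definition jspectrum :: "'a::jb_algebra \<Rightarrow> 'a \<Rightarrow> real set" where
  "jspectrum e x = {c. \<not> jinvertible e (x - c *\<^sub>R e)}"

text \<open>\<open>is_fun_calc e x \<Phi>\<close>: \<open>\<Phi>\<close> is the isometric isomorphism from \<open>C(\<sigma>(x))\<close> onto \<open>jb_gen e x\<close>
  that maps the identity function to \<open>x\<close> and the constant one to \<open>e\<close>. Elements of \<open>C(\<sigma>(x))\<close> are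
  represented by functions on the reals that are continuous on \<open>\<sigma>(x)\<close>. The isometry condition,
  which also makes \<open>\<Phi>\<close> injective and independent of the values outside \<open>\<sigma>(x)\<close>, is stated
  without a supremum because \<open>\<sigma>(x)\<close> is empty in the zero algebra.\<close>

definition is_fun_calc :: "'a::jb_algebra \<Rightarrow> 'a \<Rightarrow> ((real \<Rightarrow> real) \<Rightarrow> 'a) \<Rightarrow> bool" where
  "is_fun_calc e x \<Phi> \<longleftrightarrow>
     (let C = {g. continuous_on (jspectrum e x) g} in
        (\<forall>g\<in>C. \<forall>h\<in>C. \<Phi> (\<lambda>s. g s + h s) = \<Phi> g + \<Phi> h) \<and>
        (\<forall>c. \<forall>g\<in>C. \<Phi> (\<lambda>s. c * g s) = c *\<^sub>R \<Phi> g) \<and>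
        (\<forall>g\<in>C. \<forall>h\<in>C. \<Phi> (\<lambda>s. g s * h s) = \<Phi> g \<odot> \<Phi> h) \<and>
        (\<forall>g\<in>C. \<forall>c\<ge>0. norm (\<Phi> g) \<le> c \<longleftrightarrow> (\<forall>s\<in>jspectrum e x. \<bar>g s\<bar> \<le> c)) \<and>
        \<Phi> ` C = jb_gen e x \<and> \<Phi> (\<lambda>s. s) = x \<and> \<Phi> (\<lambda>s. 1) = e)"

text \<open>Continuous functional calculus \<open>g(x)\<close>, meaningful only if \<open>g\<close> is continuous on \<open>\<sigma>(x)\<close>.\<close>

definition jfun_calc :: "'a::jb_algebra \<Rightarrow> (real \<Rightarrow> real) \<Rightarrow> 'a \<Rightarrow> 'a" where
  "jfun_calc e g x = (THE y. \<exists>\<Phi>. is_fun_calc e x \<Phi> \<and> \<Phi> g = y)"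

definition jinv :: "'a::jb_algebra \<Rightarrow> 'a \<Rightarrow> 'a" where
  "jinv e x = jfun_calc e inverse x"

definition jsqrt :: "'a::jb_algebra \<Rightarrow> 'a \<Rightarrow> 'a" where
  "jsqrt e x = jfun_calc e sqrt x"

text \<open>The set \<open>(0,e]\<close>.\<close>

definition junit_interval_inv :: "'a::jb_algebra \<Rightarrow> 'a set" where
  "junit_interval_inv e = {x \<in> jinterval 0 e. jinvertible e x}"

definition quad_rep :: "'a::jb_algebra \<Rightarrow> 'a \<Rightarrow> 'a" where
  "quad_rep x y = 2 *\<^sub>R (x \<odot> (x \<odot> y)) - (x \<odot> x) \<odot> y"

definition jorder_iso_on :: "'a::jb_algebra set \<Rightarrow> 'b::jb_algebra set \<Rightarrow> ('a \<Rightarrow> 'b) \<Rightarrow> bool" where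
  "jorder_iso_on A B f \<longleftrightarrow> bij_betw f A B \<and> (\<forall>x\<in>A. \<forall>y\<in>A. x \<preceq> y \<longleftrightarrow> f x \<preceq> f y)"

definition jordan_iso :: "('a::jb_algebra \<Rightarrow> 'b::jb_algebra) \<Rightarrow> bool" where
  "jordan_iso J \<longleftrightarrow> linear J \<and> bij J \<and> (\<forall>x y. J (x \<odot> y) = J x \<odot> J y)"

definition jprojection :: "'a::jb_algebra \<Rightarrow> bool" where
  "jprojection p \<longleftrightarrow> p \<odot> p = p"

definition jatom :: "'a::jb_algebra \<Rightarrow> bool" where
  "jatom p \<longleftrightarrow> jprojection p \<and> p \<noteq> 0 \<and>
     (\<forall>q. jprojection q \<and> q \<noteq> 0 \<and> q \<preceq> p \<longrightarrow> q = p)"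

definition jatomic :: "'a::jb_algebra itself \<Rightarrow> bool" where
  "jatomic _ \<longleftrightarrow> (\<forall>p::'a. jprojection p \<and> p \<noteq> 0 \<longrightarrow> (\<exists>q. jatom q \<and> q \<preceq> p))"

definition operator_commute :: "'a::jb_algebra \<Rightarrow> 'a \<Rightarrow> bool" where
  "operator_commute x y \<longleftrightarrow> (\<forall>w. x \<odot> (y \<odot> w) = y \<odot> (x \<odot> w))"

definition jcentral :: "'a::jb_algebra \<Rightarrow> bool" where
  "jcentral x \<longleftrightarrow> (\<forall>y. operator_commute x y)"

definition jphi :: "'a::jb_algebra \<Rightarrow> real \<Rightarrow> 'a \<Rightarrow> 'a" where
  "jphi e t x = x \<odot> jinv e (t *\<^sub>R x + (1 - t) *\<^sub>R e)"

end

theory Submission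
  imports Defs "HOL-Analysis.Analysis" "HOL-Computational_Algebra.Fundamental_Theorem_Algebra"
begin

text \<open>If \<open>f\<close> is an order isomorphism of the unit intervals that preserves invertibility, then
  \<open>x \<mapsto> f ((e + x)\<^sup>-\<^sup>1)\<^sup>-\<^sup>1 - e\<close> is an order isomorphism of the cones \<open>M\<^sub>+ \<rightarrow> N\<^sub>+\<close>. Extreme rays of a cone
  are characterized by the order (the intervals \<open>[0, v]\<close> that are chains), they are spanned by the
  atoms, and an order isomorphism maps half-lines in the direction of a ray to such half-lines,
  parallel ones to parallel ones. Hence it is additive along parallelograms spanned by two
  different rays. An atom that is not central lies in the span of the other rays, which forces
  additivity along a single ray as well. Since every positive element is the supremum of the sums of
  rays below it, the map and its inverse are superadditive, so the map is linear. A linear order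
  isomorphism has the form \<open>U\<^sub>w J\<close>, and on the invertible elements this is the asserted
  formula. It extends to the whole interval because every element is the infimum of the invertible
  elements above it.\<close>

section \<open>Jordan identities\<close>

text \<open>Two obstacles shape the development. First, a central atom splits off a copy of the
  reals, whose cone admits every increasing bijection of the half-line as an order isomorphism;
  linearity along a ray can therefore only come from other rays that the Jordan product ties to it.
  Second, the structure theory of JB-algebras has to be extracted from the axioms. Power
  associativity comes from bicommutants of multiplication operators, the fundamental formula from
  Newton's identities, and positivity of U_a from a continuity argument along a path of invertible
  elements. Duality enters only through compactness of balls: order intervals are intersections of
  two balls, so bounded chains have suprema. That a unital linear order isomorphism preserves the
  product is once more a consequence of the linearity of cone isomorphisms, applied to a map twisted
  by inversion; the product appears as the second-order term of inversion at the unit.\<close>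

lemma jprod_add_right: "x \<odot> (y + z) = x \<odot> y + x \<odot> (z::'a::jb_algebra)"
  by (metis jprod_add_left jprod_commute)

lemma jprod_scaleR_right: "x \<odot> (c *\<^sub>R y) = c *\<^sub>R (x \<odot> (y::'a::jb_algebra))"
  by (metis jprod_scaleR_left jprod_commute)

lemma bounded_bilinear_jprod: "bounded_bilinear ((\<odot>) :: 'a::jb_algebra \<Rightarrow> 'a \<Rightarrow> 'a)"
  by (rule bounded_bilinear.intro)
     (auto simp: jprod_add_left jprod_add_right jprod_scaleR_left jprod_scaleR_right
       intro!: exI[of _ 1] norm_jprod_le)

interpretation jprod: bounded_bilinear "(\<odot>) :: 'a::jb_algebra \<Rightarrow> 'a \<Rightarrow> 'a"
  by (rule bounded_bilinear_jprod)

lemmas jprod_distribs = jprod.add_left jprod.add_right jprod.diff_left jprod.diff_right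
  jprod.minus_left jprod.minus_right jprod.scaleR_left jprod.scaleR_right

text \<open>Polarization. The defect \<open>F\<close> of the Jordan identity is cubic, and its
  alternating sum over the partial sums of \<open>x\<close>, \<open>z\<close>, \<open>w\<close> is
  twice the trilinear difference of the two sides.\<close>

lemma jordan_linearized:
  fixes x y z w :: "'a::jb_algebra"
  shows "x \<odot> (y \<odot> (z \<odot> w)) + z \<odot> (y \<odot> (w \<odot> x)) + w \<odot> (y \<odot> (x \<odot> z))
       = (x \<odot> y) \<odot> (z \<odot> w) + (z \<odot> y) \<odot> (w \<odot> x) + (w \<odot> y) \<odot> (x \<odot> z)"
proof -
  define F where "F u = u \<odot> (y \<odot> (u \<odot> u)) - (u \<odot> y) \<odot> (u \<odot> u)" for u
  have F0: "F u = 0" for u by (simp add: F_def jordan_identity)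
  have "F (x + z + w) - F (x + z) - F (x + w) - F (z + w) + F x + F z + F w
     = 2 *\<^sub>R ((x \<odot> (y \<odot> (z \<odot> w)) + z \<odot> (y \<odot> (w \<odot> x)) + w \<odot> (y \<odot> (x \<odot> z)))
       - ((x \<odot> y) \<odot> (z \<odot> w) + (z \<odot> y) \<odot> (w \<odot> x) + (w \<odot> y) \<odot> (x \<odot> z)))"
    unfolding F_def
    by (simp add: jprod_distribs jprod_commute[of z x] jprod_commute[of w x] jprod_commute[of w z]
        algebra_simps scaleR_2)
  then show ?thesis by (simp add: F0)
qed

text \<open>Reduces identities in a vector space to linear arithmetic over the reals.\<close>

lemma linear_functional_eqI:
  fixes x y :: "'a::real_vector"
  assumes "\<And>f :: 'a \<Rightarrow> real. linear f \<Longrightarrow> f x = f y"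
  shows "x = y"
proof (rule ccontr)
  assume "x \<noteq> y"
  then have "independent {x - y}" by simp
  from linear_independent_extend[OF this, of "\<lambda>_. 1::real"]
  obtain f :: "'a \<Rightarrow> real" where "linear f" "f (x - y) = 1" by auto
  with assms[OF this(1)] show False by (simp add: linear_diff)
qed

text \<open>The linearized identity, read as a formula for the multiplication operator of a triple
  product in terms of those of single factors and of products of two factors. It is the recursion
  behind all statements about multiplication by powers.\<close>

lemma jprod_mult3:
  fixes a b c w :: "'a::jb_algebra"
  shows "((a \<odot> b) \<odot> c) \<odot> w = (a \<odot> b) \<odot> (c \<odot> w) + (b \<odot> c) \<odot> (a \<odot> w) + (a \<odot> c) \<odot> (b \<odot> w)
     - a \<odot> (c \<odot> (b \<odot> w)) - b \<odot> (c \<odot> (a \<odot> w))"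
  using jordan_linearized[of a c b w] jprod_commute[of w "c"] jprod_commute[of w "a"]
    jprod_commute[of w "(a \<odot> b) \<odot> c"] jprod_commute[of "a \<odot> b" "c"] jprod_commute[of "c \<odot> w" "a \<odot> b"]
   jprod_commute[of b c]
  by (simp add: algebra_simps)

text \<open>The polarized quadratic representation, half of U_{x+y} - U_x - U_y.\<close>

definition quad_bil :: "'a::jb_algebra \<Rightarrow> 'a \<Rightarrow> 'a \<Rightarrow> 'a" where
  "quad_bil x y w = x \<odot> (y \<odot> w) + y \<odot> (x \<odot> w) - (x \<odot> y) \<odot> w"

lemma quad_rep_bil: "quad_rep x w = quad_bil x x w"
  by (simp add: quad_rep_def quad_bil_def scaleR_2)

text \<open>Infinitesimal form of the fundamental formula: putting c = exp(s a) there, so that U_c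
  is the exponential of 2 s times the multiplication by a, and differentiating at s = 0 gives the
  case x = y. In \<open>fundamental_formula\<close> it is applied to c, c^2, c^3 and c^4.\<close>

lemma quad_bil_derivation:
  fixes a x y w :: "'a::jb_algebra"
  shows "a \<odot> quad_bil x y w + quad_bil x y (a \<odot> w) = quad_bil (a \<odot> x) y w + quad_bil x (a \<odot> y) w"
proof -
  have 1: "((a \<odot> x) \<odot> y) \<odot> w = (a \<odot> x) \<odot> (y \<odot> w) + (x \<odot> y) \<odot> (a \<odot> w) + (a \<odot> y) \<odot> (x \<odot> w)
     - a \<odot> (y \<odot> (x \<odot> w)) - x \<odot> (y \<odot> (a \<odot> w))" by (rule jprod_mult3)
  have 2: "((a \<odot> y) \<odot> x) \<odot> w = (a \<odot> y) \<odot> (x \<odot> w) + (y \<odot> x) \<odot> (a \<odot> w) + (a \<odot> x) \<odot> (y \<odot> w)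
     - a \<odot> (x \<odot> (y \<odot> w)) - y \<odot> (x \<odot> (a \<odot> w))" by (rule jprod_mult3)
  have 3: "x \<odot> (w \<odot> (y \<odot> a)) + y \<odot> (w \<odot> (a \<odot> x)) + a \<odot> (w \<odot> (x \<odot> y))
       = (x \<odot> w) \<odot> (y \<odot> a) + (y \<odot> w) \<odot> (a \<odot> x) + (a \<odot> w) \<odot> (x \<odot> y)"
    by (rule jordan_linearized)
  have c: "x \<odot> (a \<odot> y) = (a \<odot> y) \<odot> x" "y \<odot> x = x \<odot> y" "y \<odot> a = a \<odot> y"
    "w \<odot> (a \<odot> y) = (a \<odot> y) \<odot> w" "w \<odot> (a \<odot> x) = (a \<odot> x) \<odot> w" "w \<odot> (x \<odot> y) = (x \<odot> y) \<odot> w"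
    "(x \<odot> w) \<odot> (a \<odot> y) = (a \<odot> y) \<odot> (x \<odot> w)" "(y \<odot> w) \<odot> (a \<odot> x) = (a \<odot> x) \<odot> (y \<odot> w)"
    "(a \<odot> w) \<odot> (x \<odot> y) = (x \<odot> y) \<odot> (a \<odot> w)"
    by (simp_all add: jprod_commute)
  show ?thesis
  proof (rule linear_functional_eqI)
    fix f :: "'a \<Rightarrow> real" assume f: "linear f"
    show "f (a \<odot> quad_bil x y w + quad_bil x y (a \<odot> w)) = f (quad_bil (a \<odot> x) y w + quad_bil x (a \<odot> y) w)"
      using arg_cong[OF 1, of f] arg_cong[OF 2, of f] arg_cong[OF 3, of f]
      unfolding quad_bil_def jprod_distribs c linear_add[OF f] linear_diff[OF f] by linarith
  qed
qed

text \<open>The relations for \<open>c\<close>, \<open>c\<^sup>2\<close>, \<open>c\<^sup>3\<close>, \<open>c\<^sup>4\<close> are the power sums \<open>p\<^sub>1, \<dots>, p\<^sub>4\<close>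
  of the four ``eigenvalues'' of \<open>c\<close> on the two arguments of \<open>B\<close>; the conclusion is the
  elementary symmetric polynomial \<open>e\<^sub>4 = (p\<^sub>1\<^sup>4 - 6 p\<^sub>1\<^sup>2 p\<^sub>2 + 3 p\<^sub>2\<^sup>2 + 8 p\<^sub>1 p\<^sub>3 - 6 p\<^sub>4) / 24\<close>.\<close>

lemma newton_identity_operators:
  fixes T S :: "'a::real_vector \<Rightarrow> 'a" and B :: "'a \<Rightarrow> 'a \<Rightarrow> 'a \<Rightarrow> 'a"
  assumes T: "linear T" and S: "linear S" and TS: "\<And>x. S (T x) = T (S x)"
    and B: "\<And>y w. linear (\<lambda>x. B x y w)" "\<And>x w. linear (\<lambda>y. B x y w)" "\<And>x y. linear (B x y)"
    and h1: "\<And>x y w. B (T x) y w = T (B x y w) + B x y (T w) - B x (T y) w"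
    and h2: "\<And>x y w. B (S x) y w = S (B x y w) + B x y (S w) - B x (S y) w"
    and R3: "\<And>x. R3 x = 3 *\<^sub>R T (S x) - 2 *\<^sub>R T (T (T x))"
    and R4: "\<And>x. R4 x = S (S x) + 4 *\<^sub>R T (T (S x)) - 4 *\<^sub>R T (T (T (T x)))"
    and h3: "\<And>x y w. R3 (B x y w) + B x y (R3 w) = B (R3 x) y w + B x (R3 y) w"
    and h4: "\<And>x y w. R4 (B x y w) + B x y (R4 w) = B (R4 x) y w + B x (R4 y) w"
    and R: "\<And>x. R x = 2 *\<^sub>R T (T x) - S x"
  shows "B (R x) (R y) w = R (B x y (R w))"
proof -
  note lin = linear_add[OF T] linear_diff[OF T] linear_cmul[OF T]
    linear_add[OF S] linear_diff[OF S] linear_cmul[OF S]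
    linear_add[OF B(1)] linear_diff[OF B(1)] linear_cmul[OF B(1)]
    linear_add[OF B(2)] linear_diff[OF B(2)] linear_cmul[OF B(2)]
    linear_add[OF B(3)] linear_diff[OF B(3)] linear_cmul[OF B(3)]
  note expand = lin TS h1 h2 scaleR_add_right scaleR_diff_right scaleR_scaleR
  define G3 where "G3 w = R3 (B x y w) + B x y (R3 w) - B (R3 x) y w - B x (R3 y) w" for w
  have g3: "G3 w = 0" for w using h3[of x y w] by (simp add: G3_def)
  have g4: "R4 (B x y w) + B x y (R4 w) - B (R4 x) y w - B x (R4 y) w = 0"
    using h4[of x y w] by simp
  have "6 *\<^sub>R (B (R x) (R y) w - R (B x y (R w)))
     = (- 8) *\<^sub>R (T (G3 w) + G3 (T w)) + 3 *\<^sub>R (R4 (B x y w) + B x y (R4 w) - B (R4 x) y w - B x (R4 y) w)"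
  proof (rule linear_functional_eqI)
    fix f :: "'a \<Rightarrow> real" assume f: "linear f"
    show "f (6 *\<^sub>R (B (R x) (R y) w - R (B x y (R w)))) = f ((- 8) *\<^sub>R (T (G3 w) + G3 (T w))
        + 3 *\<^sub>R (R4 (B x y w) + B x y (R4 w) - B (R4 x) y w - B x (R4 y) w))"
      unfolding G3_def R R3 R4 expand linear_add[OF f] linear_diff[OF f] linear_cmul[OF f] real_scaleR_def
      by (simp add: algebra_simps)
  qed
  also have "\<dots> = 0" unfolding g3 g4 by (simp add: linear_0[OF T])
  finally show ?thesis by simp
qed

section \<open>Positive cone\<close>

lemmas [simp] = jprod.zero_left jprod.zero_right

text \<open>The multiplications by c^3 and c^4 are polynomials in the commuting multiplications by c
  and c^2 (\<open>R3\<close>, \<open>R4\<close>), so the derivation identities for four powers of c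
  can be combined by Newton's formula. This replaces an appeal to Macdonald's principle.\<close>

theorem fundamental_formula:
  fixes c x w :: "'a::jb_algebra"
  shows "quad_rep (quad_rep c x) w = quad_rep c (quad_rep x (quad_rep c w))"
proof -
  have com: "(c \<odot> c) \<odot> (c \<odot> v) = c \<odot> ((c \<odot> c) \<odot> v)" for v
    using jordan_identity[of c v] by (simp add: jprod_commute)
  have R3: "((c \<odot> c) \<odot> c) \<odot> v = 3 *\<^sub>R (c \<odot> ((c \<odot> c) \<odot> v)) - 2 *\<^sub>R (c \<odot> (c \<odot> (c \<odot> v)))" for v
  proof -
    have "((c \<odot> c) \<odot> c) \<odot> v = (c \<odot> ((c \<odot> c) \<odot> v) + c \<odot> ((c \<odot> c) \<odot> v) + c \<odot> ((c \<odot> c) \<odot> v))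
       - (c \<odot> (c \<odot> (c \<odot> v)) + c \<odot> (c \<odot> (c \<odot> v)))"
      using jprod_mult3[of c c c v] com[of v] by simp
    then show ?thesis by (simp add: scaleR_2 scaleR_left_distrib[of 2 1, simplified])
  qed
  have R4: "((c \<odot> c) \<odot> (c \<odot> c)) \<odot> v = (c \<odot> c) \<odot> ((c \<odot> c) \<odot> v)
     + 4 *\<^sub>R (c \<odot> (c \<odot> ((c \<odot> c) \<odot> v))) - 4 *\<^sub>R (c \<odot> (c \<odot> (c \<odot> (c \<odot> v))))" for v
  proof -
    have "((c \<odot> c) \<odot> (c \<odot> c)) \<odot> v = (c \<odot> c) \<odot> ((c \<odot> c) \<odot> v)
       + (((c \<odot> c) \<odot> c) \<odot> (c \<odot> v) + ((c \<odot> c) \<odot> c) \<odot> (c \<odot> v))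
       - (c \<odot> ((c \<odot> c) \<odot> (c \<odot> v)) + c \<odot> ((c \<odot> c) \<odot> (c \<odot> v)))"
      using jprod_mult3[of c c "c \<odot> c" v] by (simp add: jprod_commute[of c "c \<odot> c"])
    then show ?thesis unfolding R3 com
      by (rule ssubst) (rule linear_functional_eqI, simp add: linear_add linear_diff linear_cmul jprod_distribs)
  qed
  have lin: "linear (\<lambda>v. a \<odot> v)" for a :: 'a
    using jprod.bounded_linear_right by (rule bounded_linear.linear)
  have der: "a \<odot> quad_bil x y w + quad_bil x y (a \<odot> w) = quad_bil (a \<odot> x) y w + quad_bil x (a \<odot> y) w"
    for a x y w :: 'a by (rule quad_bil_derivation)
  have "quad_bil (quad_rep c x) (quad_rep c x) w = quad_rep c (quad_bil x x (quad_rep c w))"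
  proof (rule newton_identity_operators[where B=quad_bil and R="quad_rep c" and T="\<lambda>v. c \<odot> v"
      and S="\<lambda>v. (c \<odot> c) \<odot> v" and ?R3.0="\<lambda>v. ((c \<odot> c) \<odot> c) \<odot> v"
      and ?R4.0="\<lambda>v. ((c \<odot> c) \<odot> (c \<odot> c)) \<odot> v"])
    show "linear (\<lambda>x. quad_bil x y w)" "linear (\<lambda>y. quad_bil x y w)" "linear (quad_bil x y)" for x y w :: 'a
      by (rule linearI; simp add: quad_bil_def jprod_distribs algebra_simps)+
    show "quad_bil (c \<odot> x) y w = c \<odot> quad_bil x y w + quad_bil x y (c \<odot> w) - quad_bil x (c \<odot> y) w"
      "quad_bil ((c \<odot> c) \<odot> x) y w = (c \<odot> c) \<odot> quad_bil x y w + quad_bil x y ((c \<odot> c) \<odot> w)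
        - quad_bil x ((c \<odot> c) \<odot> y) w" for x y w
      unfolding eq_diff_eq by (rule der[symmetric])+
  qed (rule lin com R3 R4 der quad_rep_def)+
  then show ?thesis by (simp add: quad_rep_bil)
qed

text \<open>Turns orthogonality into a vanishing product: once the quadratic representations on the
  right vanish, so does the square of \<open>a \<odot> b\<close>, and with it
  \<open>a \<odot> b\<close>.\<close>

lemma jprod_square_quad:
  fixes a b :: "'a::jb_algebra"
  shows "4 *\<^sub>R ((a \<odot> b) \<odot> (a \<odot> b)) = 2 *\<^sub>R (a \<odot> quad_rep b a) + quad_rep a (b \<odot> b) + quad_rep b (a \<odot> a)"
proof -
  have eq: "a \<odot> (b \<odot> (b \<odot> a)) + b \<odot> (b \<odot> (a \<odot> a)) + a \<odot> (b \<odot> (a \<odot> b))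
       = (a \<odot> b) \<odot> (b \<odot> a) + (b \<odot> b) \<odot> (a \<odot> a) + (a \<odot> b) \<odot> (a \<odot> b)"
    by (rule jordan_linearized)
  show ?thesis
  proof (rule linear_functional_eqI)
    fix f :: "'a \<Rightarrow> real" assume f: "linear f"
    have c: "b \<odot> a = a \<odot> b" "(b \<odot> b) \<odot> (a \<odot> a) = (a \<odot> a) \<odot> (b \<odot> b)"
      "(b \<odot> b) \<odot> a = a \<odot> (b \<odot> b)" by (simp_all add: jprod_commute)
    show "f (4 *\<^sub>R ((a \<odot> b) \<odot> (a \<odot> b)))
       = f (2 *\<^sub>R (a \<odot> quad_rep b a) + quad_rep a (b \<odot> b) + quad_rep b (a \<odot> a))"
      using arg_cong[OF eq, of f] unfolding quad_rep_def jprod_distribs linear_add[OF f] linear_diff[OF f]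
        linear_cmul[OF f] real_scaleR_def c
      by (simp add: algebra_simps)
  qed
qed

section \<open>The closed subalgebra generated by an element and the unit\<close>

lemma jb_gen_subspace: "subspace (jb_gen e x)"
  unfolding jb_gen_def subspace_def by auto

lemma jb_gen_closed: "closed (jb_gen e x)"
  unfolding jb_gen_def by (rule closed_Inter) auto

lemma jb_gen_jprod: "a \<in> jb_gen e x \<Longrightarrow> b \<in> jb_gen e x \<Longrightarrow> a \<odot> b \<in> jb_gen e x"
  unfolding jb_gen_def by auto

lemma jb_gen_self: "x \<in> jb_gen e x"
  unfolding jb_gen_def by auto

lemma jb_gen_unit: "e \<in> jb_gen e x"
  unfolding jb_gen_def by auto

lemma jb_gen_least:
  "subspace S \<Longrightarrow> closed S \<Longrightarrow> (\<And>a b. a \<in> S \<Longrightarrow> b \<in> S \<Longrightarrow> a \<odot> b \<in> S) \<Longrightarrow> x \<in> S \<Longrightarrow> e \<in> S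
    \<Longrightarrow> jb_gen e x \<subseteq> S"
  unfolding jb_gen_def by blast

lemma jb_gen_mono: "a \<in> jb_gen e x \<Longrightarrow> jb_gen e a \<subseteq> jb_gen e x"
  by (rule jb_gen_least) (simp_all add: jb_gen_subspace jb_gen_closed jb_gen_jprod jb_gen_unit)

lemma jb_gen_trans: "b \<in> jb_gen e a \<Longrightarrow> a \<in> jb_gen e x \<Longrightarrow> b \<in> jb_gen e x"
  using jb_gen_mono by blast

lemma jb_gen_add: "a \<in> jb_gen e x \<Longrightarrow> b \<in> jb_gen e x \<Longrightarrow> a + b \<in> jb_gen e x"
  and jb_gen_diff: "a \<in> jb_gen e x \<Longrightarrow> b \<in> jb_gen e x \<Longrightarrow> a - b \<in> jb_gen e x"
  and jb_gen_scaleR: "a \<in> jb_gen e x \<Longrightarrow> c *\<^sub>R a \<in> jb_gen e x"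
  and jb_gen_zero: "0 \<in> jb_gen e x"
  by (simp_all add: jb_gen_subspace subspace_add subspace_diff subspace_scale subspace_0)

lemmas jb_gen_intros = jb_gen_self jb_gen_unit jb_gen_add jb_gen_diff jb_gen_scaleR jb_gen_zero jb_gen_jprod

text \<open>Iterating \<open>y \<mapsto> (t + y\<^sup>2) / 2\<close> solves \<open>(e - y)\<^sup>2 = e - t\<close>; the iterates are power series in
  \<open>t\<close> with non-negative coefficients, so those for \<open>t = 1\<close> in the reals are a majorant.\<close>

primrec sqrt_iter :: "'a::jb_algebra \<Rightarrow> nat \<Rightarrow> 'a" where
  "sqrt_iter t 0 = 0"
| "sqrt_iter t (Suc n) = (1 / 2) *\<^sub>R (t + sqrt_iter t n \<odot> sqrt_iter t n)"

primrec sqrt_majorant :: "nat \<Rightarrow> real" where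
  "sqrt_majorant 0 = 0"
| "sqrt_majorant (Suc n) = (1 + (sqrt_majorant n)\<^sup>2) / 2"

lemma sqrt_majorant_bounds: "0 \<le> sqrt_majorant n" "sqrt_majorant n \<le> 1"
proof -
  have "0 \<le> sqrt_majorant n \<and> sqrt_majorant n \<le> 1"
    by (induction n) (auto simp: power_le_one)
  then show "0 \<le> sqrt_majorant n" "sqrt_majorant n \<le> 1" by auto
qed

lemma sqrt_majorant_Suc: "sqrt_majorant n \<le> sqrt_majorant (Suc n)"
proof -
  have "0 \<le> (1 - sqrt_majorant n)\<^sup>2" by simp
  then show ?thesis by (simp add: power2_eq_square algebra_simps)
qed

lemma norm_sqrt_iter:
  assumes "norm t \<le> 1"
  shows "norm (sqrt_iter t n) \<le> sqrt_majorant n"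
proof (induction n)
  case (Suc n)
  have "norm (t + sqrt_iter t n \<odot> sqrt_iter t n) \<le> norm t + norm (sqrt_iter t n \<odot> sqrt_iter t n)"
    by (rule norm_triangle_ineq)
  also have "\<dots> \<le> 1 + (sqrt_majorant n)\<^sup>2"
    using assms power_mono[OF Suc norm_ge_zero, of 2] by (simp add: norm_jsquare)
  finally show ?case by simp
qed simp

text \<open>The increments obey the recursion of the majorant because a^2 - b^2 = (a + b)(a - b)
  holds by commutativity. The bound telescopes, which gives convergence also in the boundary case
  norm t = 1, where the iteration is no uniform contraction.\<close>

lemma norm_sqrt_iter_step:
  assumes t: "norm t \<le> 1"
  shows "norm (sqrt_iter t (Suc n) - sqrt_iter t n) \<le> sqrt_majorant (Suc n) - sqrt_majorant n"
proof (induction n)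
  case (Suc n)
  let ?a = "sqrt_iter t (Suc n)" and ?b = "sqrt_iter t n"
  let ?r = "sqrt_majorant (Suc n)" and ?s = "sqrt_majorant n"
  have "sqrt_iter t (Suc (Suc n)) - ?a = (1 / 2) *\<^sub>R (t + ?a \<odot> ?a) - (1 / 2) *\<^sub>R (t + ?b \<odot> ?b)"
    by (simp only: sqrt_iter.simps)
  also have "\<dots> = (1 / 2) *\<^sub>R ((?a + ?b) \<odot> (?a - ?b))"
    by (simp add: jprod_distribs jprod_commute[of ?b ?a] scaleR_diff_right[symmetric] del: sqrt_iter.simps)
  finally have "norm (sqrt_iter t (Suc (Suc n)) - ?a) = norm ((?a + ?b) \<odot> (?a - ?b)) / 2"
    by (simp only: norm_scaleR)
  also have "\<dots> \<le> (norm (?a + ?b) * norm (?a - ?b)) / 2"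
    by (simp add: norm_jprod_le del: sqrt_iter.simps)
  also have "\<dots> \<le> ((?r + ?s) * (?r - ?s)) / 2"
  proof -
    have "norm (?a + ?b) \<le> ?r + ?s"
      using norm_triangle_ineq[of ?a ?b] norm_sqrt_iter[OF t, of n] norm_sqrt_iter[OF t, of "Suc n"]
      by linarith
    with Suc show ?thesis by (intro divide_right_mono mult_mono) (auto intro: order_trans[OF norm_ge_zero])
  qed
  also have "\<dots> = sqrt_majorant (Suc (Suc n)) - ?r"
    by (simp add: power2_eq_square field_simps)
  finally show ?case .
qed (use t in simp)

lemma sqrt_iter_convergent:
  assumes t: "norm t \<le> 1"
  shows "convergent (sqrt_iter t)"
proof -
  have "incseq sqrt_majorant" by (rule incseq_SucI) (rule sqrt_majorant_Suc)
  then obtain L where "sqrt_majorant \<longlonglongrightarrow> L"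
    using incseq_convergent[of sqrt_majorant 1] sqrt_majorant_bounds(2) by blast
  then have "Cauchy sqrt_majorant" by (rule LIMSEQ_imp_Cauchy)
  moreover have le: "norm (sqrt_iter t m - sqrt_iter t n) \<le> sqrt_majorant m - sqrt_majorant n" if "n \<le> m" for m n
    using that
  proof (induction m rule: dec_induct)
    case (step m)
    have "norm (sqrt_iter t (Suc m) - sqrt_iter t n)
        \<le> norm (sqrt_iter t (Suc m) - sqrt_iter t m) + norm (sqrt_iter t m - sqrt_iter t n)"
      using norm_triangle_ineq[of "sqrt_iter t (Suc m) - sqrt_iter t m" "sqrt_iter t m - sqrt_iter t n"] by simp
    with step norm_sqrt_iter_step[OF t, of m] show ?case by linarith
  qed simp
  ultimately have "Cauchy (sqrt_iter t)"
    unfolding Cauchy_altdef2 dist_norm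
  proof (intro allI impI)
    fix \<epsilon> :: real assume "0 < \<epsilon>" and C: "\<forall>\<epsilon>>0. \<exists>N. \<forall>n\<ge>N. norm (sqrt_majorant n - sqrt_majorant N) < \<epsilon>"
    then obtain N where N: "\<And>n. n \<ge> N \<Longrightarrow> \<bar>sqrt_majorant n - sqrt_majorant N\<bar> < \<epsilon>" by force
    have "norm (sqrt_iter t n - sqrt_iter t N) < \<epsilon>" if "n \<ge> N" for n
      using le[OF that] N[OF that] by linarith
    then show "\<exists>N. \<forall>n\<ge>N. norm (sqrt_iter t n - sqrt_iter t N) < \<epsilon>" by blast
  qed
  then show ?thesis by (simp add: Cauchy_convergent)
qed

section \<open>Metric description of the cone of squares\<close>

locale unital_jb =
  fixes e :: "'a::jb_algebra"
  assumes is_unit: "is_junit e"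
begin

lemma unit_left [simp]: "e \<odot> x = x"
  using is_unit by (simp add: is_junit_def)

lemma unit_right [simp]: "x \<odot> e = x"
  by (metis jprod_commute unit_left)

lemma norm_unit_le: "norm e \<le> 1"
proof (rule ccontr)
  assume "\<not> norm e \<le> 1"
  then show False using norm_jsquare[of e] by (auto simp: power2_eq_square)
qed

lemma trivial_if_unit_zero: "e = 0 \<Longrightarrow> (x :: 'a) = 0"
  using unit_left[of x] by (simp add: jprod.zero_left)

lemma square_root_exists:
  assumes "norm (e - c) \<le> 1"
  shows "\<exists>d\<in>jb_gen e c. d \<odot> d = c \<and> norm (e - d) \<le> 1"
proof -
  define t where "t = e - c"
  have t: "norm t \<le> 1" using assms by (simp add: t_def)
  obtain l where l: "sqrt_iter t \<longlonglongrightarrow> l" using sqrt_iter_convergent[OF t] by (auto simp: convergent_def)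
  have mem: "sqrt_iter t n \<in> jb_gen e c" for n
    by (induction n) (auto simp: t_def intro!: jb_gen_intros)
  have "(\<lambda>n. (1 / 2) *\<^sub>R (t + sqrt_iter t n \<odot> sqrt_iter t n)) \<longlonglongrightarrow> (1 / 2) *\<^sub>R (t + l \<odot> l)"
    by (intro tendsto_intros jprod.tendsto l)
  moreover have "(\<lambda>n. sqrt_iter t (Suc n)) \<longlonglongrightarrow> l" using l by (rule LIMSEQ_Suc)
  ultimately have "l = (1 / 2) *\<^sub>R (t + l \<odot> l)" using LIMSEQ_unique by auto
  then have "2 *\<^sub>R l = 2 *\<^sub>R ((1 / 2) *\<^sub>R (t + l \<odot> l))" by (rule arg_cong)
  then have "t + l \<odot> l = l + l" by (simp add: scaleR_2)
  then have "(e - l) \<odot> (e - l) = c"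
    by (simp add: jprod_distribs t_def algebra_simps)
  moreover have "e - l \<in> jb_gen e c"
    using closed_sequentially[OF jb_gen_closed _ l] mem by (auto intro!: jb_gen_intros)
  moreover have "norm (e - (e - l)) \<le> 1"
  proof -
    have "norm (sqrt_iter t n) \<le> 1" for n
      using norm_sqrt_iter[OF t, of n] sqrt_majorant_bounds(2)[of n] by linarith
    then show ?thesis using tendsto_norm[OF l] by (auto intro: LIMSEQ_le_const2)
  qed
  ultimately show ?thesis by blast
qed

text \<open>Together with \<open>jpos_norm\<close>: for r at least norm c, being a square means
  lying within distance r of r e. This metric description is what makes the squares a closed convex
  cone.\<close>

lemma jposI_norm:
  assumes "norm (r *\<^sub>R e - c) \<le> r"
  shows "\<exists>d\<in>jb_gen e c. d \<odot> d = c \<and> norm (sqrt r *\<^sub>R e - d) \<le> sqrt r"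
proof (cases "r = 0")
  case True
  then have "c = 0" using assms by simp
  then show ?thesis using True by (auto intro!: bexI[of _ 0] jb_gen_intros simp: jprod.zero_left)
next
  case False
  with assms have r: "r > 0" using order_trans[OF norm_ge_zero assms] by simp
  have "norm (e - (1 / r) *\<^sub>R c) = norm ((1 / r) *\<^sub>R (r *\<^sub>R e - c))"
    using r by (simp add: scaleR_diff_right)
  also have "\<dots> \<le> 1" using assms r by (simp del: scaleR_diff_right)
  finally obtain d where d: "d \<in> jb_gen e ((1 / r) *\<^sub>R c)" "d \<odot> d = (1 / r) *\<^sub>R c" "norm (e - d) \<le> 1"
    using square_root_exists by blast
  have "d \<in> jb_gen e c" using d(1) by (rule jb_gen_trans) (intro jb_gen_intros)
  moreover have "(sqrt r *\<^sub>R d) \<odot> (sqrt r *\<^sub>R d) = c" using r d(2) by (simp add: jprod_distribs)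
  moreover have "norm (sqrt r *\<^sub>R e - sqrt r *\<^sub>R d) \<le> sqrt r"
  proof -
    have "norm (sqrt r *\<^sub>R e - sqrt r *\<^sub>R d) = sqrt r * norm (e - d)"
      using r by (simp flip: scaleR_diff_right)
    also have "\<dots> \<le> sqrt r" using d(3) r by (simp add: mult_left_le)
    finally show ?thesis .
  qed
  ultimately show ?thesis by (auto intro: jb_gen_intros)
qed

lemma jposI_norm': "norm (r *\<^sub>R e - c) \<le> r \<Longrightarrow> c \<in> jpos"
  using jposI_norm unfolding jpos_def by blast

text \<open>After scaling to norm at most 1, e - c' has a square root k because e - (e - c') is
  small. Then k^2 plus the square c' is e, and \<open>norm_jsquare_le\<close> bounds norm (e -
  c').\<close>

lemma jpos_norm:
  assumes "c \<in> jpos" "norm c \<le> r"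
  shows "norm (r *\<^sub>R e - c) \<le> r"
proof (cases "r = 0")
  case True
  then show ?thesis using assms by simp
next
  case False
  with assms have r: "r > 0" using order_trans[OF norm_ge_zero assms(2)] by simp
  obtain d where d: "c = d \<odot> d" using assms(1) by (auto simp: jpos_def)
  define c' where "c' = (1 / r) *\<^sub>R c"
  have c': "c' = ((1 / sqrt r) *\<^sub>R d) \<odot> ((1 / sqrt r) *\<^sub>R d)"
    using r by (simp add: c'_def d jprod_distribs)
  have "norm (e - (e - c')) \<le> 1" using assms(2) r by (simp add: c'_def)
  then obtain k where k: "k \<odot> k = e - c'" using square_root_exists by blast
  have "norm (k \<odot> k) \<le> norm (k \<odot> k + ((1 / sqrt r) *\<^sub>R d) \<odot> ((1 / sqrt r) *\<^sub>R d))" by (rule norm_jsquare_le)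
  also have "\<dots> = norm e" unfolding k c' by simp
  finally have "norm (e - c') \<le> 1" unfolding k using norm_unit_le by simp
  moreover have "r *\<^sub>R e - c = r *\<^sub>R (e - c')" using r by (simp add: c'_def scaleR_diff_right)
  ultimately show ?thesis using r by (simp add: mult_left_le)
qed

lemma square_root_pos:
  assumes "c \<in> jpos"
  shows "\<exists>d\<in>jb_gen e c. d \<in> jpos \<and> d \<odot> d = c"
  using jposI_norm[OF jpos_norm[OF assms order_refl]] jposI_norm' by blast

lemma jpos_zero [simp]: "(0::'a) \<in> jpos"
  by (rule jposI_norm'[of 0]) simp

lemma jpos_square [simp]: "(x::'a) \<odot> x \<in> jpos"
  by (auto simp: jpos_def)

lemma jpos_unit [simp]: "e \<in> jpos"
  using jpos_square[of e] by simp

lemma jpos_scaleR: "(c::'a) \<in> jpos \<Longrightarrow> 0 \<le> s \<Longrightarrow> s *\<^sub>R c \<in> jpos"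
proof -
  assume "c \<in> jpos" "0 \<le> s"
  then obtain d where "c = d \<odot> d" by (auto simp: jpos_def)
  then have "s *\<^sub>R c = (sqrt s *\<^sub>R d) \<odot> (sqrt s *\<^sub>R d)" using \<open>0 \<le> s\<close> by (simp add: jprod_distribs)
  then show ?thesis by simp
qed

lemma jpos_add: "(a::'a) \<in> jpos \<Longrightarrow> b \<in> jpos \<Longrightarrow> a + b \<in> jpos"
proof -
  assume "a \<in> jpos" "b \<in> jpos"
  then have "norm (norm a *\<^sub>R e - a) \<le> norm a" "norm (norm b *\<^sub>R e - b) \<le> norm b"
    using jpos_norm by auto
  then have "norm ((norm a *\<^sub>R e - a) + (norm b *\<^sub>R e - b)) \<le> norm a + norm b"
    by (rule norm_triangle_mono)
  then show ?thesis by (intro jposI_norm'[of "norm a + norm b"]) (simp add: algebra_simps)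
qed

lemma jpos_antisym:
  assumes "(a::'a) \<in> jpos" "- a \<in> jpos"
  shows "a = 0"
proof -
  obtain x y where "a = x \<odot> x" "- a = y \<odot> y" using assms by (auto simp: jpos_def)
  then have "norm a \<le> norm (a + - a)" using norm_jsquare_le[of x y] by metis
  then show ?thesis by simp
qed

lemma jpos_closed: "closed (jpos :: 'a set)"
proof -
  have eq: "jpos = {c :: 'a. norm (norm c *\<^sub>R e - c) \<le> norm c}"
    using jpos_norm jposI_norm' by blast
  show ?thesis unfolding eq by (intro closed_Collect_le continuous_intros)
qed

lemma unit_minus_pos: "norm c \<le> r \<Longrightarrow> r *\<^sub>R e - c \<in> jpos"
  by (rule jposI_norm'[of r]) (simp)

lemma unit_plus_pos: "norm c \<le> r \<Longrightarrow> r *\<^sub>R e + c \<in> jpos"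
  by (rule jposI_norm'[of r]) simp

lemma jle_refl [simp]: "(x::'a) \<preceq> x"
  by (simp add: jle_def)

lemma jle_trans [trans]: "(x::'a) \<preceq> y \<Longrightarrow> y \<preceq> z \<Longrightarrow> x \<preceq> z"
  unfolding jle_def using jpos_add[of "y - x" "z - y"] by simp

lemma jle_antisym: "(x::'a) \<preceq> y \<Longrightarrow> y \<preceq> x \<Longrightarrow> x = y"
  unfolding jle_def using jpos_antisym[of "y - x"] by simp

lemma jle_add_cancel [simp]: "(x::'a) + u \<preceq> y + u \<longleftrightarrow> x \<preceq> y" "(u::'a) + x \<preceq> u + y \<longleftrightarrow> x \<preceq> y"
  unfolding jle_def by (simp_all add: algebra_simps)

lemma jle_scaleR: "(x::'a) \<preceq> y \<Longrightarrow> 0 \<le> c \<Longrightarrow> c *\<^sub>R x \<preceq> c *\<^sub>R y"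
  unfolding jle_def using jpos_scaleR[of "y - x" c] by (simp add: scaleR_diff_right)

lemma jle_scaleR_left: "(x::'a) \<in> jpos \<Longrightarrow> c \<le> d \<Longrightarrow> c *\<^sub>R x \<preceq> d *\<^sub>R x"
  unfolding jle_def using jpos_scaleR[of x "d - c"] by (simp add: scaleR_diff_left)

lemma jle_zero_iff: "0 \<preceq> (x::'a) \<longleftrightarrow> x \<in> jpos"
  by (simp add: jle_def)

lemma jle_closed:
  fixes x y u :: 'a
  assumes "\<And>\<epsilon>. 0 < \<epsilon> \<Longrightarrow> x \<preceq> y + \<epsilon> *\<^sub>R u"
  shows "x \<preceq> y"
proof -
  have lim: "(\<lambda>n. (y + (1 / real (Suc n)) *\<^sub>R u) - x) \<longlonglongrightarrow> (y + 0 *\<^sub>R u) - x"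
    by (intro tendsto_intros LIMSEQ_inverse_real_of_nat[unfolded inverse_eq_divide])
  have "(y + (1 / real (Suc n)) *\<^sub>R u) - x \<in> jpos" for n
    using assms[of "1 / real (Suc n)"] by (simp add: jle_def)
  then have "(y + 0 *\<^sub>R u) - x \<in> jpos"
    by (rule closed_sequentially[OF jpos_closed _ lim])
  then show ?thesis by (simp add: jle_def)
qed

end

section \<open>The subalgebra generated by an element\<close>

lemma map_poly_of_real_add:
  "map_poly of_real (p + q) = map_poly of_real p + (map_poly of_real q :: complex poly)"
  by (rule poly_eqI) (simp add: coeff_map_poly)

lemma poly_map_poly_of_real_mult:
  "poly (map_poly of_real (p * q)) z = poly (map_poly of_real p) z * poly (map_poly of_real q) (z::complex)"
proof (induction p)
  case (pCons a p)
  have "map_poly of_real (smult a q) = smult (of_real a) (map_poly of_real q :: complex poly)"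
    by (rule poly_eqI) (simp add: coeff_map_poly)
  with pCons show ?case
    by (simp add: mult_pCons_left map_poly_of_real_add map_poly_pCons algebra_simps)
qed simp

text \<open>Non-real roots are collected in factors (X - a)^2 + b^2, the shape in which
  \<open>jpoly_invertible\<close> reads off their invertibility.\<close>

lemma real_poly_factor:
  fixes q :: "real poly"
  assumes "degree q \<noteq> 0"
  obtains (linear) r q' where "q = [:- r, 1:] * q'"
  | (quadratic) a b q' where "b \<noteq> 0" "q = ([:- a, 1:] * [:- a, 1:] + [:b\<^sup>2:]) * q'"
proof -
  let ?c = "map_poly of_real :: real poly \<Rightarrow> complex poly"
  have "degree (?c q) \<noteq> 0" using assms by (subst degree_map_poly) auto
  then have "\<not> constant (poly (?c q))" by (simp add: constant_degree)
  from fundamental_theorem_of_algebra[OF this] obtain z where z: "poly (?c q) z = 0" by blast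
  show ?thesis
  proof (cases "Im z = 0")
    case True
    then have zr: "z = of_real (Re z)" by (simp add: complex_eq_iff)
    have "poly (?c p) (of_real r) = of_real (poly p r)" for p r
      by (induction p) (simp_all add: map_poly_pCons)
    with z zr have "poly q (Re z) = 0" by (metis of_real_eq_0_iff)
    then have "[:- Re z, 1:] dvd q" by (simp add: poly_eq_0_iff_dvd)
    then show ?thesis using linear by (auto elim: dvdE)
  next
    case False
    define d where "d = [:- Re z, 1:] * [:- Re z, 1:] + [:(Im z)\<^sup>2:]"
    have deg: "degree d = 2" by (simp add: d_def)
    have "poly (?c d) z = 0"
    proof -
      have "d = [:(Re z)\<^sup>2 + (Im z)\<^sup>2, - 2 * Re z, 1:]" by (simp add: d_def power2_eq_square)
      then show ?thesis by (simp add: map_poly_pCons complex_eq_iff power2_eq_square algebra_simps)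
    qed
    moreover have "?c q = ?c (d * (q div d)) + ?c (q mod d)"
      by (metis map_poly_of_real_add mult_div_mod_eq)
    ultimately have m: "poly (?c (q mod d)) z = 0"
      using z by (simp add: poly_map_poly_of_real_mult)
    have "degree (q mod d) < 2" using degree_mod_less'[of d q] deg by (cases "q mod d = 0"; cases "d = 0") auto
    then have "q mod d = [:coeff (q mod d) 0, coeff (q mod d) 1:]"
      by (intro poly_eqI) (auto simp: coeff_pCons coeff_eq_0 numeral_2_eq_2 split: nat.splits)
    then obtain u v where uv: "q mod d = [:u, v:]" by blast
    \<comment> \<open>A real polynomial of degree at most 1 that vanishes at the non-real
      \<open>z\<close> is zero.\<close>
    with m False have "q mod d = 0" by (auto simp: map_poly_pCons complex_eq_iff)
    then have "q = d * (q div d)" by (metis add.right_neutral mult_div_mod_eq)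
    then show ?thesis using quadratic[of "Im z" "Re z" "q div d"] False by (simp add: d_def)
  qed
qed

context unital_jb
begin

section \<open>Polynomials in one element and power associativity\<close>

definition jpoly :: "'a \<Rightarrow> real poly \<Rightarrow> 'a" where
  "jpoly x p = fold_coeffs (\<lambda>a y. a *\<^sub>R e + x \<odot> y) p 0"

lemma jpoly_0 [simp]: "jpoly x 0 = 0"
  by (simp add: jpoly_def)

lemma jpoly_pCons [simp]: "jpoly x (pCons a p) = a *\<^sub>R e + x \<odot> jpoly x p"
  by (cases "p = 0 \<and> a = 0") (auto simp add: jpoly_def)

lemma jpoly_add: "jpoly x (p + q) = jpoly x p + jpoly x q"
  by (induction p q rule: poly_induct2) (simp_all add: jprod_distribs algebra_simps)

lemma jpoly_smult: "jpoly x (smult c p) = c *\<^sub>R jpoly x p"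
  by (induction p) (simp_all add: jprod_distribs algebra_simps)

lemma jpoly_diff: "jpoly x (p - q) = jpoly x p - jpoly x q"
  using jpoly_add[of x p "- q"] jpoly_smult[of x "-1" q] by simp

lemma jpoly_in_gen: "jpoly x p \<in> jb_gen e x"
  by (induction p) (auto intro!: jb_gen_intros)

text \<open>Power associativity is reached through operators: multiplication by \<open>b\<close> is
  to commute with every linear map that commutes with the multiplications by x and x^2. These two
  commute with each other by the Jordan identity, which starts the argument.\<close>

definition in_bicommutant :: "'a \<Rightarrow> 'a \<Rightarrow> bool" where
  "in_bicommutant x b \<longleftrightarrow> (\<forall>T. linear T \<longrightarrow> (\<forall>w. T (x \<odot> w) = x \<odot> T w) \<longrightarrow>
     (\<forall>w. T ((x \<odot> x) \<odot> w) = (x \<odot> x) \<odot> T w) \<longrightarrow> (\<forall>w. T (b \<odot> w) = b \<odot> T w))"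

text \<open>The claim is carried along for x times p(x) as well, because the recursion is of second
  order: \<open>jprod_mult3\<close> expresses the multiplication by x (x b) through those by b and x
  b.\<close>

lemma in_bicommutant_jpoly: "in_bicommutant x (jpoly x p) \<and> in_bicommutant x (x \<odot> jpoly x p)"
proof (induction p)
  case 0
  then show ?case by (simp add: in_bicommutant_def linear_0)
next
  case (pCons a p)
  let ?b = "jpoly x p"
  have "in_bicommutant x (a *\<^sub>R e + x \<odot> ?b)"
    using pCons unfolding in_bicommutant_def
    by (simp add: jprod_distribs linear_add linear_cmul)
  moreover have "in_bicommutant x (a *\<^sub>R x + x \<odot> (x \<odot> ?b))"
    unfolding in_bicommutant_def
  proof (intro allI impI)
    fix T :: "'a \<Rightarrow> 'a" and w
    assume T: "linear T" and 1: "\<forall>w. T (x \<odot> w) = x \<odot> T w"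
      and 2: "\<forall>w. T ((x \<odot> x) \<odot> w) = (x \<odot> x) \<odot> T w"
    have 3: "T (?b \<odot> w) = ?b \<odot> T w" "T ((x \<odot> ?b) \<odot> w) = (x \<odot> ?b) \<odot> T w" for w
      using pCons T 1 2 unfolding in_bicommutant_def by blast+
    have 4: "(x \<odot> (x \<odot> ?b)) \<odot> w = (x \<odot> ?b) \<odot> (x \<odot> w) + (x \<odot> x) \<odot> (?b \<odot> w) + (x \<odot> ?b) \<odot> (x \<odot> w)
     - ?b \<odot> (x \<odot> (x \<odot> w)) - x \<odot> (x \<odot> (?b \<odot> w))" for w
      using jprod_mult3[of ?b x x w] by (simp add: jprod_commute[of ?b x] jprod_commute[of "x \<odot> ?b" x])
    show "T ((a *\<^sub>R x + x \<odot> (x \<odot> ?b)) \<odot> w) = (a *\<^sub>R x + x \<odot> (x \<odot> ?b)) \<odot> T w"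
      by (simp add: jprod.add_left jprod.scaleR_left linear_add[OF T] linear_diff[OF T] linear_cmul[OF T] 1 2 3 4)
  qed
  ultimately show ?case by (simp add: jprod_distribs)
qed

lemma jprod_linear: "linear (\<lambda>w. a \<odot> (w::'a))"
  using jprod.bounded_linear_right by (rule bounded_linear.linear)

text \<open>The bicommutant property is used first for the multiplications by x and x^2, and then,
  with what this gives, for the multiplication by p(x).\<close>

lemma jpoly_operator_commute: "jpoly x p \<odot> (jpoly x q \<odot> w) = jpoly x q \<odot> (jpoly x p \<odot> w)"
proof -
  have com: "(x \<odot> x) \<odot> (x \<odot> v) = x \<odot> ((x \<odot> x) \<odot> v)" for v
    using jordan_identity[of x v] by (simp add: jprod_commute)
  have B: "T (jpoly x r \<odot> w) = jpoly x r \<odot> T w"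
    if "linear T" "\<And>w. T (x \<odot> w) = x \<odot> T w" "\<And>w. T ((x \<odot> x) \<odot> w) = (x \<odot> x) \<odot> T w" for T r w
    using in_bicommutant_jpoly[of x r] that unfolding in_bicommutant_def by blast
  have 1: "x \<odot> (jpoly x r \<odot> w) = jpoly x r \<odot> (x \<odot> w)" for r w
    by (rule B[of "\<lambda>w. x \<odot> w"]) (simp_all add: jprod_linear com)
  have 2: "(x \<odot> x) \<odot> (jpoly x r \<odot> w) = jpoly x r \<odot> ((x \<odot> x) \<odot> w)" for r w
    by (rule B[of "\<lambda>w. (x \<odot> x) \<odot> w"]) (simp_all add: jprod_linear com)
  show ?thesis
    by (rule B[of "\<lambda>w. jpoly x p \<odot> w"]) (simp_all add: jprod_linear 1 2)
qed

lemma jpoly_mult: "jpoly x (p * q) = jpoly x p \<odot> jpoly x q"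
proof (induction p)
  case (pCons a p)
  have "jpoly x q \<odot> (x \<odot> jpoly x p) = x \<odot> (jpoly x q \<odot> jpoly x p)"
    using jpoly_operator_commute[of x q "[:0, 1:]" "jpoly x p"] by simp
  with pCons show ?case
    by (simp add: mult_pCons_left jpoly_add jpoly_smult jprod_distribs jprod_commute[of _ "jpoly x q"])
qed simp

lemma jb_gen_eq_closure: "jb_gen e x = closure (range (jpoly x))"
proof
  have sub: "subspace (range (jpoly x))"
  proof (rule subspaceI)
    show "0 \<in> range (jpoly x)" by (rule range_eqI[of _ _ 0]) simp
  next
    fix a b assume "a \<in> range (jpoly x)" "b \<in> range (jpoly x)"
    then obtain p q where "a = jpoly x p" "b = jpoly x q" by blast
    then show "a + b \<in> range (jpoly x)" by (intro range_eqI[of _ _ "p + q"]) (simp add: jpoly_add)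
  next
    fix c a assume "a \<in> range (jpoly x)"
    then obtain p where "a = jpoly x p" by blast
    then show "c *\<^sub>R a \<in> range (jpoly x)" by (intro range_eqI[of _ _ "smult c p"]) (simp add: jpoly_smult)
  qed
  have "subspace (closure (range (jpoly x)))"
  proof (rule subspaceI)
    show "0 \<in> closure (range (jpoly x))" by (rule subsetD[OF closure_subset subspace_0[OF sub]])
  next
    fix a b assume "a \<in> closure (range (jpoly x))" "b \<in> closure (range (jpoly x))"
    then obtain f g where f: "\<And>n. f n \<in> range (jpoly x)" "f \<longlonglongrightarrow> a"
      and g: "\<And>n. g n \<in> range (jpoly x)" "g \<longlonglongrightarrow> b" unfolding closure_sequential by blast
    show "a + b \<in> closure (range (jpoly x))" unfolding closure_sequential
      by (intro exI[of _ "\<lambda>n. f n + g n"] conjI allI tendsto_add f g subspace_add sub)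
  next
    fix c a assume "a \<in> closure (range (jpoly x))"
    then obtain f where f: "\<And>n. f n \<in> range (jpoly x)" "f \<longlonglongrightarrow> a" unfolding closure_sequential by blast
    show "c *\<^sub>R a \<in> closure (range (jpoly x))" unfolding closure_sequential
      by (intro exI[of _ "\<lambda>n. c *\<^sub>R f n"] conjI allI tendsto_scaleR tendsto_const f subspace_scale sub)
  qed
  then show "jb_gen e x \<subseteq> closure (range (jpoly x))"
  proof (rule jb_gen_least)
    fix a b assume "a \<in> closure (range (jpoly x))" "b \<in> closure (range (jpoly x))"
    then obtain f g where f: "\<And>n. f n \<in> range (jpoly x)" "f \<longlonglongrightarrow> a"
      and g: "\<And>n. g n \<in> range (jpoly x)" "g \<longlonglongrightarrow> b" unfolding closure_sequential by blast
    have "f n \<odot> g n \<in> range (jpoly x)" for n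
    proof -
      obtain p q where "f n = jpoly x p" "g n = jpoly x q" using f(1)[of n] g(1)[of n] by blast
      then show ?thesis by (intro range_eqI[of _ _ "p * q"]) (simp add: jpoly_mult)
    qed
    with jprod.tendsto[OF f(2) g(2)] show "a \<odot> b \<in> closure (range (jpoly x))"
      unfolding closure_sequential by (intro exI[of _ "\<lambda>n. f n \<odot> g n"]) auto
  next
    have "jpoly x [:0, 1:] = x" "jpoly x [:1:] = e" by simp_all
    then show "x \<in> closure (range (jpoly x))" "e \<in> closure (range (jpoly x))"
      by (metis closure_subset rangeI subsetD)+
  qed simp_all
  show "closure (range (jpoly x)) \<subseteq> jb_gen e x"
    by (rule closure_minimal) (auto simp: jpoly_in_gen jb_gen_closed)
qed

lemma jb_gen_operator_commute:
  assumes "a \<in> jb_gen e x" "b \<in> jb_gen e x"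
  shows "a \<odot> (b \<odot> w) = b \<odot> (a \<odot> w)"
proof -
  have closed: "closed {a. \<forall>w. a \<odot> (b \<odot> w) = b \<odot> (a \<odot> w)}" for b :: 'a
    by (intro closed_Collect_all closed_Collect_eq continuous_intros jprod.continuous_on)
  have 1: "a \<odot> (jpoly x p \<odot> w) = jpoly x p \<odot> (a \<odot> w)" if "a \<in> jb_gen e x" for a p w
  proof -
    have "closure (range (jpoly x)) \<subseteq> {a. \<forall>w. a \<odot> (jpoly x p \<odot> w) = jpoly x p \<odot> (a \<odot> w)}"
      by (rule closure_minimal[OF _ closed]) (auto simp: jpoly_operator_commute)
    then show ?thesis using that by (auto simp: jb_gen_eq_closure)
  qed
  have "closure (range (jpoly x)) \<subseteq> {b. \<forall>w. b \<odot> (a \<odot> w) = a \<odot> (b \<odot> w)}"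
    by (rule closure_minimal[OF _ closed]) (auto simp: 1[OF assms(1)])
  then show ?thesis using assms(2) by (auto simp: jb_gen_eq_closure)
qed

lemma jb_gen_assoc:
  assumes "a \<in> jb_gen e x" "b \<in> jb_gen e x" "c \<in> jb_gen e x"
  shows "(a \<odot> b) \<odot> c = a \<odot> (b \<odot> c)"
  using jb_gen_operator_commute[OF assms(1,3), of b] by (simp add: jprod_commute)

lemma jpos_jprod:
  assumes "a \<in> jb_gen e x" "b \<in> jb_gen e x" "a \<in> jpos" "b \<in> jpos"
  shows "a \<odot> b \<in> jpos"
proof -
  obtain c d where c: "c \<in> jb_gen e x" "c \<odot> c = a" and d: "d \<in> jb_gen e x" "d \<odot> d = b"
    using square_root_pos[OF assms(3)] square_root_pos[OF assms(4)] assms(1,2) jb_gen_trans by metis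
  have "(c \<odot> d) \<odot> (c \<odot> d) = a \<odot> b"
  proof -
    have "(c \<odot> d) \<odot> (c \<odot> d) = c \<odot> (d \<odot> (c \<odot> d))"
      by (intro jb_gen_assoc[of _ x] jb_gen_jprod c d)
    also have "d \<odot> (c \<odot> d) = c \<odot> b"
      using jb_gen_operator_commute[OF d(1) c(1), of d] by (simp add: d)
    also have "c \<odot> (c \<odot> b) = a \<odot> b"
      using jb_gen_assoc[OF c(1) c(1) assms(2)] by (simp add: c)
    finally show ?thesis .
  qed
  then show ?thesis using jpos_square[of "c \<odot> d"] by simp
qed

text \<open>The norm is the order unit norm. From order to norm, the positive product (c e - x)(c e
  + x) = c^2 e - x^2 is a square whose sum with x^2 is c^2 e, and \<open>norm_jsquare_le\<close>
  applies.\<close>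

lemma norm_le_iff:
  fixes x :: 'a
  assumes "0 \<le> c"
  shows "norm x \<le> c \<longleftrightarrow> c *\<^sub>R e - x \<in> jpos \<and> c *\<^sub>R e + x \<in> jpos"
proof
  assume "c *\<^sub>R e - x \<in> jpos \<and> c *\<^sub>R e + x \<in> jpos"
  then have "(c *\<^sub>R e - x) \<odot> (c *\<^sub>R e + x) \<in> jpos"
    by (intro jpos_jprod[of _ x]) (auto intro!: jb_gen_intros)
  moreover have "(c *\<^sub>R e - x) \<odot> (c *\<^sub>R e + x) = c\<^sup>2 *\<^sub>R e - x \<odot> x"
    by (simp add: jprod_distribs power2_eq_square algebra_simps)
  ultimately obtain m where m: "m \<odot> m = c\<^sup>2 *\<^sub>R e - x \<odot> x" by (auto simp: jpos_def)
  have "(norm x)\<^sup>2 \<le> norm (x \<odot> x + m \<odot> m)"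
    using norm_jsquare_le[of x m] by (simp add: norm_jsquare)
  also have "\<dots> \<le> c\<^sup>2" using norm_unit_le by (simp add: m mult_left_le)
  finally show "norm x \<le> c" using assms by (rule power2_le_imp_le)
qed (use unit_minus_pos unit_plus_pos in blast)

section \<open>Lower bounds and invertibility in the generated subalgebra\<close>

lemma pos_le_norm: "a - c *\<^sub>R e \<in> jpos \<Longrightarrow> e \<noteq> 0 \<Longrightarrow> c \<le> norm a"
proof (rule ccontr)
  assume a: "a - c *\<^sub>R e \<in> jpos" "e \<noteq> 0" "\<not> c \<le> norm a"
  have "(norm a *\<^sub>R e - a) + (a - c *\<^sub>R e) \<in> jpos"
    using a(1) by (intro jpos_add unit_minus_pos) auto
  then have "(norm a - c) *\<^sub>R e \<in> jpos" by (simp add: scaleR_diff_left)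
  then have "(1 / (c - norm a)) *\<^sub>R ((norm a - c) *\<^sub>R e) \<in> jpos"
    by (rule jpos_scaleR) (use a(3) in simp)
  moreover have "(1 / (c - norm a)) * (norm a - c) = - 1"
    using a(3) by (simp add: field_simps)
  ultimately have "- e \<in> jpos" by (simp only: scaleR_scaleR) simp
  then show False using jpos_antisym[of e] a(2) by simp
qed

text \<open>The Neumann series as a fixed point: with a = r (e - u) and norm u < 1, Banach's theorem
  solves y = e + u y inside the complete set \<open>jb_gen e x\<close>.\<close>

lemma gen_invertible_near:
  assumes a: "a \<in> jb_gen e x" and n: "norm (r *\<^sub>R e - a) < r"
  shows "\<exists>y\<in>jb_gen e x. a \<odot> y = e"
proof -
  have r: "r > 0" using n order_le_less_trans[OF norm_ge_zero] by blast
  define u where "u = (1 / r) *\<^sub>R (r *\<^sub>R e - a)"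
  have u: "u \<in> jb_gen e x" unfolding u_def by (intro jb_gen_intros a)
  have nu: "norm u < 1" using n r by (simp add: u_def del: scaleR_diff_right)
  have "\<exists>!y\<in>jb_gen e x. e + u \<odot> y = y"
  proof (rule Banach_fix[where c="norm u"])
    show "complete (jb_gen e x)" using jb_gen_closed complete_eq_closed by blast
    show "jb_gen e x \<noteq> {}" using jb_gen_unit by blast
    show "(\<lambda>y. e + u \<odot> y) ` jb_gen e x \<subseteq> jb_gen e x" using u by (auto intro!: jb_gen_intros)
    show "dist (e + u \<odot> y) (e + u \<odot> z) \<le> norm u * dist y z" for y z
      by (simp add: dist_norm norm_jprod_le flip: jprod.diff_right)
  qed (use nu in auto)
  then obtain y where y: "y \<in> jb_gen e x" "e + u \<odot> y = y" by blast
  have "a = r *\<^sub>R (e - u)" using r by (simp add: u_def scaleR_diff_right)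
  then have "a \<odot> ((1 / r) *\<^sub>R y) = y - u \<odot> y" using r by (simp add: jprod_distribs scaleR_diff_right)
  also have "\<dots> = e" using y(2) by (metis add_diff_cancel_right')
  finally show ?thesis using y(1) by (intro bexI[of _ "(1 / r) *\<^sub>R y"] jb_gen_intros)
qed

text \<open>The radius norm a + \<epsilon> is chosen so that the order bounds put (norm a +
  \<epsilon>) e - a between - norm a e and norm a e.\<close>

lemma gen_invertible_if_ge:
  assumes a: "a \<in> jb_gen e x" and "0 < \<epsilon>" "a - \<epsilon> *\<^sub>R e \<in> jpos"
  shows "\<exists>y\<in>jb_gen e x. a \<odot> y = e"
proof (rule gen_invertible_near[OF a])
  have "norm ((norm a + \<epsilon>) *\<^sub>R e - a) \<le> norm a"
    unfolding norm_le_iff[OF norm_ge_zero]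
  proof
    show "norm a *\<^sub>R e - ((norm a + \<epsilon>) *\<^sub>R e - a) \<in> jpos" using assms(3) by (simp add: algebra_simps)
    have "(norm a *\<^sub>R e - a) + (norm a + \<epsilon>) *\<^sub>R e \<in> jpos"
      using assms(2) by (intro jpos_add unit_minus_pos jpos_scaleR) auto
    then show "norm a *\<^sub>R e + ((norm a + \<epsilon>) *\<^sub>R e - a) \<in> jpos" by (simp add: algebra_simps)
  qed
  then show "norm ((norm a + \<epsilon>) *\<^sub>R e - a) < norm a + \<epsilon>" using assms(2) by linarith
qed

text \<open>With y the inverse, e = y^2 b^2 is below norm (y^2) b^2 and hence below norm (y^2) norm
  b times b. The summand 1 in \<open>K\<close> only keeps it positive.\<close>

lemma gen_invertible_pos_ge:
  assumes b: "b \<in> jb_gen e x" "b \<in> jpos" and y: "y \<in> jb_gen e x" "b \<odot> y = e"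
  shows "\<exists>\<epsilon>>0. b - \<epsilon> *\<^sub>R e \<in> jpos"
proof -
  define K where "K = norm (y \<odot> y) * norm b + 1"
  have K: "K > 0" by (simp add: K_def add_nonneg_pos)
  have bb: "b \<odot> b \<in> jb_gen e x" "y \<odot> y \<in> jb_gen e x" by (simp_all add: b y jb_gen_jprod)
  have "(y \<odot> y) \<odot> (b \<odot> b) = (y \<odot> (y \<odot> b)) \<odot> b"
    using b y bb by (metis jb_gen_assoc)
  also have "\<dots> = e" using y by (simp add: jprod_commute)
  finally have 1: "(y \<odot> y) \<odot> (b \<odot> b) = e" .
  have "(norm (y \<odot> y) *\<^sub>R e - y \<odot> y) \<odot> (b \<odot> b) \<in> jpos"
    by (intro jpos_jprod[of _ x] unit_minus_pos jb_gen_intros b y) auto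
  then have 2: "norm (y \<odot> y) *\<^sub>R (b \<odot> b) - e \<in> jpos" by (simp add: jprod_distribs 1)
  have "(norm b *\<^sub>R e - b) \<odot> b \<in> jpos"
    by (intro jpos_jprod[of _ x] unit_minus_pos jb_gen_intros b) auto
  then have "norm (y \<odot> y) *\<^sub>R (norm b *\<^sub>R b - b \<odot> b) \<in> jpos"
    by (intro jpos_scaleR) (auto simp: jprod_distribs)
  from jpos_add[OF jpos_add[OF this 2] b(2)] have "K *\<^sub>R b - e \<in> jpos"
    by (simp add: K_def algebra_simps)
  from jpos_scaleR[OF this, of "1 / K"] K have "b - (1 / K) *\<^sub>R e \<in> jpos"
    by (simp add: scaleR_diff_right)
  then show ?thesis using K by (intro exI[of _ "1 / K"]) auto
qed

end

section \<open>Functional calculus\<close>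

context unital_jb
begin

section \<open>The spectrum and its image under polynomials\<close>

lemma jb_gen_shift: "jb_gen e (x - c *\<^sub>R e) = jb_gen e x"
proof
  show "jb_gen e (x - c *\<^sub>R e) \<subseteq> jb_gen e x" by (intro jb_gen_mono jb_gen_intros)
  have "(x - c *\<^sub>R e) + c *\<^sub>R e \<in> jb_gen e (x - c *\<^sub>R e)" by (intro jb_gen_intros)
  then show "jb_gen e x \<subseteq> jb_gen e (x - c *\<^sub>R e)" by (intro jb_gen_mono) simp
qed

lemma jspectrum_iff: "s \<in> jspectrum e x \<longleftrightarrow> \<not> (\<exists>y\<in>jb_gen e x. (x - s *\<^sub>R e) \<odot> y = e)"
  by (simp add: jspectrum_def jinvertible_def jb_gen_shift)

lemma gen_invertible_jprod:
  assumes "a \<in> jb_gen e x" "b \<in> jb_gen e x"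
    and "\<exists>y\<in>jb_gen e x. a \<odot> y = e" "\<exists>y\<in>jb_gen e x. b \<odot> y = e"
  shows "\<exists>y\<in>jb_gen e x. (a \<odot> b) \<odot> y = e"
proof -
  obtain y z where y: "y \<in> jb_gen e x" "a \<odot> y = e" and z: "z \<in> jb_gen e x" "b \<odot> z = e"
    using assms by blast
  have "(a \<odot> b) \<odot> (z \<odot> y) = a \<odot> (b \<odot> (z \<odot> y))" by (intro jb_gen_assoc[of _ x] assms jb_gen_jprod y z)
  also have "b \<odot> (z \<odot> y) = (b \<odot> z) \<odot> y" by (intro jb_gen_assoc[of _ x, symmetric] assms y z)
  finally show ?thesis using y z by (intro bexI[of _ "z \<odot> y"]) (simp_all add: jb_gen_jprod)
qed

lemma gen_invertible_factor:
  assumes "a \<in> jb_gen e x" "b \<in> jb_gen e x" "\<exists>y\<in>jb_gen e x. (a \<odot> b) \<odot> y = e"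
  shows "\<exists>y\<in>jb_gen e x. a \<odot> y = e"
proof -
  obtain y where y: "y \<in> jb_gen e x" "(a \<odot> b) \<odot> y = e" using assms by blast
  have "a \<odot> (b \<odot> y) = e" using jb_gen_assoc[OF assms(1,2) y(1)] y(2) by simp
  then show ?thesis using assms(2) y(1) by (intro bexI[of _ "b \<odot> y"]) (simp_all add: jb_gen_jprod)
qed

text \<open>One half of the spectral mapping theorem, by factorization over the reals: a linear
  factor is invertible off the spectrum, and a quadratic one is at least b^2 e.\<close>

lemma jpoly_invertible:
  assumes "q \<noteq> 0" "\<And>r. poly q r = 0 \<Longrightarrow> r \<notin> jspectrum e x"
  shows "\<exists>y\<in>jb_gen e x. jpoly x q \<odot> y = e"
  using assms
proof (induction "degree q" arbitrary: q rule: less_induct)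
  case less
  show ?case
  proof (cases "degree q = 0")
    case True
    then obtain c where c: "q = [:c:]" by (rule degree_eq_zeroE)
    with less.prems have "c \<noteq> 0" by simp
    then show ?thesis using c by (intro bexI[of _ "(1 / c) *\<^sub>R e"]) (simp_all add: jprod_distribs jb_gen_intros)
  next
    case False
    then show ?thesis
    proof (cases rule: real_poly_factor)
      case (linear r q')
      have q': "q' \<noteq> 0" using linear less.prems(1) by auto
      have "\<exists>y\<in>jb_gen e x. jpoly x [:- r, 1:] \<odot> y = e"
        using less.prems(2)[of r] linear by (simp add: jspectrum_iff)
      moreover have "\<exists>y\<in>jb_gen e x. jpoly x q' \<odot> y = e"
      proof (rule less.hyps)
        show "degree q' < degree q" unfolding linear using q' by (subst degree_mult_eq) auto
      qed (use q' less.prems(2) linear in auto)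
      ultimately show ?thesis unfolding linear jpoly_mult
        by (intro gen_invertible_jprod jpoly_in_gen)
    next
      case (quadratic a b q')
      let ?d = "[:- a, 1:] * [:- a, 1:] + [:b\<^sup>2:]"
      have q': "q' \<noteq> 0" using quadratic less.prems(1) by auto
      have "jpoly x ?d = (x - a *\<^sub>R e) \<odot> (x - a *\<^sub>R e) + b\<^sup>2 *\<^sub>R e"
        unfolding jpoly_add jpoly_mult by simp
      then have "jpoly x ?d - b\<^sup>2 *\<^sub>R e \<in> jpos" by (simp only: add_diff_cancel_right' jpos_square)
      then have "\<exists>y\<in>jb_gen e x. jpoly x ?d \<odot> y = e"
        using quadratic(1) by (intro gen_invertible_if_ge[of _ _ "b\<^sup>2"] jpoly_in_gen) auto
      moreover have "\<exists>y\<in>jb_gen e x. jpoly x q' \<odot> y = e"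
      proof (rule less.hyps)
        have "degree ?d = 2" by simp
        then show "degree q' < degree q" unfolding quadratic(2) using q' by (subst degree_mult_eq) auto
      qed (use q' less.prems(2) quadratic in auto)
      ultimately show ?thesis unfolding quadratic(2) jpoly_mult
        by (intro gen_invertible_jprod jpoly_in_gen)
    qed
  qed
qed

text \<open>\<open>c\<close> is the largest scalar whose multiple of the unit lies below
  \<open>a\<close>; if the difference were invertible, \<open>gen_invertible_pos_ge\<close> would
  allow a larger one. This yields spectral values and, in \<open>jpoly_pos\<close>, the sign of
  p(x).\<close>

lemma greatest_lower_scalar:
  assumes "e \<noteq> 0" and a: "a \<in> jb_gen e x"
  obtains c where "a - c *\<^sub>R e \<in> jpos" "\<not> (\<exists>y\<in>jb_gen e x. (a - c *\<^sub>R e) \<odot> y = e)"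
proof -
  let ?S = "{c. a - c *\<^sub>R e \<in> jpos}"
  have "- norm a \<in> ?S" using unit_plus_pos[of a "norm a"] by (simp add: algebra_simps)
  then have ne: "?S \<noteq> {}" by blast
  have bdd: "bdd_above ?S" using pos_le_norm[OF _ assms(1)] by (intro bdd_aboveI[of _ "norm a"]) blast
  have "closed ((\<lambda>c. a - c *\<^sub>R e) -` jpos)"
    by (intro continuous_closed_vimage jpos_closed continuous_intros)
  then have "closed ?S" by (simp add: vimage_def)
  then have S: "Sup ?S \<in> ?S" by (rule closed_contains_Sup[OF ne bdd])
  moreover have "\<not> (\<exists>y\<in>jb_gen e x. (a - Sup ?S *\<^sub>R e) \<odot> y = e)"
  proof
    assume "\<exists>y\<in>jb_gen e x. (a - Sup ?S *\<^sub>R e) \<odot> y = e"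
    then obtain y where "y \<in> jb_gen e x" "(a - Sup ?S *\<^sub>R e) \<odot> y = e" by blast
    moreover have "a - Sup ?S *\<^sub>R e \<in> jb_gen e x" by (intro jb_gen_intros a)
    ultimately obtain \<epsilon> where "\<epsilon> > 0" "(a - Sup ?S *\<^sub>R e) - \<epsilon> *\<^sub>R e \<in> jpos"
      using gen_invertible_pos_ge S by blast
    then have "Sup ?S + \<epsilon> \<in> ?S" by (simp add: algebra_simps)
    then have "Sup ?S + \<epsilon> \<le> Sup ?S" by (rule cSup_upper[OF _ bdd])
    then show False using \<open>\<epsilon> > 0\<close> by simp
  qed
  ultimately show ?thesis using that by blast
qed

lemma jspectrum_nonempty: "e \<noteq> 0 \<Longrightarrow> jspectrum e x \<noteq> {}"
proof -
  assume "e \<noteq> 0"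
  then obtain c where "\<not> (\<exists>y\<in>jb_gen e x. (x - c *\<^sub>R e) \<odot> y = e)"
    by (rule greatest_lower_scalar[OF _ jb_gen_self])
  then have "c \<in> jspectrum e x" by (simp add: jspectrum_iff)
  then show ?thesis by blast
qed

text \<open>For the greatest lower scalar c, p(x) - c e is not invertible, so p takes the value c
  somewhere on the spectrum, which forces c to be non-negative.\<close>

lemma jpoly_pos:
  assumes p: "\<And>s. s \<in> jspectrum e x \<Longrightarrow> 0 \<le> poly p s"
  shows "jpoly x p \<in> jpos"
proof (cases "e = 0")
  case True
  then show ?thesis using trivial_if_unit_zero[of "jpoly x p"] by simp
next
  case False
  obtain c where c: "jpoly x p - c *\<^sub>R e \<in> jpos" "\<not> (\<exists>y\<in>jb_gen e x. (jpoly x p - c *\<^sub>R e) \<odot> y = e)"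
    using greatest_lower_scalar[OF False jpoly_in_gen] by blast
  have c0: "0 \<le> c"
  proof (rule ccontr)
    assume neg: "\<not> 0 \<le> c"
    let ?q = "p - [:c:]"
    have "jpoly x ?q = jpoly x p - c *\<^sub>R e" by (simp add: jpoly_diff)
    with c(2) have ni: "\<not> (\<exists>y\<in>jb_gen e x. jpoly x ?q \<odot> y = e)" by simp
    have "?q \<noteq> 0"
    proof
      assume "?q = 0"
      then have "p = [:c:]" by simp
      moreover obtain s where "s \<in> jspectrum e x" using jspectrum_nonempty[OF False] by blast
      ultimately show False using p[of s] neg by simp
    qed
    with ni jpoly_invertible[of ?q x] obtain r where "poly ?q r = 0" "r \<in> jspectrum e x" by blast
    with p[of r] neg show False by simp
  qed
  have "(jpoly x p - c *\<^sub>R e) + c *\<^sub>R e \<in> jpos" by (intro jpos_add c jpos_scaleR c0 jpos_unit)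
  then show ?thesis by simp
qed

text \<open>If norm p(x) < |p(s)|, then p(x) - p(s) e is a small perturbation of a multiple of e and
  so invertible. It has x - s e as a factor, which would be invertible too.\<close>

lemma jpoly_spectrum_bound:
  assumes s: "s \<in> jspectrum e x"
  shows "\<bar>poly p s\<bar> \<le> norm (jpoly x p)"
proof (rule ccontr)
  assume n: "\<not> ?thesis"
  define m where "m = poly p s"
  have "poly (p - [:m:]) s = 0" by (simp add: m_def)
  then have "[:- s, 1:] dvd p - [:m:]" by (simp only: poly_eq_0_iff_dvd)
  then obtain q where q: "p - [:m:] = [:- s, 1:] * q" by (rule dvdE)
  have eq: "jpoly x p - m *\<^sub>R e = (x - s *\<^sub>R e) \<odot> jpoly x q"
    using arg_cong[OF q, of "jpoly x"] unfolding jpoly_mult jpoly_diff by simp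
  have mem: "jpoly x p - m *\<^sub>R e \<in> jb_gen e x" "- (jpoly x p - m *\<^sub>R e) \<in> jb_gen e x"
    using jb_gen_scaleR[of "jpoly x p - m *\<^sub>R e" e x "-1"] by (auto intro!: jb_gen_intros jpoly_in_gen)
  have "\<exists>y\<in>jb_gen e x. (jpoly x p - m *\<^sub>R e) \<odot> y = e"
  \<comment> \<open>\<open>gen_invertible_near\<close> compares with a positive multiple of the
    unit, hence the change of sign.\<close>
  proof (cases "m < 0")
    case True
    then have "norm ((- m) *\<^sub>R e - (jpoly x p - m *\<^sub>R e)) < - m" using n by (simp add: m_def)
    then show ?thesis by (rule gen_invertible_near[OF mem(1)])
  next
    case False
    then have "norm (m *\<^sub>R e - - (jpoly x p - m *\<^sub>R e)) < m" using n by (simp add: m_def)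
    from gen_invertible_near[OF mem(2) this] obtain y where y: "y \<in> jb_gen e x"
      "- (jpoly x p - m *\<^sub>R e) \<odot> y = e" by blast
    have "(jpoly x p - m *\<^sub>R e) \<odot> - y = e" using y(2) by (simp only: jprod.minus_left jprod.minus_right)
    then show ?thesis using jb_gen_scaleR[OF y(1), of "-1"] by (intro bexI[of _ "- y"]) simp_all
  qed
  then have "\<exists>y\<in>jb_gen e x. (x - s *\<^sub>R e) \<odot> y = e"
    unfolding eq by (rule gen_invertible_factor[rotated 2]) (intro jb_gen_intros jpoly_in_gen)+
  with s show False by (simp add: jspectrum_iff)
qed

lemma norm_jpoly_le_iff:
  assumes "0 \<le> c"
  shows "norm (jpoly x p) \<le> c \<longleftrightarrow> (\<forall>s\<in>jspectrum e x. \<bar>poly p s\<bar> \<le> c)"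
proof
  assume R: "\<forall>s\<in>jspectrum e x. \<bar>poly p s\<bar> \<le> c"
  have "jpoly x ([:c:] - p) \<in> jpos" "jpoly x ([:c:] + p) \<in> jpos"
    by (rule jpoly_pos; use R in \<open>auto simp: abs_le_iff\<close>)+
  then show "norm (jpoly x p) \<le> c"
    unfolding norm_le_iff[OF assms] by (simp add: jpoly_diff jpoly_add)
qed (use jpoly_spectrum_bound order_trans in blast)

lemma compact_jspectrum: "compact (jspectrum e x)"
proof -
  have "bounded (jspectrum e x)"
    using jpoly_spectrum_bound[of _ x "[:0, 1:]"] by (auto simp: bounded_iff)
  moreover have "open (- jspectrum e x)"
    unfolding open_dist
  proof
    fix s assume "s \<in> - jspectrum e x"
    then obtain y where y: "y \<in> jb_gen e x" "(x - s *\<^sub>R e) \<odot> y = e" by (auto simp: jspectrum_iff)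
    define d where "d = 1 / (norm y + 1)"
    have d: "d > 0" by (simp add: d_def add_nonneg_pos)
    have "t \<in> - jspectrum e x" if "dist t s < d" for t
    proof -
      have mem: "x - t *\<^sub>R e \<in> jb_gen e x" by (intro jb_gen_intros)
      have eq: "(x - t *\<^sub>R e) \<odot> y = e - (t - s) *\<^sub>R y"
        using y(2) by (simp add: jprod_distribs algebra_simps)
      have "norm (1 *\<^sub>R e - (x - t *\<^sub>R e) \<odot> y) < 1"
      proof -
        have "\<bar>t - s\<bar> * norm y \<le> d * norm y" using that by (intro mult_right_mono) (auto simp: dist_real_def)
        also have "\<dots> < 1" by (simp add: d_def add_nonneg_pos)
        finally show ?thesis by (simp add: eq)
      qed
      from gen_invertible_near[OF jb_gen_jprod[OF mem y(1)] this]
      have "\<exists>z\<in>jb_gen e x. (x - t *\<^sub>R e) \<odot> z = e"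
        by (intro gen_invertible_factor[OF mem y(1)])
      then show ?thesis by (simp add: jspectrum_iff)
    qed
    with d show "\<exists>d>0. \<forall>t. dist t s < d \<longrightarrow> t \<in> - jspectrum e x" by blast
  qed
  ultimately show ?thesis using compact_eq_bounded_closed closed_def by blast
qed

text \<open>The graph of the functional calculus: a single polynomial is close to \<open>g\<close>
  on the spectrum and, evaluated at \<open>x\<close>, close to \<open>y\<close>. As a relation it is
  independent of chosen approximating sequences; that it determines \<open>y\<close> follows from
  \<open>fun_calc_approx_norm\<close>.\<close>

definition fun_calc_approx :: "'a \<Rightarrow> (real \<Rightarrow> real) \<Rightarrow> 'a \<Rightarrow> bool" where
  "fun_calc_approx x g y \<longleftrightarrow>
     (\<forall>\<epsilon>>0. \<exists>p. (\<forall>s\<in>jspectrum e x. \<bar>g s - poly p s\<bar> \<le> \<epsilon>) \<and> norm (y - jpoly x p) \<le> \<epsilon>)"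

lemma fun_calc_approxD:
  assumes "fun_calc_approx x g y" "0 < \<epsilon>"
  obtains p where "\<And>s. s \<in> jspectrum e x \<Longrightarrow> \<bar>g s - poly p s\<bar> \<le> \<epsilon>" "norm (y - jpoly x p) \<le> \<epsilon>"
  using assms unfolding fun_calc_approx_def by blast

lemma fun_calc_approx_jpoly: "(\<And>s. s \<in> jspectrum e x \<Longrightarrow> g s = poly p s) \<Longrightarrow> fun_calc_approx x g (jpoly x p)"
  unfolding fun_calc_approx_def by (auto intro!: exI[of _ p])

lemma weierstrass_poly:
  assumes "continuous_on (jspectrum e x) g" "0 < \<epsilon>"
  obtains p where "\<And>s. s \<in> jspectrum e x \<Longrightarrow> \<bar>g s - poly p s\<bar> \<le> \<epsilon>"
proof -
  obtain h where h: "real_polynomial_function h" "\<And>s. s \<in> jspectrum e x \<Longrightarrow> \<bar>g s - h s\<bar> < \<epsilon>"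
    using Stone_Weierstrass_real_polynomial_function[OF compact_jspectrum assms] by blast
  then obtain a n where a: "h = (\<lambda>s. \<Sum>i\<le>n. a i * s ^ i)" by (auto simp: real_polynomial_function_iff_sum)
  have "h s = poly (\<Sum>i\<le>n. monom (a i) i) s" for s by (simp add: a poly_sum poly_monom)
  with h(2) show ?thesis by (intro that[of "\<Sum>i\<le>n. monom (a i) i"]) (auto intro: less_imp_le)
qed

lemma fun_calc_approx_exists:
  assumes "continuous_on (jspectrum e x) g"
  obtains y where "fun_calc_approx x g y"
proof -
  have "\<exists>p. \<forall>s\<in>jspectrum e x. \<bar>g s - poly p s\<bar> \<le> 1 / real (Suc n)" for n
    using weierstrass_poly[OF assms, of "1 / real (Suc n)"] by (metis of_nat_0_less_iff zero_less_Suc zero_less_divide_1_iff)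
  then obtain p where p: "\<And>n s. s \<in> jspectrum e x \<Longrightarrow> \<bar>g s - poly (p n) s\<bar> \<le> 1 / real (Suc n)" by metis
  have d: "norm (jpoly x (p m) - jpoly x (p n)) \<le> 1 / real (Suc m) + 1 / real (Suc n)" for m n
    unfolding jpoly_diff[symmetric]
  proof (subst norm_jpoly_le_iff)
    show "\<forall>s\<in>jspectrum e x. \<bar>poly (p m - p n) s\<bar> \<le> 1 / real (Suc m) + 1 / real (Suc n)"
    proof
      fix s assume s: "s \<in> jspectrum e x"
      show "\<bar>poly (p m - p n) s\<bar> \<le> 1 / real (Suc m) + 1 / real (Suc n)"
        using p[OF s, of m] p[OF s, of n] unfolding poly_diff by linarith
    qed
  qed simp
  have "Cauchy (\<lambda>n. jpoly x (p n))"
    unfolding Cauchy_altdef2 dist_norm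
  proof (intro allI impI)
    fix \<epsilon> :: real assume "0 < \<epsilon>"
    then obtain N where N: "1 / real (Suc N) < \<epsilon> / 2" using nat_approx_posE[of "\<epsilon> / 2"] by auto
    have "norm (jpoly x (p n) - jpoly x (p N)) < \<epsilon>" if "n \<ge> N" for n
    proof -
      have "1 / real (Suc n) \<le> 1 / real (Suc N)" using that by (simp add: frac_le)
      with d[of n N] N show ?thesis by linarith
    qed
    then show "\<exists>N. \<forall>n\<ge>N. norm (jpoly x (p n) - jpoly x (p N)) < \<epsilon>" by blast
  qed
  then obtain y where y: "(\<lambda>n. jpoly x (p n)) \<longlonglongrightarrow> y" using Cauchy_convergent convergent_def by blast
  have "fun_calc_approx x g y"
    unfolding fun_calc_approx_def
  proof (intro allI impI)
    fix \<epsilon> :: real assume \<epsilon>: "0 < \<epsilon>"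
    obtain N1 where N1: "\<And>n. n \<ge> N1 \<Longrightarrow> norm (jpoly x (p n) - y) < \<epsilon>" using LIMSEQ_D[OF y \<epsilon>] by blast
    obtain N2 where N2: "1 / real (Suc N2) < \<epsilon>" using nat_approx_posE[OF \<epsilon>] by auto
    define n where "n = max N1 N2"
    have "1 / real (Suc n) \<le> 1 / real (Suc N2)" by (simp add: n_def frac_le)
    then have "\<forall>s\<in>jspectrum e x. \<bar>g s - poly (p n) s\<bar> \<le> \<epsilon>" using p[of _ n] N2 by force
    moreover have "norm (y - jpoly x (p n)) \<le> \<epsilon>" using N1[of n] by (simp add: n_def norm_minus_commute)
    ultimately show "\<exists>p. (\<forall>s\<in>jspectrum e x. \<bar>g s - poly p s\<bar> \<le> \<epsilon>) \<and> norm (y - jpoly x p) \<le> \<epsilon>" by blast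
  qed
  then show ?thesis by (rule that)
qed

lemma fun_calc_approx_norm:
  assumes "fun_calc_approx x g y" "0 \<le> c"
  shows "norm y \<le> c \<longleftrightarrow> (\<forall>s\<in>jspectrum e x. \<bar>g s\<bar> \<le> c)"
proof
  assume L: "norm y \<le> c"
  show "\<forall>s\<in>jspectrum e x. \<bar>g s\<bar> \<le> c"
  proof
    fix s assume s: "s \<in> jspectrum e x"
    show "\<bar>g s\<bar> \<le> c"
    proof (rule field_le_epsilon)
      fix \<epsilon> :: real assume "0 < \<epsilon>"
      then have "0 < \<epsilon> / 2" by simp
      from fun_calc_approxD[OF assms(1) this] obtain p where
        p: "\<And>s. s \<in> jspectrum e x \<Longrightarrow> \<bar>g s - poly p s\<bar> \<le> \<epsilon> / 2" "norm (y - jpoly x p) \<le> \<epsilon> / 2" by blast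
      have "norm (jpoly x p) \<le> norm y + norm (y - jpoly x p)"
        using norm_triangle_ineq4[of y "y - jpoly x p"] by simp
      with jpoly_spectrum_bound[OF s, of p] p(1)[OF s] p(2) L show "\<bar>g s\<bar> \<le> c + \<epsilon>" by linarith
    qed
  qed
next
  assume R: "\<forall>s\<in>jspectrum e x. \<bar>g s\<bar> \<le> c"
  show "norm y \<le> c"
  proof (rule field_le_epsilon)
    fix \<epsilon> :: real assume \<epsilon>: "0 < \<epsilon>"
    then have "0 < \<epsilon> / 2" by simp
    from fun_calc_approxD[OF assms(1) this] obtain p where
      p: "\<And>s. s \<in> jspectrum e x \<Longrightarrow> \<bar>g s - poly p s\<bar> \<le> \<epsilon> / 2" "norm (y - jpoly x p) \<le> \<epsilon> / 2" by blast
    have "\<forall>s\<in>jspectrum e x. \<bar>poly p s\<bar> \<le> c + \<epsilon> / 2"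
    proof
      fix s assume s: "s \<in> jspectrum e x"
      show "\<bar>poly p s\<bar> \<le> c + \<epsilon> / 2" using bspec[OF R s] p(1)[OF s] by linarith
    qed
    then have "norm (jpoly x p) \<le> c + \<epsilon> / 2" using assms(2) \<epsilon> by (subst norm_jpoly_le_iff) auto
    moreover have "norm y \<le> norm (y - jpoly x p) + norm (jpoly x p)"
      using norm_triangle_ineq[of "y - jpoly x p" "jpoly x p"] by simp
    ultimately show "norm y \<le> c + \<epsilon>" using p(2) by linarith
  qed
qed

lemma fun_calc_approx_add:
  assumes "fun_calc_approx x g y" "fun_calc_approx x h z"
  shows "fun_calc_approx x (\<lambda>s. g s + h s) (y + z)"
  unfolding fun_calc_approx_def
proof (intro allI impI)
  fix \<epsilon> :: real assume "0 < \<epsilon>"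
  then have \<epsilon>: "0 < \<epsilon> / 2" by simp
  obtain p where p: "\<And>s. s \<in> jspectrum e x \<Longrightarrow> \<bar>g s - poly p s\<bar> \<le> \<epsilon> / 2" "norm (y - jpoly x p) \<le> \<epsilon> / 2"
    using fun_calc_approxD[OF assms(1) \<epsilon>] by blast
  obtain q where q: "\<And>s. s \<in> jspectrum e x \<Longrightarrow> \<bar>h s - poly q s\<bar> \<le> \<epsilon> / 2" "norm (z - jpoly x q) \<le> \<epsilon> / 2"
    using fun_calc_approxD[OF assms(2) \<epsilon>] by blast
  have "norm (y + z - jpoly x (p + q)) \<le> \<epsilon>"
    using norm_triangle_mono[OF p(2) q(2)] by (simp add: jpoly_add algebra_simps)
  moreover have "\<forall>s\<in>jspectrum e x. \<bar>g s + h s - poly (p + q) s\<bar> \<le> \<epsilon>"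
  proof
    fix s assume s: "s \<in> jspectrum e x"
    show "\<bar>g s + h s - poly (p + q) s\<bar> \<le> \<epsilon>" using p(1)[OF s] q(1)[OF s] unfolding poly_add by linarith
  qed
  ultimately show "\<exists>p. (\<forall>s\<in>jspectrum e x. \<bar>g s + h s - poly p s\<bar> \<le> \<epsilon>) \<and> norm (y + z - jpoly x p) \<le> \<epsilon>" by blast
qed

lemma fun_calc_approx_mult:
  assumes g: "fun_calc_approx x g y" and h: "fun_calc_approx x h z"
  shows "fun_calc_approx x (\<lambda>s. g s * h s) (y \<odot> z)"
  unfolding fun_calc_approx_def
proof (intro allI impI)
  fix \<epsilon> :: real assume \<epsilon>: "0 < \<epsilon>"
  \<comment> \<open>From g h - p q = g (h - q) + (g - p) q with |g| at most norm y and |q| at most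
    norm z + 1; the second bound is why \<delta> is kept below 1.\<close>
  define K where "K = norm y + norm z + 1"
  have K: "K > 0" by (simp add: K_def add_nonneg_pos)
  define \<delta> where "\<delta> = min 1 (\<epsilon> / K)"
  have \<delta>: "0 < \<delta>" "\<delta> \<le> 1" "\<delta> * K \<le> \<epsilon>" using \<epsilon> K by (auto simp: \<delta>_def min_def field_simps)
  obtain p where p: "\<And>s. s \<in> jspectrum e x \<Longrightarrow> \<bar>g s - poly p s\<bar> \<le> \<delta>" "norm (y - jpoly x p) \<le> \<delta>"
    using fun_calc_approxD[OF g \<delta>(1)] by blast
  obtain q where q: "\<And>s. s \<in> jspectrum e x \<Longrightarrow> \<bar>h s - poly q s\<bar> \<le> \<delta>" "norm (z - jpoly x q) \<le> \<delta>"
    using fun_calc_approxD[OF h \<delta>(1)] by blast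
  have bound: "u * \<delta> + \<delta> * v \<le> \<epsilon>" if "u \<le> norm y" "v \<le> norm z + 1" for u v
  proof -
    have "\<delta> * (u + v) \<le> \<delta> * K" using \<delta>(1) that by (intro mult_left_mono) (auto simp: K_def)
    with \<delta>(3) show ?thesis by (simp add: algebra_simps)
  qed
  have "\<bar>g s * h s - poly (p * q) s\<bar> \<le> \<epsilon>" if s: "s \<in> jspectrum e x" for s
  proof -
    have gs: "\<bar>g s\<bar> \<le> norm y" "\<bar>h s\<bar> \<le> norm z"
      using fun_calc_approx_norm[OF g, of "norm y"] fun_calc_approx_norm[OF h, of "norm z"] s by auto
    have "\<bar>g s * h s - poly (p * q) s\<bar> = \<bar>g s * (h s - poly q s) + (g s - poly p s) * poly q s\<bar>"
      by (simp add: algebra_simps)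
    also have "\<dots> \<le> \<bar>g s\<bar> * \<bar>h s - poly q s\<bar> + \<bar>g s - poly p s\<bar> * \<bar>poly q s\<bar>"
      by (rule order_trans[OF abs_triangle_ineq]) (simp add: abs_mult)
    also have "\<dots> \<le> \<bar>g s\<bar> * \<delta> + \<delta> * \<bar>poly q s\<bar>"
      using p(1)[OF s] q(1)[OF s] by (intro add_mono mult_left_mono mult_right_mono) auto
    also have "\<dots> \<le> \<epsilon>" using gs q(1)[OF s] \<delta>(2) by (intro bound) auto
    finally show ?thesis .
  qed
  moreover have "norm (y \<odot> z - jpoly x (p * q)) \<le> \<epsilon>"
  proof -
    have "norm (y \<odot> z - jpoly x (p * q)) = norm (y \<odot> (z - jpoly x q) + (y - jpoly x p) \<odot> jpoly x q)"
      by (simp add: jpoly_mult jprod_distribs)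
    also have "\<dots> \<le> norm y * norm (z - jpoly x q) + norm (y - jpoly x p) * norm (jpoly x q)"
      by (rule norm_triangle_mono) (rule norm_jprod_le)+
    also have "\<dots> \<le> norm y * \<delta> + \<delta> * norm (jpoly x q)"
      using p(2) q(2) by (intro add_mono mult_left_mono mult_right_mono) auto
    also have "\<dots> \<le> \<epsilon>"
    proof (rule bound)
      show "norm (jpoly x q) \<le> norm z + 1"
        using norm_triangle_ineq4[of z "z - jpoly x q"] q(2) \<delta>(2) by simp
    qed simp
    finally show ?thesis .
  qed
  ultimately show "\<exists>p. (\<forall>s\<in>jspectrum e x. \<bar>g s * h s - poly p s\<bar> \<le> \<epsilon>) \<and> norm (y \<odot> z - jpoly x p) \<le> \<epsilon>" by blast
qed

lemma fun_calc_approx_scale: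
  assumes "fun_calc_approx x g y"
  shows "fun_calc_approx x (\<lambda>s. c * g s) (c *\<^sub>R y)"
  using fun_calc_approx_mult[OF fun_calc_approx_jpoly[of x "\<lambda>_. c" "[:c:]"] assms]
  by (simp add: jprod_distribs)

lemma fun_calc_approx_unique:
  assumes "fun_calc_approx x g y" "fun_calc_approx x h z" "\<And>s. s \<in> jspectrum e x \<Longrightarrow> g s = h s"
  shows "y = z"
proof -
  have "fun_calc_approx x (\<lambda>s. g s + (-1) * h s) (y + (-1) *\<^sub>R z)"
    by (intro fun_calc_approx_add fun_calc_approx_scale assms)
  then have "norm (y + (-1) *\<^sub>R z) \<le> 0" using assms(3) by (subst fun_calc_approx_norm) auto
  then show ?thesis by simp
qed

lemma fun_calc_approx_in_gen:
  assumes "fun_calc_approx x g y"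
  shows "y \<in> jb_gen e x"
proof -
  have "y \<in> closure (range (jpoly x))"
    unfolding closure_approachable
  proof (intro allI impI)
    fix \<epsilon> :: real assume "0 < \<epsilon>"
    then have \<epsilon>: "0 < \<epsilon> / 2" by simp
    obtain p where "norm (y - jpoly x p) \<le> \<epsilon> / 2" using fun_calc_approxD[OF assms \<epsilon>] by blast
    then have "dist (jpoly x p) y < \<epsilon>" using \<epsilon> by (simp add: dist_norm norm_minus_commute)
    then show "\<exists>z\<in>range (jpoly x). dist z y < \<epsilon>" by blast
  qed
  then show ?thesis by (simp add: jb_gen_eq_closure)
qed

text \<open>By \<open>jpoly_spectrum_bound\<close>, norm convergence of polynomials in x entails
  their uniform convergence on the spectrum; \<open>g\<close> is the uniform limit.\<close>

lemma fun_calc_approx_surj: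
  assumes "y \<in> jb_gen e x"
  obtains g where "continuous_on (jspectrum e x) g" "fun_calc_approx x g y"
proof -
  obtain f where f: "\<And>n. f n \<in> range (jpoly x)" "f \<longlonglongrightarrow> y"
    using assms unfolding jb_gen_eq_closure closure_sequential by blast
  then have "\<forall>n. \<exists>p. f n = jpoly x p" by blast
  then obtain p where p: "\<And>n. f n = jpoly x (p n)" by metis
  have "uniformly_Cauchy_on (jspectrum e x) (\<lambda>n s. poly (p n) s)"
    unfolding uniformly_Cauchy_on_def
  proof (intro allI impI)
    fix \<epsilon> :: real assume "0 < \<epsilon>"
    then obtain M where M: "\<And>m n. m \<ge> M \<Longrightarrow> n \<ge> M \<Longrightarrow> dist (f m) (f n) < \<epsilon>"
      using LIMSEQ_imp_Cauchy[OF f(2)] unfolding Cauchy_def by blast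
    have "dist (poly (p m) s) (poly (p n) s) < \<epsilon>" if "s \<in> jspectrum e x" "m \<ge> M" "n \<ge> M" for s m n
      using jpoly_spectrum_bound[OF that(1), of "p m - p n"] M[OF that(2,3)]
      by (simp add: dist_norm p jpoly_diff)
    then show "\<exists>M. \<forall>s\<in>jspectrum e x. \<forall>m\<ge>M. \<forall>n\<ge>M. dist (poly (p m) s) (poly (p n) s) < \<epsilon>" by blast
  qed
  then obtain g where g: "uniform_limit (jspectrum e x) (\<lambda>n s. poly (p n) s) g sequentially"
    using Cauchy_uniformly_convergent uniformly_convergent_on_def by blast
  have "continuous_on (jspectrum e x) g"
    by (rule uniform_limit_theorem[OF _ g]) (auto intro!: always_eventually continuous_intros)
  moreover have "fun_calc_approx x g y"
    unfolding fun_calc_approx_def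
  proof (intro allI impI)
    fix \<epsilon> :: real assume \<epsilon>: "0 < \<epsilon>"
    have "\<forall>\<^sub>F n in sequentially. \<forall>s\<in>jspectrum e x. dist (poly (p n) s) (g s) < \<epsilon>"
      using g \<epsilon> unfolding uniform_limit_iff by blast
    moreover have "\<forall>\<^sub>F n in sequentially. dist (f n) y < \<epsilon>" using f(2) \<epsilon> by (rule tendstoD)
    ultimately have "\<forall>\<^sub>F n in sequentially. (\<forall>s\<in>jspectrum e x. dist (poly (p n) s) (g s) < \<epsilon>) \<and> dist (f n) y < \<epsilon>"
      by (rule eventually_conj)
    then obtain n where "\<forall>s\<in>jspectrum e x. dist (poly (p n) s) (g s) < \<epsilon>" "dist (f n) y < \<epsilon>"
      using eventually_happens trivial_limit_sequentially by blast
    then show "\<exists>p. (\<forall>s\<in>jspectrum e x. \<bar>g s - poly p s\<bar> \<le> \<epsilon>) \<and> norm (y - jpoly x p) \<le> \<epsilon>"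
      by (intro exI[of _ "p n"]) (auto simp: dist_norm p norm_minus_commute abs_minus_commute less_imp_le)
  qed
  ultimately show ?thesis by (rule that)
qed

text \<open>Every map that meets the specification has its graph inside
  \<open>fun_calc_approx\<close>. This is the uniqueness on which the definite description in
  \<open>jfun_calc\<close> rests.\<close>

lemma is_fun_calc_approx:
  assumes \<Phi>: "is_fun_calc e x \<Phi>" and g: "continuous_on (jspectrum e x) g"
  shows "fun_calc_approx x g (\<Phi> g)"
proof -
  let ?C = "continuous_on (jspectrum e x) :: (real \<Rightarrow> real) \<Rightarrow> bool"
  have add: "\<Phi> (\<lambda>s. g s + h s) = \<Phi> g + \<Phi> h" if "?C g" "?C h" for g h
    using \<Phi> that unfolding is_fun_calc_def Let_def by blast
  have scale: "\<Phi> (\<lambda>s. c * g s) = c *\<^sub>R \<Phi> g" if "?C g" for c g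
    using \<Phi> that unfolding is_fun_calc_def Let_def by blast
  have mult: "\<Phi> (\<lambda>s. g s * h s) = \<Phi> g \<odot> \<Phi> h" if "?C g" "?C h" for g h
    using \<Phi> that unfolding is_fun_calc_def Let_def by blast
  have norm: "norm (\<Phi> g) \<le> c \<longleftrightarrow> (\<forall>s\<in>jspectrum e x. \<bar>g s\<bar> \<le> c)" if "?C g" "0 \<le> c" for c g
    using \<Phi> that unfolding is_fun_calc_def Let_def by blast
  have base: "\<Phi> (\<lambda>s. s) = x" "\<Phi> (\<lambda>s. 1) = e"
    using \<Phi> unfolding is_fun_calc_def Let_def by blast+
  have poly: "\<Phi> (poly p) = jpoly x p" for p
  proof (induction p)
    case 0
    have "poly 0 = (\<lambda>s. 0 :: real)" by (rule ext) simp
    then show ?case using scale[of "\<lambda>s. 1" 0] by simp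
  next
    case (pCons a p)
    have "\<Phi> (\<lambda>s. a * 1 + s * poly p s) = \<Phi> (\<lambda>s. a * 1) + \<Phi> (\<lambda>s. s * poly p s)"
      by (intro add continuous_intros)
    also have "\<Phi> (\<lambda>s. a * 1) = a *\<^sub>R e" unfolding base(2)[symmetric] by (intro scale continuous_intros)
    also have "\<Phi> (\<lambda>s. s * poly p s) = \<Phi> (\<lambda>s. s) \<odot> \<Phi> (poly p)" by (intro mult continuous_intros)
    finally have "\<Phi> (\<lambda>s. a * 1 + s * poly p s) = a *\<^sub>R e + x \<odot> jpoly x p" unfolding base pCons.IH .
    moreover have "poly (pCons a p) = (\<lambda>s. a * 1 + s * poly p s)" by (rule ext) simp
    ultimately show ?case by simp
  qed
  show ?thesis
    unfolding fun_calc_approx_def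
  proof (intro allI impI)
    fix \<epsilon> :: real assume \<epsilon>: "0 < \<epsilon>"
    obtain p where p: "\<And>s. s \<in> jspectrum e x \<Longrightarrow> \<bar>g s - poly p s\<bar> \<le> \<epsilon>"
      using weierstrass_poly[OF g \<epsilon>] by blast
    have "\<Phi> (\<lambda>s. g s + (-1) * poly p s) = \<Phi> g + (-1) *\<^sub>R jpoly x p"
    proof -
      have "\<Phi> (\<lambda>s. g s + (-1) * poly p s) = \<Phi> g + \<Phi> (\<lambda>s. (-1) * poly p s)"
        by (intro add g continuous_intros)
      also have "\<Phi> (\<lambda>s. (-1) * poly p s) = (-1) *\<^sub>R \<Phi> (poly p)" by (intro scale continuous_intros)
      finally show ?thesis unfolding poly .
    qed
    moreover have "norm (\<Phi> (\<lambda>s. g s + (-1) * poly p s)) \<le> \<epsilon>"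
      using p \<epsilon> by (subst norm) (auto intro!: g continuous_intros)
    ultimately have "norm (\<Phi> g - jpoly x p) \<le> \<epsilon>" by simp
    with p show "\<exists>p. (\<forall>s\<in>jspectrum e x. \<bar>g s - poly p s\<bar> \<le> \<epsilon>) \<and> norm (\<Phi> g - jpoly x p) \<le> \<epsilon>" by blast
  qed
qed

lemma fun_calc_exists: "\<exists>\<Phi>. is_fun_calc e x \<Phi>"
proof -
  let ?C = "continuous_on (jspectrum e x) :: (real \<Rightarrow> real) \<Rightarrow> bool"
  define \<Phi> where "\<Phi> g = (SOME y. fun_calc_approx x g y)" for g
  have \<Phi>: "fun_calc_approx x g (\<Phi> g)" if "?C g" for g
    unfolding \<Phi>_def by (rule someI_ex) (use fun_calc_approx_exists[OF that] in blast)
  have eq: "\<Phi> g = y" if "?C g" "fun_calc_approx x g y" for g y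
    by (rule fun_calc_approx_unique[OF \<Phi>[OF that(1)] that(2)]) simp
  have x: "\<Phi> (\<lambda>s. s) = jpoly x [:0, 1:]" and e: "\<Phi> (\<lambda>s. 1) = jpoly x [:1:]"
    by (rule eq; auto intro!: fun_calc_approx_jpoly continuous_intros simp del: jpoly_pCons)+
  have "is_fun_calc e x \<Phi>"
    unfolding is_fun_calc_def Let_def
  proof (intro conjI ballI allI impI)
    fix g h c assume "g \<in> {g. ?C g}" "h \<in> {g. ?C g}"
    then have C: "?C g" "?C h" by auto
    show "\<Phi> (\<lambda>s. g s + h s) = \<Phi> g + \<Phi> h"
      by (intro eq fun_calc_approx_add \<Phi> C continuous_intros)
    show "\<Phi> (\<lambda>s. g s * h s) = \<Phi> g \<odot> \<Phi> h"
      by (intro eq fun_calc_approx_mult \<Phi> C continuous_intros)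
  next
    fix g and c :: real assume "g \<in> {g. ?C g}"
    then have C: "?C g" by auto
    show "\<Phi> (\<lambda>s. c * g s) = c *\<^sub>R \<Phi> g"
      by (intro eq fun_calc_approx_scale \<Phi> C continuous_intros)
    assume "0 \<le> c"
    then show "norm (\<Phi> g) \<le> c \<longleftrightarrow> (\<forall>s\<in>jspectrum e x. \<bar>g s\<bar> \<le> c)"
      by (rule fun_calc_approx_norm[OF \<Phi>[OF C]])
  next
    show "\<Phi> ` {g. ?C g} = jb_gen e x"
    proof
      show "\<Phi> ` {g. ?C g} \<subseteq> jb_gen e x" using \<Phi> fun_calc_approx_in_gen by blast
      show "jb_gen e x \<subseteq> \<Phi> ` {g. ?C g}"
      proof
        fix y assume "y \<in> jb_gen e x"
        then obtain g where g: "?C g" "fun_calc_approx x g y" using fun_calc_approx_surj by blast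
        then show "y \<in> \<Phi> ` {g. ?C g}" using eq by blast
      qed
    qed
  qed (simp_all add: x e)
  then show ?thesis by blast
qed

lemma jfun_calc_approx:
  assumes "continuous_on (jspectrum e x) g"
  shows "fun_calc_approx x g (jfun_calc e g x)"
proof -
  obtain \<Phi> where \<Phi>: "is_fun_calc e x \<Phi>" using fun_calc_exists by blast
  have "jfun_calc e g x = \<Phi> g"
    unfolding jfun_calc_def
  proof (rule the_equality)
    show "\<exists>\<Psi>. is_fun_calc e x \<Psi> \<and> \<Psi> g = \<Phi> g" using \<Phi> by blast
    fix y assume "\<exists>\<Psi>. is_fun_calc e x \<Psi> \<and> \<Psi> g = y"
    then have "fun_calc_approx x g y" using is_fun_calc_approx[OF _ assms] by blast
    then show "y = \<Phi> g" using is_fun_calc_approx[OF \<Phi> assms] fun_calc_approx_unique by blast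
  qed
  then show ?thesis using is_fun_calc_approx[OF \<Phi> assms] by simp
qed

lemma jfun_calc_eqI:
  assumes "continuous_on (jspectrum e x) g" "fun_calc_approx x h y" "\<And>s. s \<in> jspectrum e x \<Longrightarrow> g s = h s"
  shows "jfun_calc e g x = y"
  by (rule fun_calc_approx_unique[OF jfun_calc_approx[OF assms(1)] assms(2,3)])

end

section \<open>Inverses and the quadratic representation\<close>

lemma quad_rep_add: "quad_rep a (v + w) = quad_rep a v + quad_rep a w"
  and quad_rep_diff: "quad_rep a (v - w) = quad_rep a v - quad_rep a w"
  and quad_rep_scaleR: "quad_rep a (c *\<^sub>R w) = c *\<^sub>R quad_rep a w"
  by (simp_all add: quad_rep_def jprod_distribs algebra_simps)

lemma quad_rep_zero [simp]: "quad_rep a 0 = 0"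
  by (simp add: quad_rep_def)

lemma quad_rep_scaleR_left: "quad_rep (c *\<^sub>R a) w = c\<^sup>2 *\<^sub>R quad_rep a w"
  by (simp add: quad_rep_def jprod_distribs scaleR_diff_right power2_eq_square mult.left_commute)

lemma bounded_linear_quad_rep: "bounded_linear (quad_rep a)"
proof -
  have "bounded_linear (\<lambda>w. 2 *\<^sub>R (a \<odot> (a \<odot> w)) - (a \<odot> a) \<odot> w)"
    by (intro bounded_linear_sub bounded_linear_compose[OF bounded_linear_scaleR_right]
        bounded_linear_compose[OF jprod.bounded_linear_right] jprod.bounded_linear_right)
  then show ?thesis by (simp add: quad_rep_def[abs_def])
qed

lemma jsquare_eq_0: "x \<odot> x = 0 \<Longrightarrow> x = (0 :: 'a::jb_algebra)"
  using norm_jsquare[of x] by simp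

context unital_jb
begin

section \<open>Rules of the functional calculus\<close>

lemma jfun_calc_in_gen: "continuous_on (jspectrum e x) g \<Longrightarrow> jfun_calc e g x \<in> jb_gen e x"
  by (rule fun_calc_approx_in_gen[OF jfun_calc_approx])

lemma jfun_calc_mult:
  assumes "continuous_on (jspectrum e x) g" "continuous_on (jspectrum e x) h"
  shows "jfun_calc e (\<lambda>s. g s * h s) x = jfun_calc e g x \<odot> jfun_calc e h x"
  by (rule jfun_calc_eqI[OF _ fun_calc_approx_mult[OF jfun_calc_approx[OF assms(1)] jfun_calc_approx[OF assms(2)]]])
     (intro continuous_intros assms refl)+

lemma jfun_calc_jpoly:
  assumes "\<And>s. s \<in> jspectrum e x \<Longrightarrow> g s = poly p s"
  shows "jfun_calc e g x = jpoly x p"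
proof -
  have "continuous_on (jspectrum e x) (poly p)" by (intro continuous_intros)
  from iffD2[OF continuous_on_cong[OF refl assms] this] have "continuous_on (jspectrum e x) g" by simp
  then show ?thesis by (rule jfun_calc_eqI[OF _ fun_calc_approx_jpoly]) (use assms in auto)
qed

lemma jfun_calc_id: "jfun_calc e (\<lambda>s. s) x = x"
  by (subst jfun_calc_jpoly[of _ _ "[:0, 1:]"]) auto

lemma jfun_calc_const: "jfun_calc e (\<lambda>s. c) x = c *\<^sub>R e"
  by (subst jfun_calc_jpoly[of _ _ "[:c:]"]) auto

lemma jfun_calc_cong:
  assumes "continuous_on (jspectrum e x) g" "continuous_on (jspectrum e x) h"
    "\<And>s. s \<in> jspectrum e x \<Longrightarrow> g s = h s"
  shows "jfun_calc e g x = jfun_calc e h x"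
  by (rule jfun_calc_eqI[OF assms(1) jfun_calc_approx[OF assms(2)] assms(3)])

lemma jfun_calc_diff:
  assumes "continuous_on (jspectrum e x) g" "continuous_on (jspectrum e x) h"
  shows "jfun_calc e (\<lambda>s. g s - h s) x = jfun_calc e g x - jfun_calc e h x"
proof -
  have "fun_calc_approx x (\<lambda>s. g s + (-1) * h s) (jfun_calc e g x + (-1) *\<^sub>R jfun_calc e h x)"
    by (intro fun_calc_approx_add fun_calc_approx_scale jfun_calc_approx assms)
  then have "fun_calc_approx x (\<lambda>s. g s - h s) (jfun_calc e g x - jfun_calc e h x)" by simp
  then show ?thesis by (rule jfun_calc_eqI[rotated]) (intro continuous_intros assms refl)+
qed

lemma norm_jfun_calc_le_iff:
  assumes "continuous_on (jspectrum e x) g" "0 \<le> c"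
  shows "norm (jfun_calc e g x) \<le> c \<longleftrightarrow> (\<forall>s\<in>jspectrum e x. \<bar>g s\<bar> \<le> c)"
  by (rule fun_calc_approx_norm[OF jfun_calc_approx[OF assms(1)] assms(2)])

lemma jfun_calc_pos:
  assumes g: "continuous_on (jspectrum e x) g" "\<And>s. s \<in> jspectrum e x \<Longrightarrow> 0 \<le> g s"
  shows "jfun_calc e g x \<in> jpos"
proof -
  have c: "continuous_on (jspectrum e x) (\<lambda>s. sqrt (g s))" by (intro continuous_intros g)
  have "jfun_calc e g x = jfun_calc e (\<lambda>s. sqrt (g s) * sqrt (g s)) x"
    by (rule jfun_calc_cong) (use g c in \<open>auto intro!: continuous_intros\<close>)
  also have "\<dots> = jfun_calc e (\<lambda>s. sqrt (g s)) x \<odot> jfun_calc e (\<lambda>s. sqrt (g s)) x"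
    by (rule jfun_calc_mult[OF c c])
  finally show ?thesis by simp
qed

lemma jfun_calc_mono:
  assumes "continuous_on (jspectrum e x) g" "continuous_on (jspectrum e x) h"
    "\<And>s. s \<in> jspectrum e x \<Longrightarrow> g s \<le> h s"
  shows "jfun_calc e g x \<preceq> jfun_calc e h x"
  unfolding jle_def jfun_calc_diff[OF assms(2,1), symmetric]
  by (rule jfun_calc_pos) (use assms in \<open>auto intro!: continuous_intros\<close>)

text \<open>For r = norm (x - c e), positivity gives norm ((r + c) e - x) at most r, hence |r + c -
  s| \<le> r on the spectrum.\<close>

lemma jspectrum_ge:
  assumes "x - c *\<^sub>R e \<in> jpos" "s \<in> jspectrum e x"
  shows "c \<le> s"
proof -
  let ?r = "norm (x - c *\<^sub>R e)"
  have "norm (?r *\<^sub>R e - (x - c *\<^sub>R e)) \<le> ?r" using assms(1) by (rule jpos_norm) simp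
  moreover have "jpoly x [:?r + c, -1:] = ?r *\<^sub>R e - (x - c *\<^sub>R e)"
    by (simp add: jprod.minus_right algebra_simps)
  ultimately have "\<bar>poly [:?r + c, -1:] s\<bar> \<le> ?r"
    using jpoly_spectrum_bound[OF assms(2), of "[:?r + c, -1:]"] by simp
  then show ?thesis by simp
qed

lemma jspectrum_nonneg: "x \<in> jpos \<Longrightarrow> s \<in> jspectrum e x \<Longrightarrow> 0 \<le> s"
  using jspectrum_ge[of x 0 s] by simp

lemma jinvertible_iff_spectrum: "jinvertible e x \<longleftrightarrow> 0 \<notin> jspectrum e x"
  by (simp add: jspectrum_def)

lemma
  assumes "jinvertible e a"
  shows jinv_in_gen: "jinv e a \<in> jb_gen e a" and jprod_jinv: "a \<odot> jinv e a = e"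
proof -
  have 0: "\<And>s. s \<in> jspectrum e a \<Longrightarrow> s \<noteq> 0" using assms by (auto simp: jinvertible_iff_spectrum)
  then have c: "continuous_on (jspectrum e a) inverse" by (intro continuous_intros) auto
  then show "jinv e a \<in> jb_gen e a" unfolding jinv_def by (rule jfun_calc_in_gen)
  have "a \<odot> jinv e a = jfun_calc e (\<lambda>s. s) a \<odot> jfun_calc e inverse a"
    by (simp only: jinv_def jfun_calc_id)
  also have "\<dots> = jfun_calc e (\<lambda>s. s * inverse s) a"
    by (rule jfun_calc_mult[symmetric]) (intro continuous_intros c)+
  also have "\<dots> = jfun_calc e (\<lambda>s. 1) a"
    by (rule jfun_calc_cong) (use 0 c in \<open>auto intro!: continuous_intros\<close>)
  finally show "a \<odot> jinv e a = e" by (simp add: jfun_calc_const)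
qed

section \<open>Inverses in terms of the quadratic representation\<close>

lemma quad_rep_unit [simp]: "quad_rep a e = a \<odot> a"
  by (simp add: quad_rep_def scaleR_2)

lemma quad_rep_unit_left [simp]: "quad_rep e w = w"
  by (simp add: quad_rep_def scaleR_2)

lemma quad_rep_gen:
  assumes "a \<in> jb_gen e x" "b \<in> jb_gen e x"
  shows "quad_rep a b = (a \<odot> a) \<odot> b"
  using jb_gen_assoc[OF assms(1,1,2)] by (simp add: quad_rep_def scaleR_2)

lemma quad_rep_of_quad_unit:
  assumes "quad_rep a v = e"
  shows "quad_rep a (quad_rep v (quad_rep a w)) = w"
  using fundamental_formula[of a v w] by (simp add: assms)

text \<open>Invertibility without reference to the generated subalgebra. By the fundamental formula
  U_a U_v U_a is the identity, so norm w is at most K norm (U_a w); a spike function at the spectral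
  value 0 would violate this.\<close>

lemma jinvertibleI:
  assumes v: "quad_rep a v = e"
  shows "jinvertible e a"
proof (rule ccontr)
  assume "\<not> jinvertible e a"
  then have 0: "0 \<in> jspectrum e a" by (simp add: jinvertible_iff_spectrum)
  have "bounded_linear (\<lambda>w. quad_rep a (quad_rep v w))"
    by (rule bounded_linear_compose[OF bounded_linear_quad_rep bounded_linear_quad_rep])
  then obtain K where K: "K > 0" "\<And>w. norm (quad_rep a (quad_rep v w)) \<le> norm w * K"
    using bounded_linear.pos_bounded by blast
  define n where "n = 1 + K"
  have n: "n > 0" "n\<^sup>2 > K" using K(1) by (auto simp: n_def power2_eq_square algebra_simps add_pos_pos)
  \<comment> \<open>A spike of height 1 at 0 that vanishes for |s| at least 1/n: its image
    \<open>?y\<close> has norm at least 1, whereas s^2 g(s) is at most 1/n^2, which is less than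
    1/K.\<close>
  define g where "g s = max 0 (1 - n * \<bar>s\<bar>)" for s :: real
  have cg: "continuous_on (jspectrum e a) g" unfolding g_def by (intro continuous_intros)
  let ?y = "jfun_calc e g a"
  have y: "1 \<le> norm ?y"
    using norm_jfun_calc_le_iff[OF cg, of "norm ?y"] 0 by (auto simp: g_def dest: bspec[of _ _ 0])
  have "quad_rep a ?y = (a \<odot> a) \<odot> ?y"
    by (rule quad_rep_gen[of _ a]) (intro jb_gen_self jfun_calc_in_gen cg)+
  also have "\<dots> = jfun_calc e (\<lambda>s. (s * s) * g s) a"
    by (subst jfun_calc_mult; (intro continuous_intros cg)?)
       (subst jfun_calc_mult; (intro continuous_intros)?; simp add: jfun_calc_id)
  also have "norm \<dots> \<le> 1 / n\<^sup>2"
  proof (subst norm_jfun_calc_le_iff)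
    show "\<forall>s\<in>jspectrum e a. \<bar>s * s * g s\<bar> \<le> 1 / n\<^sup>2"
    proof
      fix s
      show "\<bar>s * s * g s\<bar> \<le> 1 / n\<^sup>2"
      proof (cases "n * \<bar>s\<bar> \<le> 1")
        case True
        then have "(n * \<bar>s\<bar>) * (n * \<bar>s\<bar>) \<le> 1 * 1" using n by (intro mult_mono) auto
        then have "s * s \<le> 1 / n\<^sup>2" using n by (simp add: field_simps power2_eq_square abs_mult)
        moreover have "0 \<le> g s" "g s \<le> 1" using n by (auto simp: g_def)
        ultimately have "(s * s) * g s \<le> 1 / n\<^sup>2 * 1" by (intro mult_mono) auto
        then show ?thesis using \<open>0 \<le> g s\<close> by (simp add: abs_mult)
      qed (use n in \<open>simp add: g_def\<close>)
    qed
  qed (use cg in \<open>auto intro!: continuous_intros\<close>)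
  finally have "norm (quad_rep a ?y) * K \<le> 1 / n\<^sup>2 * K" using K(1) by (intro mult_right_mono) auto
  moreover have "1 / n\<^sup>2 * K < 1" using n K(1) by (simp add: field_simps)
  moreover have "norm ?y \<le> norm (quad_rep a ?y) * K"
    using K(2)[of "quad_rep a ?y"] by (simp add: quad_rep_of_quad_unit[OF v])
  ultimately show False using y by linarith
qed

lemma quad_rep_jinv_self: "jinvertible e a \<Longrightarrow> quad_rep a (jinv e a) = a"
  using quad_rep_gen[OF jb_gen_self jinv_in_gen] jb_gen_assoc[OF jb_gen_self jb_gen_self jinv_in_gen]
    jprod_jinv by simp

lemma quad_rep_jinv_square:
  assumes "jinvertible e a"
  shows "quad_rep a (jinv e a \<odot> jinv e a) = e"
proof -
  note m = jb_gen_self jinv_in_gen[OF assms]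
  have "quad_rep a (jinv e a \<odot> jinv e a) = (a \<odot> a) \<odot> (jinv e a \<odot> jinv e a)"
    by (rule quad_rep_gen[of _ a]) (intro m jb_gen_jprod)+
  also have "\<dots> = a \<odot> (a \<odot> (jinv e a \<odot> jinv e a))" by (intro jb_gen_assoc[of _ a] m jb_gen_jprod)
  also have "a \<odot> (jinv e a \<odot> jinv e a) = (a \<odot> jinv e a) \<odot> jinv e a" by (intro jb_gen_assoc[of _ a, symmetric] m)
  finally show ?thesis by (simp add: jprod_jinv[OF assms])
qed

lemma quad_rep_inject: "jinvertible e a \<Longrightarrow> quad_rep a v = quad_rep a w \<Longrightarrow> v = w"
  by (metis quad_rep_of_quad_unit quad_rep_jinv_square)

text \<open>Describes the inverse by equations in U_a. Unlike the functional calculus behind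
  \<open>jinv\<close>, they are easily transported by other quadratic representations and by Jordan
  isomorphisms.\<close>

lemma jinvI:
  assumes "quad_rep a v = e" "quad_rep a y = a"
  shows "jinv e a = y"
  using quad_rep_inject[OF jinvertibleI[OF assms(1)]] quad_rep_jinv_self[OF jinvertibleI[OF assms(1)]] assms(2)
  by simp

lemma gen_inverse:
  assumes "a \<in> jb_gen e x" "y \<in> jb_gen e x" "a \<odot> y = e"
  shows "jinvertible e a" "jinv e a = y"
proof -
  have "quad_rep a (y \<odot> y) = (a \<odot> a) \<odot> (y \<odot> y)"
    by (rule quad_rep_gen[of _ x]) (intro assms jb_gen_jprod)+
  also have "\<dots> = a \<odot> (a \<odot> (y \<odot> y))" by (intro jb_gen_assoc[of _ x] assms jb_gen_jprod)
  also have "a \<odot> (y \<odot> y) = (a \<odot> y) \<odot> y" by (intro jb_gen_assoc[of _ x, symmetric] assms)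
  finally have 1: "quad_rep a (y \<odot> y) = e" by (simp add: assms)
  then show "jinvertible e a" by (rule jinvertibleI)
  have "quad_rep a y = a"
    using quad_rep_gen[OF assms(1,2)] jb_gen_assoc[OF assms(1,1,2)] by (simp add: assms)
  with 1 show "jinv e a = y" by (rule jinvI)
qed

lemma jinvertible_jinv: "jinvertible e a \<Longrightarrow> jinvertible e (jinv e a)"
  and jinv_jinv: "jinvertible e a \<Longrightarrow> jinv e (jinv e a) = a"
  using gen_inverse[OF jinv_in_gen jb_gen_self] jprod_jinv by (simp_all add: jprod_commute)

lemma jinv_unit: "jinvertible e e" "jinv e e = e"
  using gen_inverse[OF jb_gen_unit jb_gen_unit] by simp_all

lemma quad_rep_jinv_left:
  assumes "jinvertible e a"
  shows "quad_rep (jinv e a) (quad_rep a w) = w"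
proof (rule quad_rep_inject[OF assms])
  show "quad_rep a (quad_rep (jinv e a) (quad_rep a w)) = quad_rep a w"
    using fundamental_formula[of a "jinv e a" w] by (simp add: quad_rep_jinv_self assms)
qed

lemma quad_rep_jinv_right:
  assumes "jinvertible e a"
  shows "quad_rep a (quad_rep (jinv e a) w) = w"
  using quad_rep_jinv_left[OF jinvertible_jinv[OF assms]] by (simp add: jinv_jinv assms)

lemma jinvertible_quad_rep:
  assumes "jinvertible e a" "jinvertible e b"
  shows "jinvertible e (quad_rep a b)" and jinv_quad_rep: "jinv e (quad_rep a b) = quad_rep (jinv e a) (jinv e b)"
proof -
  \<comment> \<open>By the fundamental formula the operator of U_a b is U_a U_b U_a;
    \<open>?v\<close> is the inverse operator applied to the unit.\<close>
  let ?v = "quad_rep (jinv e a) (quad_rep (jinv e b) (quad_rep (jinv e a) e))"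
  have 1: "quad_rep (quad_rep a b) ?v = e"
    unfolding fundamental_formula quad_rep_jinv_right[OF assms(1)] quad_rep_jinv_right[OF assms(2)] ..
  then show "jinvertible e (quad_rep a b)" by (rule jinvertibleI)
  have "quad_rep (quad_rep a b) (quad_rep (jinv e a) (jinv e b)) = quad_rep a b"
    by (simp add: fundamental_formula quad_rep_jinv_right quad_rep_jinv_self assms)
  with 1 show "jinv e (quad_rep a b) = quad_rep (jinv e a) (jinv e b)" by (rule jinvI)
qed

text \<open>Membership in the interior of the cone (\<open>interior_jpos\<close>), or equivalently
  being positive and invertible (\<open>spos_iff\<close>). The uniform lower bound makes stability
  under enlargement and sums immediate.\<close>

definition spos :: "'a \<Rightarrow> bool" where
  "spos a \<longleftrightarrow> (\<exists>\<epsilon>>0. a - \<epsilon> *\<^sub>R e \<in> jpos)"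

lemma spos_pos: "spos a \<Longrightarrow> a \<in> jpos"
proof -
  assume "spos a"
  then obtain \<epsilon> where "\<epsilon> > 0" "a - \<epsilon> *\<^sub>R e \<in> jpos" by (auto simp: spos_def)
  then have "(a - \<epsilon> *\<^sub>R e) + \<epsilon> *\<^sub>R e \<in> jpos" by (intro jpos_add jpos_scaleR) auto
  then show "a \<in> jpos" by simp
qed

lemma spos_iff: "spos a \<longleftrightarrow> a \<in> jpos \<and> jinvertible e a"
proof
  assume s: "spos a"
  then obtain \<epsilon> where \<epsilon>: "\<epsilon> > 0" "a - \<epsilon> *\<^sub>R e \<in> jpos" by (auto simp: spos_def)
  then have "0 \<notin> jspectrum e a" using jspectrum_ge[OF \<epsilon>(2), of 0] by auto
  then show "a \<in> jpos \<and> jinvertible e a" using spos_pos[OF s] by (simp add: jinvertible_iff_spectrum)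
next
  assume "a \<in> jpos \<and> jinvertible e a"
  then show "spos a" using gen_invertible_pos_ge[OF jb_gen_self] by (auto simp: spos_def jinvertible_def)
qed

lemma spos_invertible: "spos a \<Longrightarrow> jinvertible e a"
  by (simp add: spos_iff)

lemma spos_unit: "spos e"
  by (auto simp: spos_iff jinv_unit)

lemma spos_mono:
  assumes "spos a" "a \<preceq> b"
  shows "spos b"
proof -
  from assms(1) obtain \<epsilon> where "\<epsilon> > 0" "a - \<epsilon> *\<^sub>R e \<in> jpos" by (auto simp: spos_def)
  with jpos_add[OF this(2) assms(2)[unfolded jle_def]] show ?thesis by (auto simp: spos_def algebra_simps)
qed

lemma spos_add: "spos a \<Longrightarrow> b \<in> jpos \<Longrightarrow> spos (a + b)"
  using spos_mono[of a "a + b"] by (simp add: jle_def)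

lemma spos_scaleR:
  assumes "spos a" "c > 0"
  shows "spos (c *\<^sub>R a)"
proof -
  from assms(1) obtain \<epsilon> where "\<epsilon> > 0" "a - \<epsilon> *\<^sub>R e \<in> jpos" by (auto simp: spos_def)
  with jpos_scaleR[OF this(2), of c] assms(2) show ?thesis
    unfolding spos_def by (intro exI[of _ "c * \<epsilon>"]) (simp add: scaleR_diff_right)
qed

lemma interior_jpos: "a \<in> interior jpos \<longleftrightarrow> spos a"
proof
  assume "a \<in> interior jpos"
  then obtain d where d: "d > 0" "cball a d \<subseteq> jpos" by (meson interior_subset mem_interior_cball)
  have "norm (d *\<^sub>R e) \<le> d" using norm_unit_le d(1) by (simp add: mult_left_le)
  then have "a - d *\<^sub>R e \<in> jpos" using d(2) by (intro subsetD[OF d(2)]) (simp add: dist_norm)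
  with d(1) show "spos a" by (auto simp: spos_def)
next
  assume "spos a"
  then obtain \<epsilon> where \<epsilon>: "\<epsilon> > 0" "a - \<epsilon> *\<^sub>R e \<in> jpos" by (auto simp: spos_def)
  have "cball a \<epsilon> \<subseteq> jpos"
  proof
    fix b assume "b \<in> cball a \<epsilon>"
    then have "norm (a - b) \<le> \<epsilon>" by (simp add: dist_norm)
    from jpos_add[OF \<epsilon>(2) unit_minus_pos[OF this]] show "b \<in> jpos" by simp
  qed
  with \<epsilon>(1) show "a \<in> interior jpos" by (auto simp: mem_interior_cball)
qed

text \<open>Along the segment from e to w the image under U_a stays invertible. It starts at the
  positive element a^2; a positive invertible element has a positive neighbourhood and the cone is
  closed, so positivity cannot be lost on the way.\<close>

lemma quad_rep_invertible_spos:
  assumes a: "jinvertible e a" and w: "spos w"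
  shows "quad_rep a w \<in> jpos"
proof -
  define h where "h t = e + t *\<^sub>R (w - e)" for t :: real
  have hs: "spos (h t)" if t: "0 \<le> t" "t \<le> 1" for t
  proof (cases "t = 1")
    case True
    then show ?thesis using w by (simp add: h_def)
  next
    case False
    have "spos ((1 - t) *\<^sub>R e + t *\<^sub>R w)"
      using False t w by (intro spos_add spos_scaleR jpos_scaleR spos_unit spos_pos) auto
    moreover have "h t = (1 - t) *\<^sub>R e + t *\<^sub>R w" by (simp add: h_def algebra_simps)
    ultimately show ?thesis by simp
  qed
  define k where "k t = a \<odot> a + t *\<^sub>R quad_rep a (w - e)" for t
  have k: "k t = quad_rep a (h t)" for t
    by (simp add: k_def h_def quad_rep_add quad_rep_scaleR)
  have ki: "jinvertible e (k t)" if "0 \<le> t" "t \<le> 1" for t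
    unfolding k by (rule jinvertible_quad_rep[OF a spos_invertible[OF hs[OF that]]])
  define S where "S = {0..1} \<inter> k -` jpos"
  have "closed S" unfolding S_def k_def
    by (intro closed_Int continuous_closed_vimage jpos_closed continuous_intros closed_real_atLeastAtMost)
  moreover have S0: "0 \<in> S" by (simp add: S_def k_def)
  moreover have bdd: "bdd_above S" by (auto simp: S_def bdd_above_def)
  ultimately have T: "Sup S \<in> S" by (intro closed_contains_Sup) auto
  define T where "T = Sup S"
  have T01: "0 \<le> T" "T \<le> 1" "k T \<in> jpos" using T by (auto simp: S_def T_def)
  have "T = 1"
  proof (rule ccontr)
    assume "T \<noteq> 1"
    then have T1: "T < 1" using T01 by simp
    have "spos (k T)" using T01 ki by (simp add: spos_iff)
    then obtain \<delta> where \<delta>: "\<delta> > 0" "k T - \<delta> *\<^sub>R e \<in> jpos" by (auto simp: spos_def)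
    let ?N = "norm (quad_rep a (w - e)) + 1"
    have N: "?N > 0" by (simp add: add_nonneg_pos)
    define \<eta> where "\<eta> = min (1 - T) (\<delta> / ?N)"
    have \<eta>: "\<eta> > 0" "\<eta> \<le> 1 - T" "\<eta> \<le> \<delta> / ?N" using T1 \<delta>(1) N by (simp_all add: \<eta>_def)
    have "\<eta> * ?N \<le> \<delta>" using \<eta>(3) N by (simp add: field_simps)
    then have "norm (\<eta> *\<^sub>R quad_rep a (w - e)) \<le> \<delta>" using \<eta>(1) by (simp add: algebra_simps)
    from jpos_add[OF \<delta>(2) unit_plus_pos[OF this]] have "k (T + \<eta>) \<in> jpos"
      by (simp add: k_def algebra_simps)
    then have "T + \<eta> \<in> S" using \<eta> T01 by (simp add: S_def)
    then have "T + \<eta> \<le> T" unfolding T_def by (rule cSup_upper[OF _ bdd])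
    with \<eta>(1) show False by simp
  qed
  with T01(3) show ?thesis by (simp add: k h_def)
qed

lemma quad_rep_invertible_pos:
  assumes a: "jinvertible e a" and w: "w \<in> jpos"
  shows "quad_rep a w \<in> jpos"
proof -
  have "0 \<preceq> quad_rep a w + \<epsilon> *\<^sub>R (a \<odot> a)" if "\<epsilon> > 0" for \<epsilon>
  proof -
    have "spos (\<epsilon> *\<^sub>R e + w)" using that w by (intro spos_add spos_scaleR spos_unit)
    from quad_rep_invertible_spos[OF a this] show ?thesis
      by (simp add: jle_zero_iff quad_rep_add quad_rep_scaleR add.commute)
  qed
  from jle_closed[OF this] show ?thesis by (simp add: jle_zero_iff)
qed

lemma quad_rep_pos:
  fixes a :: 'a
  assumes a: "a \<in> jpos" and w: "w \<in> jpos"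
  shows "quad_rep a w \<in> jpos"
proof -
  have lim: "(\<lambda>n. quad_rep (a + (1 / real (Suc n)) *\<^sub>R e) w) \<longlonglongrightarrow> quad_rep (a + 0 *\<^sub>R e) w"
    unfolding quad_rep_def
    by (intro tendsto_intros jprod.tendsto LIMSEQ_inverse_real_of_nat[unfolded inverse_eq_divide])
  have "quad_rep (a + (1 / real (Suc n)) *\<^sub>R e) w \<in> jpos" for n
  proof -
    have "spos ((1 / real (Suc n)) *\<^sub>R e + a)" using a by (intro spos_add spos_scaleR spos_unit) auto
    then show ?thesis using w by (intro quad_rep_invertible_pos spos_invertible) (simp_all add: add.commute)
  qed
  then have "quad_rep (a + 0 *\<^sub>R e) w \<in> jpos" by (rule closed_sequentially[OF jpos_closed _ lim])
  then show ?thesis by simp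
qed

lemma quad_rep_mono: "(a::'a) \<in> jpos \<Longrightarrow> v \<preceq> w \<Longrightarrow> quad_rep a v \<preceq> quad_rep a w"
  unfolding jle_def by (simp add: quad_rep_pos flip: quad_rep_diff)

lemma quad_rep_invertible_mono: "jinvertible e a \<Longrightarrow> v \<preceq> w \<Longrightarrow> quad_rep a v \<preceq> quad_rep a w"
  unfolding jle_def by (simp add: quad_rep_invertible_pos flip: quad_rep_diff)

lemma quad_rep_le_iff: "jinvertible e a \<Longrightarrow> quad_rep a v \<preceq> quad_rep a w \<longleftrightarrow> v \<preceq> w"
  using quad_rep_invertible_mono[of a v w] quad_rep_invertible_mono[of "jinv e a" "quad_rep a v" "quad_rep a w"]
  by (auto simp: jinvertible_jinv quad_rep_jinv_left)

lemma spos_quad_rep: "jinvertible e a \<Longrightarrow> spos w \<Longrightarrow> spos (quad_rep a w)"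
  by (simp add: spos_iff quad_rep_invertible_pos jinvertible_quad_rep)

lemma spos_jinv: "spos a \<Longrightarrow> spos (jinv e a)"
  using spos_quad_rep[of "jinv e a" a] quad_rep_jinv_self[of "jinv e a"]
  by (simp add: spos_invertible jinvertible_jinv jinv_jinv)

section \<open>Square roots and monotonicity of inversion\<close>

lemma
  assumes a: "a \<in> jpos"
  shows jsqrt_in_gen: "jsqrt e a \<in> jb_gen e a" and jsqrt_pos: "jsqrt e a \<in> jpos"
    and jsqrt_square: "jsqrt e a \<odot> jsqrt e a = a"
proof -
  have c: "continuous_on (jspectrum e a) sqrt" by (intro continuous_intros)
  show "jsqrt e a \<in> jb_gen e a" unfolding jsqrt_def by (rule jfun_calc_in_gen[OF c])
  show "jsqrt e a \<in> jpos" unfolding jsqrt_def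
    by (rule jfun_calc_pos[OF c]) (use a jspectrum_nonneg in auto)
  have "jsqrt e a \<odot> jsqrt e a = jfun_calc e (\<lambda>s. sqrt s * sqrt s) a"
    unfolding jsqrt_def by (rule jfun_calc_mult[OF c c, symmetric])
  also have "\<dots> = jfun_calc e (\<lambda>s. s) a"
    by (rule jfun_calc_cong) (use a jspectrum_nonneg in \<open>auto intro!: continuous_intros\<close>)
  finally show "jsqrt e a \<odot> jsqrt e a = a" by (simp add: jfun_calc_id)
qed

lemma spos_jsqrt:
  assumes "spos a"
  shows "spos (jsqrt e a)"
proof -
  have a: "a \<in> jpos" "jinvertible e a" using assms by (auto simp: spos_iff)
  have "quad_rep (jsqrt e a) (jinv e a) = (jsqrt e a \<odot> jsqrt e a) \<odot> jinv e a"
    by (rule quad_rep_gen[of _ a]) (intro jsqrt_in_gen jinv_in_gen a)+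
  then have "quad_rep (jsqrt e a) (jinv e a) = e" by (simp add: jsqrt_square a jprod_jinv)
  then show ?thesis by (simp add: spos_iff jsqrt_pos a jinvertibleI)
qed

text \<open>The difference u of two positive roots s and d satisfies u (s + d) = 0, so the positive
  elements u^2 s and u^2 d add up to 0 and both vanish. Then u^3 = 0 and u = 0.\<close>

lemma jsqrt_unique:
  assumes d: "d \<in> jpos" "d \<odot> d = a"
  shows "jsqrt e a = d"
proof -
  have a: "a \<in> jpos" using d(2) jpos_square by metis
  have ad: "a \<in> jb_gen e d" using d(2) jb_gen_jprod[OF jb_gen_self jb_gen_self] by metis
  let ?s = "jsqrt e a" and ?u = "jsqrt e a - d"
  have s: "?s \<in> jb_gen e d" using jsqrt_in_gen[OF a] ad by (rule jb_gen_trans)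
  have dm: "d \<in> jb_gen e d" by (rule jb_gen_self)
  have u: "?u \<in> jb_gen e d" by (intro jb_gen_diff s dm)
  have "?u \<odot> (?s + d) = ?s \<odot> ?s - d \<odot> d"
    by (simp add: jprod_distribs jprod_commute[of d ?s])
  then have "?u \<odot> (?s + d) = 0" by (simp add: jsqrt_square[OF a] d)
  then have z: "(?u \<odot> ?u) \<odot> ?s + (?u \<odot> ?u) \<odot> d = 0"
    using jb_gen_assoc[OF u u jb_gen_add[OF s dm]] by (simp add: jprod.add_right)
  have p: "(?u \<odot> ?u) \<odot> ?s \<in> jpos" "(?u \<odot> ?u) \<odot> d \<in> jpos"
    by (intro jpos_jprod[of _ d] jb_gen_jprod u s dm jpos_square jsqrt_pos a d)+
  from z have "- ((?u \<odot> ?u) \<odot> ?s) = (?u \<odot> ?u) \<odot> d" by (rule minus_unique)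
  with p have 1: "(?u \<odot> ?u) \<odot> ?s = 0" by (intro jpos_antisym) simp_all
  have "(?u \<odot> ?u) \<odot> ?u = (?u \<odot> ?u) \<odot> ?s - (?u \<odot> ?u) \<odot> d" by (rule jprod.diff_right)
  also have "(?u \<odot> ?u) \<odot> d = 0" using z unfolding 1 by simp
  finally have "(?u \<odot> ?u) \<odot> ?u = 0" unfolding 1 by simp
  then have "(?u \<odot> ?u) \<odot> (?u \<odot> ?u) = 0"
    using jb_gen_assoc[OF jb_gen_jprod[OF u u] u u] by (metis jprod.zero_left)
  then have "?u = 0" by (rule jsquare_eq_0[OF jsquare_eq_0])
  then show ?thesis by simp
qed

text \<open>With s the inverse root of v, the inverse of v is U_s e, which is below U_s v =
  e.\<close>

lemma jinv_le_unit:
  assumes "e \<preceq> v"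
  shows "jinv e v \<preceq> e"
proof -
  have v: "spos v" using spos_mono[OF spos_unit assms] .
  define s where "s = jinv e (jsqrt e v)"
  have sq: "jinvertible e (jsqrt e v)" using v by (intro spos_invertible spos_jsqrt)
  have sv: "quad_rep s v = e"
    using quad_rep_jinv_left[OF sq, of e] by (simp add: s_def jsqrt_square spos_pos v)
  have "jinv e v = jinv e (quad_rep (jsqrt e v) e)" by (simp add: jsqrt_square spos_pos v)
  also have "\<dots> = quad_rep s e" unfolding s_def by (simp only: jinv_quad_rep sq jinv_unit)
  finally have "jinv e v = quad_rep s e" .
  moreover have "quad_rep s e \<preceq> quad_rep s v"
    unfolding s_def by (intro quad_rep_invertible_mono jinvertible_jinv sq assms)
  ultimately show ?thesis by (simp add: sv)
qed

text \<open>For r the inverse root of x, U_r sends x to e and so reduces the claim to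
  \<open>jinv_le_unit\<close>.\<close>

lemma jinv_antimono:
  assumes x: "spos x" and "x \<preceq> y"
  shows "jinv e y \<preceq> jinv e x"
proof -
  have y: "spos y" using spos_mono assms by blast
  define r where "r = jinv e (jsqrt e x)"
  have sq: "jinvertible e (jsqrt e x)" using x by (intro spos_invertible spos_jsqrt)
  have r: "jinvertible e r" unfolding r_def by (rule jinvertible_jinv[OF sq])
  have rx: "quad_rep r x = e"
    using quad_rep_jinv_left[OF sq, of e] by (simp add: r_def jsqrt_square spos_pos x)
  have "e \<preceq> quad_rep r y" using quad_rep_invertible_mono[OF r assms(2)] by (simp add: rx)
  then have "jinv e (quad_rep r y) \<preceq> jinv e (quad_rep r x)" by (simp add: rx jinv_unit jinv_le_unit)
  then show ?thesis
    by (simp add: jinv_quad_rep r spos_invertible x y quad_rep_le_iff jinvertible_jinv)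
qed

lemma jinv_le_iff:
  assumes "spos x" "spos y"
  shows "jinv e y \<preceq> jinv e x \<longleftrightarrow> x \<preceq> y"
  using jinv_antimono[OF assms(1)] jinv_antimono[of "jinv e y" "jinv e x"] assms
  by (auto simp: spos_jinv jinv_jinv spos_invertible)

section \<open>Orthogonality of positive elements\<close>

lemma square_le: "(a::'a) \<in> jpos \<Longrightarrow> a \<odot> a \<preceq> norm a *\<^sub>R a"
  using jpos_jprod[of "norm a *\<^sub>R e - a" a a] by (simp add: jle_def unit_minus_pos jb_gen_intros jprod_distribs)

lemma jle_zero_eq: "(a::'a) \<in> jpos \<Longrightarrow> a \<preceq> 0 \<Longrightarrow> a = 0"
  using jpos_antisym[of a] by (simp add: jle_def)

lemma quad_rep_square_zero:
  fixes a y :: 'a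
  assumes "a \<in> jpos" "y \<in> jpos" "quad_rep y a = 0"
  shows "quad_rep y (a \<odot> a) = 0"
proof (rule jle_zero_eq)
  show "quad_rep y (a \<odot> a) \<in> jpos" using assms(2) by (rule quad_rep_pos) simp
  show "quad_rep y (a \<odot> a) \<preceq> 0"
    using quad_rep_mono[OF assms(2) square_le[OF assms(1)]] by (simp add: quad_rep_scaleR assms(3))
qed

text \<open>By the fundamental formula the square of U_a y is U_a U_y (a^2), and U_y (a^2) vanishes
  because a^2 is below a multiple of a.\<close>

lemma quad_rep_zero_commute:
  fixes a y :: 'a
  assumes "a \<in> jpos" "y \<in> jpos" "quad_rep y a = 0"
  shows "quad_rep a y = 0"
proof (rule jsquare_eq_0)
  have "quad_rep a y \<odot> quad_rep a y = quad_rep (quad_rep a y) e" by simp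
  also have "\<dots> = quad_rep a (quad_rep y (a \<odot> a))" unfolding fundamental_formula by simp
  finally show "quad_rep a y \<odot> quad_rep a y = 0" using quad_rep_square_zero[OF assms] by simp
qed

lemma jprod_zero_if_quad_rep_zero:
  fixes a y :: 'a
  assumes "a \<in> jpos" "y \<in> jpos" "quad_rep y a = 0"
  shows "a \<odot> y = 0"
proof (rule jsquare_eq_0)
  have "4 *\<^sub>R ((a \<odot> y) \<odot> (a \<odot> y)) = 2 *\<^sub>R (a \<odot> quad_rep y a) + quad_rep a (y \<odot> y) + quad_rep y (a \<odot> a)"
    by (rule jprod_square_quad)
  also have "\<dots> = 0"
    using assms quad_rep_square_zero[OF assms(1,2,3)] quad_rep_square_zero[OF assms(2,1) quad_rep_zero_commute[OF assms]]
    by simp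
  finally show "(a \<odot> y) \<odot> (a \<odot> y) = 0" by simp
qed

end

section \<open>Projections, atoms and extreme rays\<close>

text \<open>Banach-Alaoglu for balls: in a dual space, closed balls any finitely many of which meet
  have a common point. Functionals are regarded as points of a product of intervals, where
  Tychonoff's theorem applies.\<close>

lemma jbw_ball_intersection:
  fixes c :: "'i \<Rightarrow> 'a::jb_algebra" and r :: "'i \<Rightarrow> real"
  assumes jbw: "jbw_algebra TYPE('a) TYPE('p::banach)"
    and fip: "\<And>J. finite J \<Longrightarrow> J \<subseteq> I \<Longrightarrow> \<exists>x. \<forall>i\<in>J. norm (x - c i) \<le> r i"
  shows "\<exists>x. \<forall>i\<in>I. norm (x - c i) \<le> r i"
proof (cases "I = {}")
  case False
  then obtain i0 where i0: "i0 \<in> I" by blast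
  obtain D :: "'a \<Rightarrow> 'p \<Rightarrow>\<^sub>L real" where D: "linear D" "bij D" "\<And>x. norm (D x) = norm x"
    using jbw by (auto simp: jbw_algebra_def)
  have Dd: "\<bar>blinfun_apply (D x) v - blinfun_apply (D y) v\<bar> \<le> norm (x - y) * norm v" for x y v
    using norm_blinfun[of "D (x - y)" v] unfolding D(3) by (simp add: linear_diff[OF D(1)] blinfun.diff_left)
  \<comment> \<open>A single ball of the family bounds all candidates and confines them to the
    compact box \<open>K\<close>.\<close>
  define R where "R = norm (c i0) + \<bar>r i0\<bar>"
  define K where "K = Pi\<^sub>E (UNIV :: 'p set) (\<lambda>v. {- (R * norm v)..R * norm v})"
  define L where "L = {f :: 'p \<Rightarrow> real. (\<forall>u v. f (u + v) = f u + f v) \<and> (\<forall>k v. f (k *\<^sub>R v) = k * f v)}"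
  define B where "B i = {f :: 'p \<Rightarrow> real. \<forall>v. \<bar>f v - blinfun_apply (D (c i)) v\<bar> \<le> r i * norm v}" for i
  have "compactin (product_topology (\<lambda>i. euclidean) UNIV) K"
    unfolding K_def compactin_PiE by simp
  then have "compact K" by (simp add: euclidean_product_topology)
  moreover have "closed L"
    unfolding L_def by (intro closed_Collect_conj closed_Collect_all closed_Collect_eq continuous_intros
        continuous_on_product_coordinates)
  ultimately have compact: "compact (K \<inter> L)" by (rule compact_Int_closed)
  have closed: "closed (B i)" for i
    unfolding B_def by (intro closed_Collect_all closed_Collect_le continuous_intros
        continuous_on_product_coordinates)
  have "(K \<inter> L) \<inter> (\<Inter>i\<in>I. B i) \<noteq> {}"
  proof (rule compact_imp_fip_image[OF compact closed])
    fix J assume J: "finite J" "J \<subseteq> I"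
    then obtain x where x: "\<And>i. i \<in> insert i0 J \<Longrightarrow> norm (x - c i) \<le> r i"
      using fip[of "insert i0 J"] i0 by auto
    have "norm x \<le> R"
      using norm_triangle_ineq[of "x - c i0" "c i0"] x[of i0] by (simp add: R_def)
    then have xR: "\<bar>blinfun_apply (D x) v\<bar> \<le> R * norm v" for v
      using norm_blinfun[of "D x" v] mult_right_mono[of "norm x" R "norm v"] by (simp add: D)
    have "blinfun_apply (D x) \<in> K \<inter> L"
      using xR by (auto simp: K_def L_def blinfun.add_right blinfun.scaleR_right abs_le_iff PiE_iff minus_le_iff)
    moreover have "blinfun_apply (D x) \<in> B i" if "i \<in> J" for i
      unfolding B_def using that by (auto intro!: order_trans[OF Dd] mult_right_mono x)
    ultimately show "(K \<inter> L) \<inter> (\<Inter>i\<in>J. B i) \<noteq> {}" by blast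
  qed
  then obtain f where f: "f \<in> K" "f \<in> L" "\<And>i. i \<in> I \<Longrightarrow> f \<in> B i" by blast
  have "bounded_linear f"
  proof (rule bounded_linear_intro)
    show "f (u + v) = f u + f v" "f (k *\<^sub>R v) = k *\<^sub>R f v" for u v k using f(2) by (simp_all add: L_def)
    show "norm (f v) \<le> norm v * R" for v
      using f(1) by (auto simp: K_def PiE_iff abs_le_iff minus_le_iff mult.commute dest!: spec[of _ v])
  qed
  then have F: "blinfun_apply (Blinfun f) = f" by (rule bounded_linear_Blinfun_apply)
  obtain x where x: "D x = Blinfun f" using D(2) by (metis bij_pointE)
  have "norm (x - c i) \<le> r i" if i: "i \<in> I" for i
  proof -
    have r: "0 \<le> r i" using fip[of "{i}"] i order_trans[OF norm_ge_zero] by force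
    have "norm (D (x - c i)) \<le> r i"
    proof (rule norm_blinfun_bound[OF r])
      fix v show "norm (blinfun_apply (D (x - c i)) v) \<le> r i * norm v"
        using f(3)[OF i] by (simp add: B_def linear_diff[OF D(1)] blinfun.diff_left x F)
    qed
    then show ?thesis by (simp add: D)
  qed
  then show ?thesis by blast
qed simp

context unital_jb
begin

section \<open>Suprema of bounded chains\<close>

lemma norm_mono: "(a::'a) \<in> jpos \<Longrightarrow> a \<preceq> b \<Longrightarrow> norm a \<le> norm b"
proof -
  assume a: "a \<in> jpos" "a \<preceq> b"
  have "(norm b *\<^sub>R e - b) + (b - a) \<in> jpos"
    using a(2) by (intro jpos_add unit_minus_pos) (auto simp: jle_def)
  moreover have "norm b *\<^sub>R e + a \<in> jpos" using a(1) by (intro jpos_add jpos_scaleR) auto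
  ultimately show ?thesis by (subst norm_le_iff) (auto simp: algebra_simps)
qed

text \<open>An order interval is the intersection of the balls of radius r around a + r e and b - r
  e. This is the inclusion into the balls; \<open>jposI_norm'\<close> supplies the other one in
  \<open>chain_supremum\<close>.\<close>

lemma order_interval_balls:
  assumes "a \<preceq> w" "w \<preceq> b"
  defines "r \<equiv> norm (b - a)"
  shows "norm (w - (a + r *\<^sub>R e)) \<le> r" "norm (w - (b - r *\<^sub>R e)) \<le> r"
proof -
  have "norm (w - a) \<le> r" "norm (b - w) \<le> r"
    unfolding r_def using assms by (auto intro!: norm_mono simp: jle_def)
  then have "norm (r *\<^sub>R e - (w - a)) \<le> r" "norm (r *\<^sub>R e - (b - w)) \<le> r"
    using assms by (auto intro!: jpos_norm simp: jle_def)
  then show "norm (w - (a + r *\<^sub>R e)) \<le> r" "norm (w - (b - r *\<^sub>R e)) \<le> r"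
    by (simp_all add: norm_minus_commute algebra_simps)
qed

text \<open>The supremum has to lie in every interval [y, v] with y in the chain and v an upper
  bound, that is, in a family of balls. Finitely many of these intervals share the greatest of their
  left ends.\<close>

lemma chain_supremum:
  fixes C :: "'a set"
  assumes jbw: "jbw_algebra TYPE('a) TYPE('p::banach)"
    and ne: "C \<noteq> {}" and chain: "\<And>x y. x \<in> C \<Longrightarrow> y \<in> C \<Longrightarrow> x \<preceq> y \<or> y \<preceq> x"
    and bdd: "\<And>x. x \<in> C \<Longrightarrow> x \<preceq> b0"
  shows "\<exists>w. (\<forall>y\<in>C. y \<preceq> w) \<and> (\<forall>v. (\<forall>y\<in>C. y \<preceq> v) \<longrightarrow> w \<preceq> v)"
proof -
  define U where "U = {v. \<forall>y\<in>C. y \<preceq> v}"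
  define I where "I = C \<times> U \<times> (UNIV :: bool set)"
  define r where "r i = (case i of (a, b, s) \<Rightarrow> norm (b - a))" for i :: "'a \<times> 'a \<times> bool"
  define c where "c i = (case i of (a, b, s) \<Rightarrow> if s then a + r i *\<^sub>R e else b - r i *\<^sub>R e)" for i :: "'a \<times> 'a \<times> bool"
  have max: "\<exists>m\<in>C. \<forall>a\<in>A. a \<preceq> m" if "finite A" "A \<subseteq> C" for A
    using that
  proof (induction A)
    case empty
    then show ?case using ne by blast
  next
    case (insert a A)
    then obtain m where m: "m \<in> C" "\<forall>a\<in>A. a \<preceq> m" by auto
    from chain[of a m] insert.prems m(1) have "a \<preceq> m \<or> m \<preceq> a" by auto
    then show ?case
    proof
      assume "m \<preceq> a"
      then show ?thesis using m insert.prems jle_trans[of _ m a] by (intro bexI[of _ a]) auto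
    qed (use m in auto)
  qed
  have "\<exists>x. \<forall>i\<in>I. norm (x - c i) \<le> r i"
  proof (rule jbw_ball_intersection[OF jbw])
    fix J assume J: "finite J" "J \<subseteq> I"
    have "finite (fst ` J)" "fst ` J \<subseteq> C" using J by (auto simp: I_def)
    from max[OF this] obtain m where m: "m \<in> C" "\<And>a. a \<in> fst ` J \<Longrightarrow> a \<preceq> m" by blast
    have "norm (m - c i) \<le> r i" if i: "i \<in> J" for i
    proof -
      obtain a b s where abs: "i = (a, b, s)" by (cases i)
      have "a \<preceq> m" using m(2) i abs by force
      moreover have "m \<preceq> b" using J(2) i abs m(1) by (auto simp: I_def U_def)
      ultimately show ?thesis using order_interval_balls[of a m b] by (simp add: c_def r_def abs)
    qed
    then show "\<exists>x. \<forall>i\<in>J. norm (x - c i) \<le> r i" by blast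
  qed
  then obtain w where w: "\<And>i. i \<in> I \<Longrightarrow> norm (w - c i) \<le> r i" by blast
  have "y \<preceq> w \<and> w \<preceq> v" if "y \<in> C" "v \<in> U" for y v
  proof -
    let ?r = "norm (v - y)"
    have "norm (w - (y + ?r *\<^sub>R e)) \<le> ?r" "norm (w - (v - ?r *\<^sub>R e)) \<le> ?r"
      using w[of "(y, v, True)"] w[of "(y, v, False)"] that by (auto simp: I_def c_def r_def)
    then have "norm (?r *\<^sub>R e - (w - y)) \<le> ?r" "norm (?r *\<^sub>R e - (v - w)) \<le> ?r"
      by (simp_all add: norm_minus_commute algebra_simps)
    then show ?thesis using jposI_norm' by (simp add: jle_def)
  qed
  moreover have "b0 \<in> U" using bdd by (simp add: U_def)
  ultimately show ?thesis using ne unfolding U_def by (intro exI[of _ w]) blast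
qed

section \<open>Projections\<close>

lemma jprojection_pos: "jprojection p \<Longrightarrow> (p::'a) \<in> jpos"
  unfolding jprojection_def using jpos_square[of p] by simp

lemma jprojection_compl: "jprojection (p::'a) \<Longrightarrow> jprojection (e - p)"
  unfolding jprojection_def by (simp add: jprod_distribs)

lemma jprojection_absorb:
  fixes p x :: 'a
  assumes p: "jprojection p" and x: "x \<in> jpos" "x \<preceq> c *\<^sub>R p"
  shows "x \<odot> p = x"
proof -
  have q: "e - p \<in> jpos" using p by (intro jprojection_pos jprojection_compl)
  have "quad_rep (e - p) p = 0"
    using p unfolding jprojection_def by (simp add: quad_rep_def jprod_distribs)
  then have "quad_rep (e - p) x \<preceq> 0"
    using quad_rep_mono[OF q x(2)] by (simp add: quad_rep_scaleR)
  then have "quad_rep (e - p) x = 0" by (intro jle_zero_eq quad_rep_pos q x)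
  then have "x \<odot> (e - p) = 0" by (intro jprod_zero_if_quad_rep_zero q x)
  then show ?thesis by (simp add: jprod_distribs)
qed

text \<open>By absorption q p = q, which makes p - q a projection. The factor \<open>c\<close> lets
  a comparison of positive multiples be traded for one of the projections themselves.\<close>

lemma jprojection_le:
  fixes p q :: 'a
  assumes p: "jprojection p" and q: "jprojection q" "q \<preceq> c *\<^sub>R p"
  shows "q \<preceq> p"
proof -
  have "q \<odot> p = q" using p q by (intro jprojection_absorb jprojection_pos)
  then have "(p - q) \<odot> (p - q) = p - q"
    using p q(1) unfolding jprojection_def by (simp add: jprod_distribs jprod_commute[of p q])
  then show ?thesis unfolding jle_def using jpos_square[of "p - q"] by simp
qed

end

text \<open>Of the duality only the suprema of bounded chains are kept, which frees all later
  statements from the type of the predual.\<close>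

locale jbw = unital_jb e for e :: "'a::jb_algebra" +
  assumes chain_sup: "C \<noteq> {} \<Longrightarrow> (\<And>x y. x \<in> C \<Longrightarrow> y \<in> C \<Longrightarrow> x \<preceq> y \<or> y \<preceq> x)
    \<Longrightarrow> (\<And>x. x \<in> C \<Longrightarrow> x \<preceq> b) \<Longrightarrow> \<exists>w. (\<forall>y\<in>C. y \<preceq> w) \<and> (\<forall>v. (\<forall>y\<in>C. y \<preceq> v) \<longrightarrow> w \<preceq> (v :: 'a))"
begin

text \<open>The projection is the supremum \<open>q\<close> of \<open>g\<^sub>n(x)\<close>, where \<open>g\<^sub>n\<close> increases to the indicator of
  \<open>s > \<parallel>x\<parallel> / 2\<close> and \<open>g\<^sub>n\<^sub>+\<^sub>1 = 1\<close> on the support of \<open>g\<^sub>n\<close>. The latter makes \<open>e - q\<close> orthogonal to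
  \<open>g\<^sub>n(x)\<close>, so that \<open>g\<^sub>n(x) = U\<^sub>q g\<^sub>n(x) \<preceq> q\<^sup>3\<close> and hence \<open>q \<preceq> q\<^sup>3\<close>; no weak*-continuity of
  the product is needed.\<close>

lemma spectral_projection:
  fixes x :: 'a
  assumes x: "x \<in> jpos" "x \<noteq> 0"
  obtains q c where "jprojection q" "q \<noteq> 0" "c > 0" "c *\<^sub>R q \<preceq> x"
proof -
  define r where "r = norm x"
  have r: "r > 0" using x by (simp add: r_def)
  have nn: "\<And>s. s \<in> jspectrum e x \<Longrightarrow> 0 \<le> s" using jspectrum_nonneg[OF x(1)] by blast
  obtain s0 where s0: "s0 \<in> jspectrum e x" "s0 > 3 * r / 4"
  proof (rule ccontr)
    assume "\<not> thesis"
    then have "\<forall>s\<in>jspectrum e x. \<bar>s\<bar> \<le> 3 * r / 4" using that nn by force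
    then have "norm (jfun_calc e (\<lambda>s. s) x) \<le> 3 * r / 4"
      using r by (subst norm_jfun_calc_le_iff) (auto intro!: continuous_intros)
    then show False using r by (simp add: jfun_calc_id r_def)
  qed
  define u where "u s = 8 / r * (s - r / 2)" for s
  define g where "g n s = max 0 (min 1 (2 ^ n * u s - 1))" for n :: nat and s
  have cg: "continuous_on S (g n)" for S n unfolding g_def u_def by (intro continuous_intros)
  have g01: "0 \<le> g n s" "g n s \<le> 1" for n s by (auto simp: g_def)
  have gS: "g (Suc n) s = 1" and us: "u s > 0" if "g n s > 0" for n s
  proof -
    have "2 ^ n * u s > 1" using that by (auto simp: g_def)
    then show "g (Suc n) s = 1" by (simp add: g_def)
    show "u s > 0" using \<open>2 ^ n * u s > 1\<close> by (smt (verit) mult_nonneg_nonpos zero_le_power)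
  qed
  have gm: "g n s \<le> g (Suc n) s" and gg: "g n s * g (Suc n) s = g n s" for n s
    using g01[of n s] g01[of "Suc n" s] gS[of n s] by (cases "g n s > 0"; force)+
  define y where "y n = jfun_calc e (g n) x" for n
  have yg: "y n \<in> jb_gen e x" for n unfolding y_def by (rule jfun_calc_in_gen[OF cg])
  have y0: "y n \<in> jpos" for n unfolding y_def by (rule jfun_calc_pos[OF cg]) (rule g01)
  have y1: "y n \<preceq> e" for n
    using jfun_calc_mono[OF cg continuous_on_const, of x n 1] g01 by (simp add: y_def jfun_calc_const)
  have ym: "y n \<preceq> y (Suc n)" for n unfolding y_def by (rule jfun_calc_mono[OF cg cg gm])
  have yy: "y n \<odot> y (Suc n) = y n" for n
    unfolding y_def jfun_calc_mult[of x "g n" "g (Suc n)", OF cg cg, symmetric] gg ..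
  have yx: "(r / 2) *\<^sub>R y n \<preceq> x" for n
  proof -
    have "(r / 2) *\<^sub>R y n = jfun_calc e (\<lambda>s. r / 2) x \<odot> jfun_calc e (g n) x"
      by (simp add: jfun_calc_const y_def jprod_distribs)
    also have "\<dots> = jfun_calc e (\<lambda>s. r / 2 * g n s) x"
      by (rule jfun_calc_mult[symmetric]) (intro continuous_intros cg)+
    also have "\<dots> \<preceq> jfun_calc e (\<lambda>s. s) x"
    proof (rule jfun_calc_mono)
      fix s assume s: "s \<in> jspectrum e x"
      show "r / 2 * g n s \<le> s"
      proof (cases "g n s > 0")
        case True
        then have "\<not> s - r / 2 \<le> 0"
            using us[OF True] r mult_nonneg_nonpos[of "8 / r" "s - r / 2"] by (auto simp: u_def)
        moreover have "r / 2 * g n s \<le> r / 2 * 1" using g01 r by (intro mult_left_mono) auto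
        ultimately show ?thesis by simp
      next
        case False
        then have "g n s = 0" using g01(1)[of n s] by simp
        then show ?thesis using nn[OF s] by simp
      qed
    qed (intro continuous_intros cg)+
    finally show ?thesis by (simp add: jfun_calc_id)
  qed
  have mono: "y m \<preceq> y n" if "m \<le> n" for m n
    using that by (induction n rule: dec_induct) (use ym jle_trans in auto)
  have "\<exists>q. (\<forall>z\<in>range y. z \<preceq> q) \<and> (\<forall>v. (\<forall>z\<in>range y. z \<preceq> v) \<longrightarrow> q \<preceq> v)"
  proof (rule chain_sup)
    fix z w assume "z \<in> range y" "w \<in> range y"
    then show "z \<preceq> w \<or> w \<preceq> z" using mono nat_le_linear by blast
  qed (use y1 in auto)
  then obtain q where q: "\<And>n. y n \<preceq> q" "\<And>v. (\<And>n. y n \<preceq> v) \<Longrightarrow> q \<preceq> v" by blast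
  have q0: "q \<in> jpos" using jle_trans[of 0 "y 0" q] y0 q(1) by (simp add: jle_zero_iff)
  have q1: "q \<preceq> e" by (rule q(2)[OF y1])
  then have b: "e - q \<in> jpos" by (simp add: jle_def)
  have qx: "(r / 2) *\<^sub>R q \<preceq> x"
  proof -
    have "q \<preceq> (2 / r) *\<^sub>R x"
      using jle_scaleR[OF yx, of "2 / r"] r by (intro q(2)) simp
    from jle_scaleR[OF this, of "r / 2"] r show ?thesis by simp
  qed
  have qy: "quad_rep q (y n) = y n" for n
  proof -
    have "quad_rep (y n) (e - y (Suc n)) = y n \<odot> (y n \<odot> (e - y (Suc n)))"
      by (subst quad_rep_gen[of _ x]) (auto intro!: yg jb_gen_intros jb_gen_assoc[of _ x])
    also have "\<dots> = 0" by (simp add: jprod_distribs yy)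
    finally have "quad_rep (y n) (e - y (Suc n)) = 0" .
    moreover have "quad_rep (y n) (e - q) \<preceq> quad_rep (y n) (e - y (Suc n))"
      using q(1)[of "Suc n"] by (intro quad_rep_mono y0) (simp add: jle_def)
    ultimately have z: "quad_rep (y n) (e - q) = 0"
      using quad_rep_pos[OF y0 b, of n] by (intro jle_zero_eq) auto
    then have 1: "(e - q) \<odot> y n = 0" by (rule jprod_zero_if_quad_rep_zero[OF b y0])
    have "((e - q) \<odot> (e - q)) \<odot> y n = 0"
      by (rule jprod_zero_if_quad_rep_zero[OF jpos_square y0 quad_rep_square_zero[OF b y0 z]])
    with 1 have "q \<odot> y n = y n" "(q \<odot> q) \<odot> y n = y n" by (simp_all add: jprod_distribs)
    then show ?thesis by (simp add: quad_rep_def scaleR_2)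
  qed
  have qg: "q \<in> jb_gen e q" "e - q \<in> jb_gen e q" by (intro jb_gen_intros)+
  have a: "q \<preceq> quad_rep q q"
    using quad_rep_mono[OF q0 q(1)] by (intro q(2)) (simp add: qy)
  have "(q \<odot> q) \<odot> (e - q) \<in> jpos" by (intro jpos_jprod[of _ q] jb_gen_jprod qg b jpos_square)
  then have "quad_rep q q \<preceq> q \<odot> q" unfolding quad_rep_gen[OF qg(1) qg(1)] by (simp add: jle_def jprod_distribs)
  with a have "q \<preceq> q \<odot> q" by (rule jle_trans)
  moreover have "q \<odot> (e - q) \<in> jpos" by (intro jpos_jprod[of _ q] qg b q0)
  then have "q \<odot> q \<preceq> q" by (simp add: jle_def jprod_distribs)
  ultimately have "jprojection q" unfolding jprojection_def using jle_antisym by blast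
  moreover have "q \<noteq> 0"
  proof
    assume "q = 0"
    then have "y 0 = 0" using q(1)[of 0] y0[of 0] by (intro jle_zero_eq) auto
    then have "norm (jfun_calc e (g 0) x) \<le> 0" by (simp add: y_def)
    then have "g 0 s0 = 0" using s0(1) by (subst (asm) norm_jfun_calc_le_iff[OF cg]) auto
    moreover have "u s0 > 2" using s0(2) r by (simp add: u_def field_simps)
    ultimately show False by (simp add: g_def)
  qed
  ultimately show ?thesis using qx r by (intro that[of q "r / 2"]) auto
qed

end

section \<open>Extreme rays and their finite sums\<close>

definition jray :: "'a::jb_algebra \<Rightarrow> bool" where
  "jray v \<longleftrightarrow> v \<in> jpos \<and> v \<noteq> 0 \<and>
    (\<forall>a b. a \<in> jpos \<longrightarrow> a \<preceq> v \<longrightarrow> b \<in> jpos \<longrightarrow> b \<preceq> v \<longrightarrow> a \<preceq> b \<or> b \<preceq> a)"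

definition parallel :: "'a::real_vector \<Rightarrow> 'a \<Rightarrow> bool" where
  "parallel v w \<longleftrightarrow> (\<exists>c. w = c *\<^sub>R v)"

inductive_set ray_sum :: "('a::jb_algebra \<Rightarrow> bool) \<Rightarrow> 'a set" for P where
  zero: "0 \<in> ray_sum P"
| add: "w \<in> ray_sum P \<Longrightarrow> jray v \<Longrightarrow> P v \<Longrightarrow> w + v \<in> ray_sum P"

lemma ray_sum_mono: "w \<in> ray_sum P \<Longrightarrow> (\<And>v. P v \<Longrightarrow> Q v) \<Longrightarrow> w \<in> ray_sum Q"
  by (induction rule: ray_sum.induct) (auto intro: ray_sum.intros)

lemma ray_sum_add: "w \<in> ray_sum P \<Longrightarrow> v \<in> ray_sum P \<Longrightarrow> v + w \<in> ray_sum P"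
  by (induction rule: ray_sum.induct) (auto intro: ray_sum.intros simp: add.assoc[symmetric])

lemma ray_sum_single: "jray v \<Longrightarrow> P v \<Longrightarrow> v \<in> ray_sum P"
  using ray_sum.add[OF ray_sum.zero] by auto

context unital_jb
begin

lemma ray_sum_pos: "w \<in> ray_sum P \<Longrightarrow> (w::'a) \<in> jpos"
  by (induction rule: ray_sum.induct) (auto simp: jray_def jpos_add)

lemma greatest_multiple_below:
  fixes v x :: 'a
  assumes v: "v \<in> jpos" "v \<noteq> 0" and x: "x \<in> jpos"
  obtains m where "0 \<le> m" "m *\<^sub>R v \<preceq> x" "\<And>k. m < k \<Longrightarrow> \<not> k *\<^sub>R v \<preceq> x"
proof -
  let ?S = "{k. k *\<^sub>R v \<preceq> x}"
  have 0: "0 \<in> ?S" using x by (simp add: jle_def)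
  then have ne: "?S \<noteq> {}" by blast
  have bdd: "bdd_above ?S"
  proof (rule bdd_aboveI)
    fix k assume "k \<in> ?S"
    then have k: "k *\<^sub>R v \<preceq> x" by simp
    show "k \<le> norm x / norm v"
    proof (cases "0 \<le> k")
      case True
      then have "norm (k *\<^sub>R v) \<le> norm x" using v k by (intro norm_mono jpos_scaleR)
      then show ?thesis using True v by (simp add: field_simps)
    next
      case False
      then show ?thesis by (smt (verit) divide_nonneg_nonneg norm_ge_zero)
    qed
  qed
  have "closed ((\<lambda>k. x - k *\<^sub>R v) -` jpos)"
    by (intro continuous_closed_vimage jpos_closed continuous_intros)
  then have "closed ?S" by (simp add: vimage_def jle_def)
  then have "Sup ?S \<in> ?S" by (rule closed_contains_Sup[OF ne bdd])
  moreover have "k \<le> Sup ?S" if "k *\<^sub>R v \<preceq> x" for k using that bdd by (intro cSup_upper) auto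
  ultimately show ?thesis using 0 that[of "Sup ?S"] by (metis (mono_tags) mem_Collect_eq not_less)
qed

lemma jray_quad_rep:
  assumes a: "jinvertible e a" and v: "jray v"
  shows "jray (quad_rep a v)"
  unfolding jray_def
proof (intro conjI allI impI)
  show "quad_rep a v \<in> jpos" using a v by (intro quad_rep_invertible_pos) (auto simp: jray_def)
  show "quad_rep a v \<noteq> 0" using quad_rep_inject[OF a, of v 0] v by (auto simp: jray_def)
  fix b c assume bc: "b \<in> jpos" "b \<preceq> quad_rep a v" "c \<in> jpos" "c \<preceq> quad_rep a v"
  let ?U = "quad_rep (jinv e a)"
  have i: "jinvertible e (jinv e a)" using a by (rule jinvertible_jinv)
  have "?U b \<in> jpos" "?U c \<in> jpos" using i bc by (auto intro: quad_rep_invertible_pos)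
  moreover have "?U b \<preceq> v" "?U c \<preceq> v"
    using quad_rep_invertible_mono[OF i bc(2)] quad_rep_invertible_mono[OF i bc(4)]
    by (simp_all add: quad_rep_jinv_left a)
  ultimately have "?U b \<preceq> ?U c \<or> ?U c \<preceq> ?U b" using v unfolding jray_def by blast
  then show "b \<preceq> c \<or> c \<preceq> b" by (simp add: quad_rep_le_iff i)
qed

lemma jray_scaleR:
  assumes "jray (v::'a)" "c > 0"
  shows "jray (c *\<^sub>R v)"
proof -
  have "jray (quad_rep (sqrt c *\<^sub>R e) v)"
    using assms by (intro jray_quad_rep spos_invertible spos_scaleR spos_unit) auto
  then show ?thesis using assms by (simp add: quad_rep_scaleR_left)
qed

lemma ray_sum_scaleR:
  assumes "(w::'a) \<in> ray_sum P" "c > 0" "\<And>v. P v \<Longrightarrow> P (c *\<^sub>R v)"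
  shows "c *\<^sub>R w \<in> ray_sum P"
  using assms(1)
  by induction (auto simp: scaleR_add_right intro!: ray_sum.intros jray_scaleR assms)

text \<open>The linearized Jordan identity with p in two places shows that the multiplications by p
  and c commute once c p is a multiple of p. Contrapositively, some multiplication moves a
  non-central atom off its line, as \<open>ray_in_span_of_others\<close> requires.\<close>

lemma jcentralI:
  fixes p :: 'a
  assumes p: "jprojection p" and "\<And>x. \<exists>c. x \<odot> p = c *\<^sub>R p"
  shows "jcentral p"
  unfolding jcentral_def operator_commute_def
proof (intro allI)
  fix c y :: 'a
  obtain k where k: "c \<odot> p = k *\<^sub>R p" using assms(2) by blast
  have pp: "p \<odot> p = p" using p by (simp add: jprojection_def)
  have "p \<odot> (y \<odot> (p \<odot> c)) + p \<odot> (y \<odot> (c \<odot> p)) + c \<odot> (y \<odot> (p \<odot> p))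
      = (p \<odot> y) \<odot> (p \<odot> c) + (p \<odot> y) \<odot> (c \<odot> p) + (c \<odot> y) \<odot> (p \<odot> p)"
    by (rule jordan_linearized)
  then have "c \<odot> (y \<odot> p) = (c \<odot> y) \<odot> p"
    using k by (simp add: pp jprod_commute[of p c] jprod_distribs jprod_commute[of y p] jprod_commute[of "p \<odot> y" p])
  then show "p \<odot> (c \<odot> y) = c \<odot> (p \<odot> y)" by (simp add: jprod_commute)
qed

text \<open>For \<open>s\<close> small, \<open>U\<^bsub>e + s x\<^esub> v\<close> is a ray that depends quadratically on \<open>s\<close>, so \<open>v\<close>, its value at
  \<open>s = 0\<close>, is a linear combination of its values at \<open>\<plusminus>h\<close>, \<open>\<plusminus>2h\<close>.\<close>

lemma ray_in_span_of_others:
  fixes v x :: 'a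
  assumes v: "jray v" and x: "\<And>c. x \<odot> v \<noteq> c *\<^sub>R v"
  obtains a b where "a \<in> ray_sum (\<lambda>w. \<not> parallel v w)" "b \<in> ray_sum (\<lambda>w. \<not> parallel v w)" "v + a = b"
proof -
  \<comment> \<open>Scaled so that e + s x' is strictly positive for |s| < 1.\<close>
  define x' where "x' = (1 / (norm x + 1)) *\<^sub>R x"
  have N: "norm x + 1 > 0" by (simp add: add_nonneg_pos)
  have x': "norm x' \<le> 1" using N by (simp add: x'_def)
  have x'v: "x' \<odot> v \<noteq> c *\<^sub>R v" for c
  proof
    assume "x' \<odot> v = c *\<^sub>R v"
    then have "x \<odot> v = ((norm x + 1) * c) *\<^sub>R v"
      using N jprod.scaleR_left[of "norm x + 1" x' v] by (simp add: x'_def)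
    with x show False by blast
  qed
  define u where "u s = quad_rep (e + s *\<^sub>R x') v" for s
  have u: "u s = v + s *\<^sub>R (2 *\<^sub>R (x' \<odot> v) + s *\<^sub>R quad_rep x' v)" for s
    by (rule linear_functional_eqI)
      (simp add: u_def quad_rep_def jprod_distribs linear_add linear_diff linear_cmul algebra_simps)
  have ray: "jray (u s)" if "\<bar>s\<bar> < 1" for s
  proof -
    have "norm (s *\<^sub>R x') \<le> \<bar>s\<bar>" using x' by (simp add: mult_left_le)
    have "spos ((1 - \<bar>s\<bar>) *\<^sub>R e)" using that by (intro spos_scaleR spos_unit) auto
    from spos_add[OF this unit_plus_pos[OF \<open>norm (s *\<^sub>R x') \<le> \<bar>s\<bar>\<close>]]
    have "spos ((1 - \<bar>s\<bar>) *\<^sub>R e + (\<bar>s\<bar> *\<^sub>R e + s *\<^sub>R x'))" .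
    then have "spos (e + s *\<^sub>R x')" by (simp add: algebra_simps)
    then show ?thesis unfolding u_def using v by (intro jray_quad_rep spos_invertible)
  qed
  \<comment> \<open>At most one nonzero parameter yields a ray parallel to v: from two of them the
    quadratic term could be eliminated, which would put x' v on the line of v.\<close>
  have bad: False if st: "s \<noteq> 0" "t \<noteq> 0" "s \<noteq> t" "parallel v (u s)" "parallel v (u t)" for s t
  proof -
    obtain c d where c: "u s = c *\<^sub>R v" and d: "u t = d *\<^sub>R v" using st(4,5) unfolding parallel_def by blast
    let ?A = "2 *\<^sub>R (x' \<odot> v)" and ?B = "quad_rep x' v"
    have 1: "?A + s *\<^sub>R ?B = ((c - 1) / s) *\<^sub>R v"
    proof -
      have "s *\<^sub>R (?A + s *\<^sub>R ?B) = u s - v" unfolding u by simp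
      then have "s *\<^sub>R (?A + s *\<^sub>R ?B) = (c - 1) *\<^sub>R v" unfolding c by (simp add: scaleR_diff_left)
      then have "(1 / s) *\<^sub>R (s *\<^sub>R (?A + s *\<^sub>R ?B)) = (1 / s) *\<^sub>R ((c - 1) *\<^sub>R v)" by simp
      then show ?thesis using that(1) by simp
    qed
    have 2: "?A + t *\<^sub>R ?B = ((d - 1) / t) *\<^sub>R v"
    proof -
      have "t *\<^sub>R (?A + t *\<^sub>R ?B) = u t - v" unfolding u by simp
      then have "t *\<^sub>R (?A + t *\<^sub>R ?B) = (d - 1) *\<^sub>R v" unfolding d by (simp add: scaleR_diff_left)
      then have "(1 / t) *\<^sub>R (t *\<^sub>R (?A + t *\<^sub>R ?B)) = (1 / t) *\<^sub>R ((d - 1) *\<^sub>R v)" by simp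
      then show ?thesis using that(2) by simp
    qed
    have "(2 * (t - s)) *\<^sub>R (x' \<odot> v) = t *\<^sub>R (?A + s *\<^sub>R ?B) - s *\<^sub>R (?A + t *\<^sub>R ?B)"
      by (simp add: algebra_simps)
    also have "\<dots> = (t * ((c - 1) / s) - s * ((d - 1) / t)) *\<^sub>R v" unfolding 1 2 by (simp add: scaleR_diff_left)
    finally have "(1 / (2 * (t - s))) *\<^sub>R ((2 * (t - s)) *\<^sub>R (x' \<odot> v))
       = (1 / (2 * (t - s)) * (t * ((c - 1) / s) - s * ((d - 1) / t))) *\<^sub>R v" by simp
    moreover have "1 / (2 * (t - s)) * (2 * (t - s)) = 1" using that(3) by simp
    ultimately have "x' \<odot> v = (1 / (2 * (t - s)) * (t * ((c - 1) / s) - s * ((d - 1) / t))) *\<^sub>R v"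
      by (metis scaleR_one scaleR_scaleR)
    with x'v show False by blast
  qed
  \<comment> \<open>The parameter sets \<plusminus>h, \<plusminus>2h for h = 1/4 and for h = 1/3 are
    disjoint, so one of them avoids the exceptional parameter.\<close>
  obtain h where h: "0 < h" "h < 1 / 2"
    and np: "\<not> parallel v (u h)" "\<not> parallel v (u (- h))" "\<not> parallel v (u (2 * h))" "\<not> parallel v (u (- (2 * h)))"
  proof (cases "parallel v (u (1/4)) \<or> parallel v (u (- (1/4))) \<or> parallel v (u (2 * (1/4))) \<or> parallel v (u (- (2 * (1/4))))")
    case False
    then show ?thesis by (intro that[of "1/4"]) auto
  next
    case True
    then obtain t where t: "parallel v (u t)" "t \<noteq> 0" "\<bar>t\<bar> = 1/4 \<or> \<bar>t\<bar> = 1/2" by auto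
    have "\<not> parallel v (u s)" if s: "\<bar>s\<bar> = 1/3 \<or> \<bar>s\<bar> = 2/3" for s
    proof -
      have "s \<noteq> 0" "s \<noteq> t" using s t(3) by (auto simp: abs_if split: if_splits)
      then show ?thesis using bad[of s t] t(1,2) by blast
    qed
    then show ?thesis by (intro that[of "1/3"]) auto
  qed
  let ?P = "\<lambda>w. \<not> parallel v w"
  have sc: "c *\<^sub>R w \<in> ray_sum ?P" if "w \<in> ray_sum ?P" "c > 0" for c w
  proof (rule ray_sum_scaleR[OF that])
    fix w assume w: "\<not> parallel v w"
    show "\<not> parallel v (c *\<^sub>R w)"
    proof
      assume "parallel v (c *\<^sub>R w)"
      then obtain k where "c *\<^sub>R w = k *\<^sub>R v" by (auto simp: parallel_def)
      then have "(1 / c) *\<^sub>R (c *\<^sub>R w) = (1 / c) *\<^sub>R (k *\<^sub>R v)" by simp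
      then have "w = (k / c) *\<^sub>R v" using that(2) by simp
      with w show False by (auto simp: parallel_def)
    qed
  qed
  have mem: "u (2 * h) + u (- (2 * h)) \<in> ray_sum ?P" "u h + u (- h) \<in> ray_sum ?P"
    by (intro ray_sum_add ray_sum_single np ray; use h in simp)+
  \<comment> \<open>The fourth difference of a quadratic polynomial vanishes; its coefficients 1,
    -4, 6, -4, 1 are distributed over both sides so that only sums of rays occur.\<close>
  have "6 *\<^sub>R v + (u (2 * h) + u (- (2 * h))) = 4 *\<^sub>R (u h + u (- h))"
    by (rule linear_functional_eqI) (simp add: u linear_add linear_diff linear_cmul linear_neg algebra_simps)
  then have "(1 / 6) *\<^sub>R (6 *\<^sub>R v + (u (2 * h) + u (- (2 * h)))) = (1 / 6) *\<^sub>R (4 *\<^sub>R (u h + u (- h)))" by simp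
  then have "v + (1 / 6) *\<^sub>R (u (2 * h) + u (- (2 * h))) = (4 / 6) *\<^sub>R (u h + u (- h))"
    by (simp only: scaleR_add_right scaleR_scaleR) simp
  then show ?thesis by (intro that[OF sc[OF mem(1)] sc[OF mem(2)]]) auto
qed

end

section \<open>Atoms and the extreme rays they span\<close>

locale atomic_jbw = jbw +
  assumes atomic: "jatomic TYPE('a)"
begin

lemma dominates_atom:
  fixes x :: 'a
  assumes "x \<in> jpos" "x \<noteq> 0"
  obtains p c where "jatom p" "c > 0" "c *\<^sub>R p \<preceq> x"
proof -
  obtain q c where q: "jprojection q" "q \<noteq> 0" "c > 0" "c *\<^sub>R q \<preceq> x" using spectral_projection[OF assms] by blast
  then obtain p where p: "jatom p" "p \<preceq> q" using atomic by (auto simp: jatomic_def)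
  have "c *\<^sub>R p \<preceq> c *\<^sub>R q" using p(2) q(3) by (intro jle_scaleR) auto
  then show ?thesis using p(1) q(3,4) jle_trans that by blast
qed

text \<open>If x minus the greatest multiple of p below it were nonzero, it would dominate a
  positive multiple of a projection. That projection lies below p, hence equals p, and the multiple
  was not the greatest.\<close>

lemma below_atom:
  fixes p x :: 'a
  assumes p: "jatom p" and x: "x \<in> jpos" "x \<preceq> c *\<^sub>R p"
  obtains m where "0 \<le> m" "x = m *\<^sub>R p"
proof -
  have pp: "jprojection p" "p \<noteq> 0" using p by (auto simp: jatom_def)
  obtain m where m: "0 \<le> m" "m *\<^sub>R p \<preceq> x" "\<And>k. m < k \<Longrightarrow> \<not> k *\<^sub>R p \<preceq> x"
    using greatest_multiple_below[OF jprojection_pos[OF pp(1)] pp(2) x(1)] by blast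
  have "x - m *\<^sub>R p = 0"
  proof (rule ccontr)
    assume "x - m *\<^sub>R p \<noteq> 0"
    moreover have "x - m *\<^sub>R p \<in> jpos" using m(2) by (simp add: jle_def)
    ultimately obtain q d where q: "jprojection q" "q \<noteq> 0" "d > 0" "d *\<^sub>R q \<preceq> x - m *\<^sub>R p"
      using spectral_projection by blast
    have "x - m *\<^sub>R p \<preceq> x" using m(1) pp by (simp add: jle_def jpos_scaleR jprojection_pos)
    then have "d *\<^sub>R q \<preceq> c *\<^sub>R p" using q(4) x(2) jle_trans by blast
    from jle_scaleR[OF this, of "1 / d"] q(3) have "q \<preceq> (c / d) *\<^sub>R p" by simp
    then have "q \<preceq> p" by (rule jprojection_le[OF pp(1) q(1)])
    then have "q = p" using p q by (simp add: jatom_def)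
    with q(4) have "(m + d) *\<^sub>R p \<preceq> x" by (simp add: jle_def algebra_simps)
    with m(3)[of "m + d"] q(3) show False by simp
  qed
  then show ?thesis using m(1) by (intro that[of m]) auto
qed

lemma jray_atom:
  assumes p: "jatom p" and "c > 0"
  shows "jray (c *\<^sub>R (p::'a))"
  unfolding jray_def
proof (intro conjI allI impI)
  have pp: "p \<in> jpos" "p \<noteq> 0" using p jprojection_pos by (auto simp: jatom_def)
  then show "c *\<^sub>R p \<in> jpos" "c *\<^sub>R p \<noteq> 0" using assms(2) by (auto intro: jpos_scaleR)
  fix a b assume a: "a \<in> jpos" "a \<preceq> c *\<^sub>R p" and b: "b \<in> jpos" "b \<preceq> c *\<^sub>R p"
  obtain m k where "a = m *\<^sub>R p" "b = k *\<^sub>R p" using below_atom[OF p a] below_atom[OF p b] by metis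
  then show "a \<preceq> b \<or> b \<preceq> a" using jle_scaleR_left[OF pp(1)] by (cases "m \<le> k") auto
qed

text \<open>For a ray v, the chain condition makes any two atoms with positive multiples below v
  comparable up to scalars, hence equal. So removing the greatest multiple of one atom leaves
  nothing.\<close>

lemma jray_iff_atom: "jray (v::'a) \<longleftrightarrow> (\<exists>p c. jatom p \<and> c > 0 \<and> v = c *\<^sub>R p)"
proof
  assume v: "jray v"
  then have v0: "v \<in> jpos" "v \<noteq> 0" by (auto simp: jray_def)
  then obtain p d where p: "jatom p" "d > 0" "d *\<^sub>R p \<preceq> v" using dominates_atom by blast
  have pp: "p \<in> jpos" "p \<noteq> 0" "jprojection p" using p jprojection_pos by (auto simp: jatom_def)
  obtain m where m: "0 \<le> m" "m *\<^sub>R p \<preceq> v" "\<And>k. m < k \<Longrightarrow> \<not> k *\<^sub>R p \<preceq> v"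
    using greatest_multiple_below[OF pp(1,2) v0(1)] by blast
  have "v - m *\<^sub>R p = 0"
  proof (rule ccontr)
    assume "v - m *\<^sub>R p \<noteq> 0"
    moreover have "v - m *\<^sub>R p \<in> jpos" using m(2) by (simp add: jle_def)
    ultimately obtain q c where q: "jatom q" "c > 0" "c *\<^sub>R q \<preceq> v - m *\<^sub>R p" using dominates_atom by blast
    have qp: "q \<in> jpos" "jprojection q" "q \<noteq> 0" using q jprojection_pos by (auto simp: jatom_def)
    have "v - m *\<^sub>R p \<preceq> v" using m(1) pp by (simp add: jle_def jpos_scaleR)
    then have "c *\<^sub>R q \<preceq> v" using q(3) jle_trans by blast
    then have "d *\<^sub>R p \<preceq> c *\<^sub>R q \<or> c *\<^sub>R q \<preceq> d *\<^sub>R p"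
      using v p q pp qp unfolding jray_def by (auto simp: jpos_scaleR)
    then have "p = q"
    proof
      assume "d *\<^sub>R p \<preceq> c *\<^sub>R q"
      from jle_scaleR[OF this, of "1 / d"] p(2) have "p \<preceq> (c / d) *\<^sub>R q" by simp
      then have "p \<preceq> q" by (rule jprojection_le[OF qp(2) pp(3)])
      then show "p = q" using q(1) pp by (simp add: jatom_def)
    next
      assume "c *\<^sub>R q \<preceq> d *\<^sub>R p"
      from jle_scaleR[OF this, of "1 / c"] q(2) have "q \<preceq> (d / c) *\<^sub>R p" by simp
      then have "q \<preceq> p" by (rule jprojection_le[OF pp(3) qp(2)])
      then show "p = q" using p(1) qp unfolding jatom_def by blast
    qed
    with q(3) have "(m + c) *\<^sub>R p \<preceq> v" by (simp add: jle_def algebra_simps)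
    with m(3)[of "m + c"] q(2) show False by simp
  qed
  then have "v = m *\<^sub>R p" by simp
  moreover have "m > 0" using m(1) v0(2) calculation by (cases "m = 0") auto
  ultimately show "\<exists>p c. jatom p \<and> c > 0 \<and> v = c *\<^sub>R p" using p(1) by blast
qed (auto intro: jray_atom)

lemma dominates_ray:
  fixes x :: 'a
  assumes "x \<in> jpos" "x \<noteq> 0"
  obtains v where "jray v" "v \<preceq> x"
  using dominates_atom[OF assms] jray_atom by metis

text \<open>The summand \<open>w\<close> in the definition of \<open>G\<close> makes \<open>G\<close> stable under adding a ray below \<open>x - y\<close>,
  so that a maximal element of \<open>G\<close> must be \<open>x\<close>.\<close>

lemma supremum_of_ray_sums:
  fixes x z :: 'a
  assumes x: "x \<in> jpos" and z: "\<And>w. w \<in> ray_sum (\<lambda>_. True) \<Longrightarrow> w \<preceq> x \<Longrightarrow> w \<preceq> z"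
  shows "x \<preceq> z"
proof -
  let ?F = "ray_sum (\<lambda>_::'a. True)"
  define G where "G = {y \<in> jpos. y \<preceq> x \<and> (\<forall>w\<in>?F. y + w \<preceq> x \<longrightarrow> y + w \<preceq> z)}"
  have 0: "0 \<in> G" using x z by (simp add: G_def jle_zero_iff)
  have "\<exists>m\<in>G. \<forall>a\<in>G. m \<preceq> a \<longrightarrow> a = m"
  proof (rule predicate_Zorn)
    show "partial_order_on G (relation_of (\<preceq>) G)"
      by (rule partial_order_on_relation_ofI) (auto intro: jle_trans jle_antisym)
    fix C assume C: "C \<in> Chains (relation_of (\<preceq>) G)"
    then have CG: "C \<subseteq> G" by (rule Chains_relation_of)
    show "\<exists>u\<in>G. \<forall>a\<in>C. a \<preceq> u"
    proof (cases "C = {}")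
      case True
      then show ?thesis using 0 by blast
    next
      case False
      have "\<exists>w. (\<forall>y\<in>C. y \<preceq> w) \<and> (\<forall>v. (\<forall>y\<in>C. y \<preceq> v) \<longrightarrow> w \<preceq> v)"
      proof (rule chain_sup[OF False])
        show "a \<preceq> b \<or> b \<preceq> a" if "a \<in> C" "b \<in> C" for a b
          using C that unfolding Chains_def relation_of_def by auto
        show "a \<preceq> x" if "a \<in> C" for a using that CG by (auto simp: G_def)
      qed
      then obtain u where u: "\<And>y. y \<in> C \<Longrightarrow> y \<preceq> u" "\<And>v. (\<And>y. y \<in> C \<Longrightarrow> y \<preceq> v) \<Longrightarrow> u \<preceq> v" by blast
      have "u \<in> G" unfolding G_def
      proof (intro CollectI conjI ballI impI)
        obtain y where "y \<in> C" using False by blast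
        then show "u \<in> jpos" using u(1)[of y] CG jle_trans[of 0 y u] by (auto simp: G_def jle_zero_iff)
        show "u \<preceq> x" using CG by (intro u(2)) (auto simp: G_def)
        fix w assume w: "w \<in> ?F" "u + w \<preceq> x"
        have "u \<preceq> z - w"
        proof (rule u(2))
          fix y assume y: "y \<in> C"
          then have "y + w \<preceq> u + w" using u(1) by simp
          then have "y + w \<preceq> x" using w(2) jle_trans by blast
          then have "y + w \<preceq> z" using y CG w(1) by (auto simp: G_def)
          then show "y \<preceq> z - w" by (simp add: jle_def algebra_simps)
        qed
        then show "u + w \<preceq> z" by (simp add: jle_def algebra_simps)
      qed
      then show ?thesis using u(1) by blast
    qed
  qed
  then obtain m where m: "m \<in> G" "\<And>a. a \<in> G \<Longrightarrow> m \<preceq> a \<Longrightarrow> a = m" by blast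
  have "x - m = 0"
  proof (rule ccontr)
    assume "x - m \<noteq> 0"
    moreover have "x - m \<in> jpos" using m(1) by (simp add: G_def jle_def)
    ultimately obtain v where v: "jray v" "v \<preceq> x - m" using dominates_ray by blast
    have v0: "v \<in> jpos" "v \<noteq> 0" using v(1) by (auto simp: jray_def)
    have "m + v \<in> G" unfolding G_def
    proof (intro CollectI conjI ballI impI)
      show "m + v \<in> jpos" using m(1) v0 by (auto simp: G_def intro: jpos_add)
      show "m + v \<preceq> x" using v(2) by (simp add: jle_def algebra_simps)
      fix w assume w: "w \<in> ?F" "m + v + w \<preceq> x"
      have "v + w \<in> ?F" by (rule ray_sum_add[OF w(1) ray_sum_single[OF v(1) TrueI]])
      then have "m + (v + w) \<preceq> z" using m(1) w(2) by (auto simp: G_def add.assoc)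
      then show "m + v + w \<preceq> z" by (simp add: add.assoc)
    qed
    moreover have "m \<preceq> m + v" using v0 by (simp add: jle_def)
    ultimately have "m + v = m" by (rule m(2))
    then show False using v0 by simp
  qed
  then have "m = x" by simp
  with m(1) show ?thesis using ray_sum.zero by (force simp: G_def)
qed

lemma ray_engaged:
  assumes nc: "\<not> (\<exists>p::'a. jatom p \<and> jcentral p)" and v: "jray (v::'a)"
  obtains a b where "a \<in> ray_sum (\<lambda>w. \<not> parallel v w)" "b \<in> ray_sum (\<lambda>w. \<not> parallel v w)" "v + a = b"
proof -
  obtain p c where p: "jatom p" "c > 0" "v = c *\<^sub>R p" using v jray_iff_atom by blast
  then have "\<not> jcentral p" using nc by blast
  then obtain x where x: "\<And>k. x \<odot> p \<noteq> k *\<^sub>R p" using jcentralI[of p] p(1) by (auto simp: jatom_def)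
  have "x \<odot> v \<noteq> k *\<^sub>R v" for k
  proof
    assume "x \<odot> v = k *\<^sub>R v"
    then have "c *\<^sub>R (x \<odot> p) = c *\<^sub>R (k *\<^sub>R p)" by (simp add: p(3) jprod.scaleR_right mult.commute)
    then have "c = 0 \<or> x \<odot> p = k *\<^sub>R p" by (rule iffD1[OF scaleR_cancel_left, THEN disj_commute[THEN iffD1]])
    then show False using x[of k] p(2) by simp
  qed
  then show ?thesis using ray_in_span_of_others[OF v] that by blast
qed

end

section \<open>Order isomorphisms of cones\<close>

lemma jorder_iso_on_inv:
  assumes f: "jorder_iso_on A B f"
  shows "jorder_iso_on B A (inv_into A f)"
proof -
  have b: "bij_betw f A B" and le: "\<And>x y. x \<in> A \<Longrightarrow> y \<in> A \<Longrightarrow> x \<preceq> y \<longleftrightarrow> f x \<preceq> f y"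
    using f by (auto simp: jorder_iso_on_def)
  have inv: "inv_into A f y \<in> A" "f (inv_into A f y) = y" if "y \<in> B" for y
    using that b by (auto simp: bij_betw_def inv_into_into f_inv_into_f)
  show ?thesis
    unfolding jorder_iso_on_def
    using bij_betw_inv_into[OF b] le inv by auto
qed

lemma jorder_iso_on_comp:
  assumes "jorder_iso_on A B f" "jorder_iso_on B C g"
  shows "jorder_iso_on A C (\<lambda>x. g (f x))"
proof -
  have "\<And>x. x \<in> A \<Longrightarrow> f x \<in> B" using assms(1) by (auto simp: jorder_iso_on_def bij_betw_def)
  then show ?thesis
    using assms bij_betw_trans[of f A B g C] by (auto simp: jorder_iso_on_def comp_def)
qed

definition linear_order_iso :: "('a::jb_algebra \<Rightarrow> 'b::jb_algebra) \<Rightarrow> bool" where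
  "linear_order_iso T \<longleftrightarrow> linear T \<and> bij T \<and> (\<forall>x. T x \<in> jpos \<longleftrightarrow> x \<in> jpos)"

context unital_jb
begin

lemma scaleR_bounded_zero:
  assumes "\<And>n::nat. norm (real n *\<^sub>R (a::'a)) \<le> C"
  shows "a = 0"
proof (rule ccontr)
  assume "a \<noteq> 0"
  then obtain n where "C < real n * norm a" using reals_Archimedean3[of "norm a"] by auto
  with assms[of n] show False by simp
qed

end

context atomic_jbw
begin

lemma jray_multiple_of_smaller:
  assumes v: "jray (v::'a)" and a: "a \<in> jpos" "a \<noteq> 0" "a \<preceq> v"
  obtains c where "c > 0" "v = c *\<^sub>R a"
proof -
  obtain p d where p: "jatom p" "d > 0" "v = d *\<^sub>R p" using v jray_iff_atom by blast
  obtain m where m: "0 \<le> m" "a = m *\<^sub>R p" using below_atom[OF p(1) a(1)] a(3) p(3) by metis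
  with a(2) have "m > 0" by (cases "m = 0") auto
  then show ?thesis using m p by (intro that[of "d / m"]) auto
qed

lemma jray_parallel_if_annihilated:
  assumes p: "jatom (p::'a)" and v: "jray v" and 0: "quad_rep (e - p) v = 0"
  obtains c where "c > 0" "v = c *\<^sub>R p"
proof -
  obtain q d where q: "jatom q" "d > 0" "v = d *\<^sub>R q" using v jray_iff_atom by blast
  have pp: "jprojection p" "p \<noteq> 0" and qp: "jprojection q" "q \<noteq> 0" using p q by (auto simp: jatom_def)
  have "quad_rep (e - p) q = 0" using 0 q(2) by (simp add: q(3) quad_rep_scaleR)
  then have "q \<odot> (e - p) = 0"
    by (intro jprod_zero_if_quad_rep_zero jprojection_pos jprojection_compl pp qp)
  then have qpq: "q \<odot> p = q" by (simp add: jprod_distribs)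
  then have "(p - q) \<odot> (p - q) = p - q"
    using pp(1) qp(1) unfolding jprojection_def by (simp add: jprod_distribs jprod_commute[of p q])
  then have "q \<preceq> p" unfolding jle_def using jpos_square[of "p - q"] by simp
  then have "q = p" using p qp by (simp add: jatom_def)
  then show ?thesis using q that by blast
qed

end

section \<open>Order isomorphisms along extreme rays\<close>

locale jbw_pair = M: atomic_jbw eM + N: atomic_jbw eN
  for eM :: "'a::jb_algebra" and eN :: "'b::jb_algebra"

locale cone_iso = jbw_pair eM eN for eM :: "'a::jb_algebra" and eN :: "'b::jb_algebra" +
  fixes f :: "'a \<Rightarrow> 'b"
  assumes iso: "jorder_iso_on jpos jpos f"
begin

abbreviation (input) "g \<equiv> inv_into jpos f"

lemma f_pos: "x \<in> jpos \<Longrightarrow> f x \<in> jpos"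
  using iso by (auto simp: jorder_iso_on_def bij_betw_def)

lemma f_le: "x \<in> jpos \<Longrightarrow> y \<in> jpos \<Longrightarrow> f x \<preceq> f y \<longleftrightarrow> x \<preceq> y"
  using iso by (auto simp: jorder_iso_on_def)

lemma f_inj: "x \<in> jpos \<Longrightarrow> y \<in> jpos \<Longrightarrow> f x = f y \<longleftrightarrow> x = y"
  using iso by (auto simp: jorder_iso_on_def bij_betw_def inj_on_def)

lemma g_pos: "y \<in> jpos \<Longrightarrow> g y \<in> jpos"
  and f_g: "y \<in> jpos \<Longrightarrow> f (g y) = y"
  using iso by (auto simp: jorder_iso_on_def bij_betw_def inv_into_into f_inv_into_f)

lemma g_f: "x \<in> jpos \<Longrightarrow> g (f x) = x"
  using iso by (auto simp: jorder_iso_on_def bij_betw_def)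

lemma cone_iso_inv: "cone_iso eN eM g"
  by (intro cone_iso.intro jbw_pair.intro cone_iso_axioms.intro jorder_iso_on_inv iso
      M.atomic_jbw_axioms N.atomic_jbw_axioms)

lemma f_zero: "f 0 = 0"
proof -
  have "f 0 \<preceq> f (g 0)" using g_pos[of 0] by (subst f_le) (auto simp: jle_def)
  then show ?thesis using f_pos[of 0] by (intro N.jle_zero_eq) (auto simp: f_g)
qed

lemma pos_increment: "x \<in> jpos \<Longrightarrow> v \<in> jpos \<Longrightarrow> f (x + v) - f x \<in> jpos"
  using f_le[of x "x + v"] by (simp add: M.jpos_add jle_def)

text \<open>The interval [f x, f (x + v)] is the image of [x, x + v], a translate of the chain
  [0, v]; \<open>aux\<close> pulls elements back along this correspondence.\<close>

lemma ray_increment: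
  assumes x: "x \<in> jpos" and v: "jray v"
  shows "jray (f (x + v) - f x)"
  unfolding jray_def
proof (intro conjI allI impI)
  have v0: "v \<in> jpos" "v \<noteq> 0" using v by (auto simp: jray_def)
  have xv: "x + v \<in> jpos" using x v0 by (intro M.jpos_add)
  show "f (x + v) - f x \<in> jpos" using x v0 by (intro pos_increment)
  show "f (x + v) - f x \<noteq> 0" using f_inj[OF xv x] v0 by simp
  fix a b assume a: "a \<in> jpos" "a \<preceq> f (x + v) - f x" and b: "b \<in> jpos" "b \<preceq> f (x + v) - f x"
  have aux: "\<exists>a'. a' \<in> jpos \<and> a' \<preceq> v \<and> c = f (x + a') - f x"
    if c: "c \<in> jpos" "c \<preceq> f (x + v) - f x" for c
  proof -
    have pos: "f x + c \<in> jpos" using c x by (intro N.jpos_add f_pos)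
    let ?y = "g (f x + c)"
    have fy: "f ?y = f x + c" by (rule f_g[OF pos])
    have "f x \<preceq> f ?y" unfolding fy using c by (simp add: jle_def)
    then have 1: "x \<preceq> ?y" using x g_pos[OF pos] by (simp add: f_le)
    have "f ?y \<preceq> f (x + v)" unfolding fy using c(2) by (simp add: jle_def algebra_simps)
    then have 2: "?y \<preceq> x + v" using xv g_pos[OF pos] by (simp add: f_le)
    have eq: "v - (?y - x) = x + v - ?y" by simp
    show ?thesis using 1 2 by (intro exI[of _ "?y - x"]) (unfold jle_def eq, simp add: fy)
  qed
  obtain a' b' where a': "a' \<in> jpos" "a' \<preceq> v" "a = f (x + a') - f x"
    and b': "b' \<in> jpos" "b' \<preceq> v" "b = f (x + b') - f x" using aux[OF a] aux[OF b] by blast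
  have "a' \<preceq> b' \<or> b' \<preceq> a'" using v a' b' unfolding jray_def by blast
  then have "f (x + a') \<preceq> f (x + b') \<or> f (x + b') \<preceq> f (x + a')"
    using x a' b' by (simp add: f_le M.jpos_add)
  then show "a \<preceq> b \<or> b \<preceq> a" unfolding a' b' by (simp add: jle_def)
qed

lemma f_ray: "jray v \<Longrightarrow> jray (f v)"
  using ray_increment[of 0 v] by (simp add: f_zero)

lemma g_ray: "jray v \<Longrightarrow> jray (g v)"
  using cone_iso.f_ray[OF cone_iso_inv] .

text \<open>The half-line \<open>f (x + \<real>\<^sub>+ v)\<close> dominates \<open>f (\<real>\<^sub>+ v)\<close>, and the face of the ray \<open>u\<close> is exposed by
  the positive map \<open>U\<^bsub>e - p\<^esub>\<close>, which vanishes at \<open>u\<close> and stays bounded along the half-line.\<close>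

lemma ray_direction:
  assumes x: "x \<in> jpos" and v: "jray v"
  obtains c where "c > 0" "f (x + v) - f x = c *\<^sub>R f v"
proof -
  define u where "u = f (x + v) - f x"
  have u: "jray u" unfolding u_def using x v by (rule ray_increment)
  then obtain p d where p: "jatom p" "d > 0" "u = d *\<^sub>R p" using N.jray_iff_atom by blast
  have pp: "jprojection p" using p by (simp add: jatom_def)
  have ep: "eN - p \<in> jpos" using pp by (intro N.jprojection_pos N.jprojection_compl)
  have v0: "v \<in> jpos" "v \<noteq> 0" using v by (auto simp: jray_def)
  let ?U = "quad_rep (eN - p)"
  have "?U p = 0" using pp unfolding jprojection_def by (simp add: quad_rep_def jprod_distribs)
  have "real n *\<^sub>R ?U (f v) \<preceq> ?U (f x)" if n: "n > 0" for n :: nat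
  proof -
    have fv: "jray (real n *\<^sub>R f v)" using n f_ray[OF v] by (intro N.jray_scaleR) auto
    then have fv0: "real n *\<^sub>R f v \<in> jpos" by (simp add: jray_def)
    define y where "y = g (real n *\<^sub>R f v)"
    have y: "jray y" unfolding y_def by (rule g_ray[OF fv])
    have y0: "y \<in> jpos" using y by (simp add: jray_def)
    have fy: "f y = real n *\<^sub>R f v" by (simp add: y_def f_g fv0)
    have "1 *\<^sub>R f v \<preceq> real n *\<^sub>R f v" using n f_pos[OF v0(1)] by (intro N.jle_scaleR_left) auto
    then have vy: "v \<preceq> y" using fy f_le[OF v0(1) y0] by simp
    then have "f (x + v) \<preceq> f (x + y)" using x v0 y0 by (simp add: f_le M.jpos_add)
    \<comment> \<open>The increment in the larger direction \<open>y\<close> is a ray above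
      \<open>u\<close>, hence a multiple of \<open>u\<close>, and \<open>?U\<close> annihilates it.
      This keeps the bound \<open>?U (f x)\<close> independent of n.\<close>
    then have le: "u \<preceq> f (x + y) - f x" by (simp add: u_def jle_def)
    have u0: "u \<in> jpos" "u \<noteq> 0" using u by (auto simp: jray_def)
    obtain c where c: "f (x + y) - f x = c *\<^sub>R u"
      by (rule N.jray_multiple_of_smaller[OF ray_increment[OF x y] u0 le])
    have "y \<preceq> x + y" using x by (simp add: jle_def)
    then have "f y \<preceq> f (x + y)" using x y0 by (simp add: f_le M.jpos_add)
    then have "?U (f y) \<preceq> ?U (f (x + y))" by (rule N.quad_rep_mono[OF ep])
    also have "f (x + y) = f x + c *\<^sub>R u" using c by (simp add: algebra_simps)
    also have "?U (f x + c *\<^sub>R u) = ?U (f x)"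
      by (simp add: quad_rep_add quad_rep_scaleR p(3) \<open>?U p = 0\<close>)
    finally show ?thesis by (simp add: fy quad_rep_scaleR)
  qed
  then have "norm (real n *\<^sub>R ?U (f v)) \<le> norm (?U (f x))" for n :: nat
    using f_pos[OF v0(1)] ep
    by (cases "n = 0") (auto simp del: norm_scaleR intro!: N.norm_mono N.jpos_scaleR N.quad_rep_pos)
  then have "?U (f v) = 0" by (rule N.scaleR_bounded_zero)
  then obtain c where c: "c > 0" "f v = c *\<^sub>R p" by (rule N.jray_parallel_if_annihilated[OF p(1) f_ray[OF v]])
  show ?thesis using that[of "d / c"] c p by (simp add: u_def)
qed

text \<open>A scalar relation would make f v and f w comparable, hence also v and w, and comparable
  rays are parallel.\<close>

lemma f_not_parallel:
  assumes v: "jray v" and w: "jray w" and np: "\<not> parallel v w"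
  shows "k *\<^sub>R f v \<noteq> f w"
proof
  assume eq: "k *\<^sub>R f v = f w"
  have v0: "v \<in> jpos" "v \<noteq> 0" and w0: "w \<in> jpos" "w \<noteq> 0" using v w by (auto simp: jray_def)
  have fv: "f v \<in> jpos" and fw: "f w \<noteq> 0" using f_ray[OF v] f_ray[OF w] by (auto simp: jray_def)
  have "f v \<preceq> f w \<or> f w \<preceq> f v"
    using N.jle_scaleR_left[OF fv, of 1 k] N.jle_scaleR_left[OF fv, of k 1] eq by (cases "1 \<le> k") auto
  then have "v \<preceq> w \<or> w \<preceq> v" using v0 w0 by (simp add: f_le)
  then show False
  proof
    assume "v \<preceq> w"
    then show False using M.jray_multiple_of_smaller[OF w v0] np by (auto simp: parallel_def)
  next
    assume "w \<preceq> v"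
    then obtain c where "c > 0" "v = c *\<^sub>R w" using M.jray_multiple_of_smaller[OF v w0] by blast
    then have "w = (1 / c) *\<^sub>R v" by simp
    with np show False by (auto simp: parallel_def)
  qed
qed

text \<open>The two ways around the parallelogram end at the same point, and their coefficients
  agree because f v and f w are linearly independent by \<open>f_not_parallel\<close>.\<close>

lemma parallelogram:
  assumes x: "x \<in> jpos" and v: "jray v" and w: "jray w" and np: "\<not> parallel v w"
  shows "f (x + w + v) - f (x + w) = f (x + v) - f x"
proof -
  have v0: "v \<in> jpos" and w0: "w \<in> jpos" using v w by (auto simp: jray_def)
  obtain a where a: "f (x + v) - f x = a *\<^sub>R f v" using ray_direction[OF x v] by blast
  obtain b where b: "f (x + w) - f x = b *\<^sub>R f w" using ray_direction[OF x w] by blast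
  obtain a' where a': "f (x + w + v) - f (x + w) = a' *\<^sub>R f v"
    using ray_direction[OF M.jpos_add[OF x w0] v] by blast
  obtain b' where b': "f (x + v + w) - f (x + v) = b' *\<^sub>R f w"
    using ray_direction[OF M.jpos_add[OF x v0] w] by blast
  have "(a' *\<^sub>R f v) + (b *\<^sub>R f w) = (b' *\<^sub>R f w) + (a *\<^sub>R f v)"
    unfolding a[symmetric] b[symmetric] a'[symmetric] b'[symmetric] by (simp add: add.commute add.left_commute)
  then have eq: "(a' - a) *\<^sub>R f v = (b' - b) *\<^sub>R f w" by (simp add: algebra_simps)
  have "a' = a"
  proof (rule ccontr)
    assume ne: "a' \<noteq> a"
    have "f v \<noteq> 0" using f_ray[OF v] by (simp add: jray_def)
    with eq ne have "b' - b \<noteq> 0" by auto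
    then have "((a' - a) / (b' - b)) *\<^sub>R f v = f w"
      using arg_cong[OF eq, of "\<lambda>z. (1 / (b' - b)) *\<^sub>R z"] by simp
    with f_not_parallel[OF v w np] show False by blast
  qed
  then show ?thesis using a a' by simp
qed

lemma parallelogram_sum:
  assumes "w \<in> ray_sum (\<lambda>w. \<not> parallel v w)" and x: "x \<in> jpos" and v: "jray v"
  shows "f (x + w + v) - f (x + w) = f (x + v) - f x"
  using assms(1)
proof induction
  case (add w r)
  have "f (x + w + r + v) - f (x + w + r) = f (x + w + v) - f (x + w)"
    using add x v M.ray_sum_pos by (intro parallelogram M.jpos_add)
  with add.IH show ?case by (simp add: add.assoc)
qed simp

text \<open>If w is parallel to v, write w + a = b with a and b sums of rays not parallel to v.
  Adding a after w, and then removing b = w + a, leaves the increment in direction v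
  unchanged.\<close>

lemma ray_increment_constant:
  assumes nc: "\<not> (\<exists>p::'a. jatom p \<and> jcentral p)"
    and x: "x \<in> jpos" and v: "jray v" and w: "jray w"
  shows "f (x + w + v) - f (x + w) = f (x + v) - f x"
proof (cases "parallel v w")
  case True
  then obtain c where c: "w = c *\<^sub>R v" by (auto simp: parallel_def)
  obtain a b where ab: "a \<in> ray_sum (\<lambda>z. \<not> parallel w z)" "b \<in> ray_sum (\<lambda>z. \<not> parallel w z)" "w + a = b"
    using M.ray_engaged[OF nc w] by blast
  have w0: "w \<in> jpos" "w \<noteq> 0" using w by (auto simp: jray_def)
  have wz: "parallel w z" if "parallel v z" for z
  proof -
    obtain k where "z = k *\<^sub>R v" using \<open>parallel v z\<close> by (auto simp: parallel_def)
    moreover have "c \<noteq> 0" using w0 c by auto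
    ultimately have "z = (k / c) *\<^sub>R w" by (simp add: c)
    then show ?thesis by (auto simp: parallel_def)
  qed
  have a: "a \<in> ray_sum (\<lambda>z. \<not> parallel v z)" by (rule ray_sum_mono[OF ab(1)]) (use wz in blast)
  have b: "b \<in> ray_sum (\<lambda>z. \<not> parallel v z)" by (rule ray_sum_mono[OF ab(2)]) (use wz in blast)
  have "f (x + w + v) - f (x + w) = f (x + w + a + v) - f (x + w + a)"
    using x w0 v by (intro parallelogram_sum[OF a, symmetric] M.jpos_add)
  also have "\<dots> = f (x + b + v) - f (x + b)" by (simp add: ab(3)[symmetric] add.assoc)
  also have "\<dots> = f (x + v) - f x" by (rule parallelogram_sum[OF b x v])
  finally show ?thesis .
qed (rule parallelogram[OF x v w])

section \<open>From additivity on rays to linearity\<close>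

lemma additive_on_ray_sums:
  assumes nc: "\<not> (\<exists>p::'a. jatom p \<and> jcentral p)"
    and v: "v \<in> ray_sum (\<lambda>_. True)" and w: "w \<in> ray_sum (\<lambda>_. True)"
  shows "f (v + w) = f v + f w"
proof -
  have 1: "f (w + r) = f w + f r" if "w \<in> ray_sum (\<lambda>_. True)" "jray r" for w r
  proof -
    have "f (w + r) - f w = f r"
      using that(1)
    proof induction
      case (add w s)
      have "f (w + s + r) - f (w + s) = f (w + r) - f w"
        using add that M.ray_sum_pos by (intro ray_increment_constant nc)
      with add.IH show ?case by simp
    qed (simp add: f_zero)
    then show ?thesis by (simp add: algebra_simps)
  qed
  show ?thesis
    using w
  proof induction
    case (add w r)
    have "f (v + w + r) = f (v + w) + f r" using add v by (intro 1 ray_sum_add)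
    also have "\<dots> = f v + f (w + r)" using add 1[of w r] by (simp add: add.assoc)
    finally show ?case by (simp add: add.assoc)
  qed (simp add: f_zero)
qed

text \<open>f x is the least upper bound of the f w for ray sums w below x, so additivity on ray
  sums passes on, one variable at a time. It is a premise because the lemma also serves the inverse
  map, where central atoms are only excluded in the codomain.\<close>

lemma superadditive:
  assumes add: "\<And>v w. v \<in> ray_sum (\<lambda>_. True) \<Longrightarrow> w \<in> ray_sum (\<lambda>_. True) \<Longrightarrow> f (v + w) = f v + f w"
    and x: "x \<in> jpos" and y: "y \<in> jpos"
  shows "f x + f y \<preceq> f (x + y)"
proof -
  have sup: "f x \<preceq> u"
    if x: "x \<in> jpos" and u: "u \<in> jpos" "\<And>w. w \<in> ray_sum (\<lambda>_. True) \<Longrightarrow> w \<preceq> x \<Longrightarrow> f w \<preceq> u" for x u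
  proof -
    have "w \<preceq> g u" if w: "w \<in> ray_sum (\<lambda>_. True)" "w \<preceq> x" for w
      using u(2)[OF w] f_le[OF M.ray_sum_pos[OF w(1)] g_pos[OF u(1)]] by (simp add: f_g u(1))
    then have "x \<preceq> g u" by (rule M.supremum_of_ray_sums[OF x])
    then show ?thesis using f_le[OF x g_pos[OF u(1)]] by (simp add: f_g u(1))
  qed
  have 1: "f x + f y \<preceq> f (x + y)" if x: "x \<in> jpos" and y: "y \<in> ray_sum (\<lambda>_. True)" for x y
  proof -
    have y0: "y \<in> jpos" using y by (rule M.ray_sum_pos)
    have "f x \<preceq> f (x + y) - f y"
    proof (rule sup[OF x])
      show "f (x + y) - f y \<in> jpos" using pos_increment[OF y0 x] by (simp add: add.commute)
      fix w assume w: "w \<in> ray_sum (\<lambda>_. True)" "w \<preceq> x"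
      have "f (w + y) \<preceq> f (x + y)" using w x y0 M.ray_sum_pos[OF w(1)] by (subst f_le) (auto intro: M.jpos_add)
      then show "f w \<preceq> f (x + y) - f y" using add[OF w(1) y] by (simp add: jle_def algebra_simps)
    qed
    then show ?thesis by (simp add: jle_def algebra_simps)
  qed
  have "f y \<preceq> f (x + y) - f x"
  proof (rule sup[OF y])
    show "f (x + y) - f x \<in> jpos" using x y by (rule pos_increment)
    fix w assume w: "w \<in> ray_sum (\<lambda>_. True)" "w \<preceq> y"
    have "f (x + w) \<preceq> f (x + y)" using w x y M.ray_sum_pos[OF w(1)] by (subst f_le) (auto intro: M.jpos_add)
    with 1[OF x w(1)] have "f x + f w \<preceq> f (x + y)" by (rule N.jle_trans)
    then show "f w \<preceq> f (x + y) - f x" by (simp add: jle_def algebra_simps)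
  qed
  then show ?thesis by (simp add: jle_def algebra_simps)
qed

lemma additive:
  assumes nc: "\<not> (\<exists>p::'a. jatom p \<and> jcentral p)" and x: "x \<in> jpos" and y: "y \<in> jpos"
  shows "f (x + y) = f x + f y"
proof (rule N.jle_antisym)
  note add = additive_on_ray_sums[OF nc]
  show "f x + f y \<preceq> f (x + y)" by (rule superadditive[OF add x y])
  interpret inv: cone_iso eN eM g by (rule cone_iso_inv)
  \<comment> \<open>Additivity of the inverse is transported from \<open>f\<close>; by
    \<open>gF\<close> the inverse carries ray sums to ray sums.\<close>
  have gadd: "g (v + w) = g v + g w"
    if "v \<in> jpos" "w \<in> jpos" "g v \<in> ray_sum (\<lambda>_. True)" "g w \<in> ray_sum (\<lambda>_. True)" for v w
  proof -
    have "v + w = f (g v + g w)" using add[OF that(3,4)] that by (simp add: f_g)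
    then show ?thesis using that by (simp add: g_f M.jpos_add g_pos)
  qed
  have gF: "g w \<in> ray_sum (\<lambda>_. True)" if "w \<in> ray_sum (\<lambda>_. True)" for w
    using that
  proof induction
    case zero
    then show ?case by (simp add: inv.f_zero ray_sum.zero)
  next
    case (add w v)
    have "g v \<in> ray_sum (\<lambda>_. True)" using g_ray[OF add(2)] by (intro ray_sum_single) auto
    then have "g (w + v) = g w + g v" using add N.ray_sum_pos[OF add(1)] by (intro gadd) (auto simp: jray_def)
    then show ?case using add g_ray[OF add(2)] by (auto intro: ray_sum.add)
  qed
  have "g (f x) + g (f y) \<preceq> g (f x + f y)"
    using x y by (intro inv.superadditive f_pos gadd gF N.ray_sum_pos)
  then have "x + y \<preceq> g (f x + f y)" using x y by (simp add: g_f)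
  then show "f (x + y) \<preceq> f x + f y"
    using f_le[of "x + y" "g (f x + f y)"] x y by (simp add: M.jpos_add N.jpos_add f_pos g_pos f_g)
qed

lemma homogeneous:
  assumes nc: "\<not> (\<exists>p::'a. jatom p \<and> jcentral p)" and x: "x \<in> jpos" and c: "0 \<le> c"
  shows "f (c *\<^sub>R x) = c *\<^sub>R f x"
proof -
  have nat: "f (real n *\<^sub>R y) = real n *\<^sub>R f y" if "y \<in> jpos" for n y
  proof (induction n)
    case (Suc n)
    have "f (real n *\<^sub>R y + y) = f (real n *\<^sub>R y) + f y"
      using that by (intro additive nc M.jpos_scaleR) auto
    with Suc show ?case by (simp add: algebra_simps)
  qed (simp add: f_zero)
  have fx: "f x \<in> jpos" using x by (rule f_pos)
  have "norm (real n *\<^sub>R (f (c *\<^sub>R x) - c *\<^sub>R f x)) \<le> norm (f x)" for n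
  proof -
    \<comment> \<open>Both n f (c x) and n c f x lie between k f x and (k + 1) f x, so n times the
      difference of f (c x) and c f x stays bounded in n.\<close>
    define k where "k = nat \<lfloor>real n * c\<rfloor>"
    have k: "real k \<le> real n * c" "real n * c \<le> real (Suc k)"
      using c by (auto simp: k_def) linarith
    have nx: "real n *\<^sub>R f (c *\<^sub>R x) = f ((real n * c) *\<^sub>R x)"
      using nat[of "c *\<^sub>R x" n] x c by (simp add: M.jpos_scaleR)
    have le: "real k *\<^sub>R f x \<preceq> real n *\<^sub>R f (c *\<^sub>R x)" "real n *\<^sub>R f (c *\<^sub>R x) \<preceq> real (Suc k) *\<^sub>R f x"
      unfolding nx nat[OF x, symmetric]
      using x c k by (auto simp: f_le M.jpos_scaleR simp del: of_nat_Suc intro!: M.jle_scaleR_left)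
    have le': "real k *\<^sub>R f x \<preceq> (real n * c) *\<^sub>R f x" "(real n * c) *\<^sub>R f x \<preceq> real (Suc k) *\<^sub>R f x"
      using k fx by (auto intro!: N.jle_scaleR_left simp del: of_nat_Suc)
    let ?d = "real n *\<^sub>R (f (c *\<^sub>R x) - c *\<^sub>R f x)"
    have "?d \<preceq> f x" "- ?d \<preceq> f x"
      using N.jpos_add[OF le(2)[unfolded jle_def] le'(1)[unfolded jle_def]]
        N.jpos_add[OF le(1)[unfolded jle_def] le'(2)[unfolded jle_def]]
      by (simp_all add: jle_def algebra_simps)
    moreover have "f x \<preceq> norm (f x) *\<^sub>R eN" using N.unit_minus_pos by (simp add: jle_def)
    ultimately have "?d \<preceq> norm (f x) *\<^sub>R eN" "- ?d \<preceq> norm (f x) *\<^sub>R eN" using N.jle_trans by blast+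
    then show ?thesis by (subst N.norm_le_iff) (auto simp: jle_def)
  qed
  then have "f (c *\<^sub>R x) - c *\<^sub>R f x = 0" by (rule N.scaleR_bounded_zero)
  then show ?thesis by simp
qed

theorem cone_iso_linear:
  assumes nc: "\<not> (\<exists>p::'a. jatom p \<and> jcentral p)"
  obtains T where "linear_order_iso T" "\<And>x. x \<in> jpos \<Longrightarrow> f x = T x"
proof -
  \<comment> \<open>Each element is a difference of positive ones, here by adding a multiple of the
    unit; the fact \<open>T\<close> shows independence of the decomposition.\<close>
  define T where "T x = f (x + norm x *\<^sub>R eM) - f (norm x *\<^sub>R eM)" for x
  have dec: "norm x *\<^sub>R eM + x \<in> jpos" "norm x *\<^sub>R eM \<in> jpos" for x :: 'a
    by (auto intro: M.unit_plus_pos M.jpos_scaleR)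
  have T: "T (a - b) = f a - f b" if "a \<in> jpos" "b \<in> jpos" for a b
  proof -
    let ?n = "norm (a - b) *\<^sub>R eM"
    have "f ((?n + (a - b)) + b) = f (?n + (a - b)) + f b" using that dec by (intro additive nc)
    moreover have "f (a + ?n) = f a + f ?n" using that dec by (intro additive nc)
    ultimately have "f (?n + (a - b)) + f b = f a + f ?n" by (simp add: add.commute)
    then show ?thesis by (simp add: T_def add.commute algebra_simps)
  qed
  have Tf: "T x = f x" if "x \<in> jpos" for x using T[OF that, of 0] by (simp add: f_zero)
  have ex: "\<exists>a b. a \<in> jpos \<and> b \<in> jpos \<and> x = a - b" for x :: 'a
    by (rule exI[of _ "norm x *\<^sub>R eM + x"], rule exI[of _ "norm x *\<^sub>R eM"]) (simp add: dec)
  have lin: "linear T"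
  proof (rule linearI)
    fix x y :: 'a
    obtain a b c d where ab: "a \<in> jpos" "b \<in> jpos" "x = a - b" and cd: "c \<in> jpos" "d \<in> jpos" "y = c - d"
      using ex[of x] ex[of y] by blast
    have "x + y = (a + c) - (b + d)" by (simp add: ab cd)
    then have "T (x + y) = T ((a + c) - (b + d))" by simp
    also have "\<dots> = f (a + c) - f (b + d)" using ab cd by (intro T M.jpos_add)
    also have "\<dots> = T x + T y" using ab cd by (simp add: T additive nc)
    finally show "T (x + y) = T x + T y" .
  next
    fix k :: real and x :: 'a
    obtain a b where ab: "a \<in> jpos" "b \<in> jpos" "x = a - b" using ex[of x] by blast
    show "T (k *\<^sub>R x) = k *\<^sub>R T x"
    proof (cases "0 \<le> k")
      case True
      have "T (k *\<^sub>R x) = T (k *\<^sub>R a - k *\<^sub>R b)" by (simp add: ab scaleR_diff_right)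
      also have "\<dots> = f (k *\<^sub>R a) - f (k *\<^sub>R b)" using ab True by (intro T M.jpos_scaleR)
      finally show ?thesis using ab True by (simp add: T homogeneous nc scaleR_diff_right)
    next
      case False
      have "T (k *\<^sub>R x) = T ((- k) *\<^sub>R b - (- k) *\<^sub>R a)" by (simp add: ab scaleR_diff_right)
      also have "\<dots> = f ((- k) *\<^sub>R b) - f ((- k) *\<^sub>R a)" using ab False by (intro T M.jpos_scaleR) auto
      also have "\<dots> = (- k) *\<^sub>R f b - (- k) *\<^sub>R f a" 
        using homogeneous[OF nc ab(1), of "- k"] homogeneous[OF nc ab(2), of "- k"] False by simp
      finally show ?thesis using ab by (simp add: T scaleR_diff_right)
    qed
  qed
  have pos: "T x \<in> jpos \<longleftrightarrow> x \<in> jpos" for x :: 'a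
  proof -
    obtain a b where ab: "a \<in> jpos" "b \<in> jpos" "x = a - b" using ex[of x] by blast
    show ?thesis using f_le[OF ab(2,1)] by (simp add: ab(3) T[OF ab(1,2)] jle_def)
  qed
  have "inj T"
    unfolding linear_injective_0[OF lin]
  proof (intro allI impI)
    fix x assume "T x = 0"
    then show "x = 0" using pos[of x] pos[of "- x"] by (intro M.jpos_antisym) (auto simp: linear_neg[OF lin])
  qed
  moreover have "surj T"
  proof (rule surjI)
    fix y :: 'b
    let ?a = "norm y *\<^sub>R eN + y" and ?b = "norm y *\<^sub>R eN"
    have a: "?a \<in> jpos" "?b \<in> jpos" by (auto intro: N.unit_plus_pos N.jpos_scaleR)
    then show "T (g ?a - g ?b) = y" by (simp add: T g_pos f_g)
  qed
  ultimately have "linear_order_iso T" using lin pos by (simp add: linear_order_iso_def bij_def)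
  then show ?thesis using Tf that by metis
qed

end

section \<open>Linear order isomorphisms\<close>

definition janti_iso_on :: "'a::jb_algebra set \<Rightarrow> 'b::jb_algebra set \<Rightarrow> ('a \<Rightarrow> 'b) \<Rightarrow> bool" where
  "janti_iso_on A B f \<longleftrightarrow> bij_betw f A B \<and> (\<forall>x\<in>A. \<forall>y\<in>A. x \<preceq> y \<longleftrightarrow> f y \<preceq> f x)"

lemma jorder_iso_on_conjugate:
  assumes p: "janti_iso_on A B p" and f: "jorder_iso_on B C f" and q: "janti_iso_on C D q"
  shows "jorder_iso_on A D (\<lambda>x. q (f (p x)))"
proof -
  have "bij_betw (q \<circ> (f \<circ> p)) A D"
    using p f q by (intro bij_betw_trans) (auto simp: janti_iso_on_def jorder_iso_on_def)
  moreover have "p x \<in> B" "f (p x) \<in> C" if "x \<in> A" for x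
    using that p f by (auto simp: janti_iso_on_def jorder_iso_on_def bij_betw_def)
  ultimately show ?thesis
    using p f q by (auto simp: janti_iso_on_def jorder_iso_on_def comp_def)
qed

lemma linear_order_iso_le: "linear_order_iso T \<Longrightarrow> T x \<preceq> T y \<longleftrightarrow> x \<preceq> y"
  unfolding linear_order_iso_def jle_def by (metis linear_diff)

lemma linear_order_iso_on:
  "linear_order_iso T \<Longrightarrow> jorder_iso_on A (T ` A) T"
  unfolding jorder_iso_on_def
  by (auto simp: linear_order_iso_le linear_order_iso_def bij_def bij_betw_def intro: inj_on_subset)

lemma image_eq_if_mem_iff: "(\<And>x. T x \<in> B \<longleftrightarrow> x \<in> A) \<Longrightarrow> surj T \<Longrightarrow> T ` A = B"
  by (fastforce simp: surj_def image_iff)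

lemma linear_order_iso_image_jpos: "linear_order_iso T \<Longrightarrow> T ` jpos = jpos"
  by (rule image_eq_if_mem_iff) (auto simp: linear_order_iso_def bij_def)

lemma linear_order_iso_image_interval:
  assumes T: "linear_order_iso T"
  shows "T ` jinterval 0 a = jinterval 0 (T a)"
proof -
  have "T 0 = 0" using T by (simp add: linear_order_iso_def linear_0)
  then have "T x \<in> jinterval 0 (T a) \<longleftrightarrow> x \<in> jinterval 0 a" for x
    using linear_order_iso_le[OF T, of 0 x] linear_order_iso_le[OF T, of x a] by (simp add: jinterval_def)
  moreover have "surj T" using T by (simp add: linear_order_iso_def bij_def)
  ultimately show ?thesis by (rule image_eq_if_mem_iff)
qed

lemma linear_order_iso_inv:
  assumes T: "linear_order_iso T"
  shows "linear_order_iso (inv T)"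
proof -
  have b: "bij T" "linear T" using T by (auto simp: linear_order_iso_def)
  have T_inv: "T (inv T y) = y" and inv_T: "inv T (T x) = x" for x y
    using b by (simp_all add: bij_is_inj bij_is_surj surj_f_inv_f)
  have "linear (inv T)"
  proof (rule linearI)
    fix x y k
    have "T (inv T x + inv T y) = x + y" "T (k *\<^sub>R inv T x) = k *\<^sub>R x"
      by (simp_all add: linear_add[OF b(2)] linear_cmul[OF b(2)] T_inv)
    then show "inv T (x + y) = inv T x + inv T y" "inv T (k *\<^sub>R x) = k *\<^sub>R inv T x"
      using inv_T by metis+
  qed
  moreover have "inv T y \<in> jpos \<longleftrightarrow> y \<in> jpos" for y
    using T T_inv[of y] unfolding linear_order_iso_def by metis
  ultimately show ?thesis using b by (simp add: linear_order_iso_def bij_imp_bij_inv)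
qed

lemma linear_order_iso_comp:
  "linear_order_iso S \<Longrightarrow> linear_order_iso T \<Longrightarrow> linear_order_iso (\<lambda>x. S (T x))"
  unfolding linear_order_iso_def using linear_compose[of T S] bij_comp[of T S] by (simp add: comp_def)

context unital_jb
begin

section \<open>Inversion between the cone and the unit interval\<close>

lemma jinterval_iff: "(w::'a) \<in> jinterval 0 q \<longleftrightarrow> w \<in> jpos \<and> w \<preceq> q"
  by (simp add: jinterval_def jle_zero_iff)

lemma junit_interval_inv_iff: "w \<in> junit_interval_inv e \<longleftrightarrow> spos w \<and> w \<preceq> e"
  by (auto simp: junit_interval_inv_def jinterval_iff spos_iff)

lemma quad_rep_linear_order_iso:
  assumes a: "jinvertible e a"
  shows "linear_order_iso (quad_rep a)"
  unfolding linear_order_iso_def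
proof (intro conjI allI)
  show "linear (quad_rep a)" using bounded_linear_quad_rep by (rule bounded_linear.linear)
  show "bij (quad_rep a)"
    using quad_rep_jinv_left[OF a] quad_rep_jinv_right[OF a] by (intro bij_betw_byWitness[where f'="quad_rep (jinv e a)"]) auto
  show "quad_rep a x \<in> jpos \<longleftrightarrow> x \<in> jpos" for x
    using quad_rep_le_iff[OF a, of 0 x] by (simp add: jle_zero_iff)
qed

lemma jinv_scaleR:
  assumes "jinvertible e a" "c \<noteq> 0"
  shows "jinvertible e (c *\<^sub>R a)" and "jinv e (c *\<^sub>R a) = (1 / c) *\<^sub>R jinv e a"
proof -
  have "c *\<^sub>R a \<in> jb_gen e a" "(1 / c) *\<^sub>R jinv e a \<in> jb_gen e a"
    by (intro jb_gen_intros jinv_in_gen assms)+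
  moreover have "(c *\<^sub>R a) \<odot> ((1 / c) *\<^sub>R jinv e a) = e"
    using assms by (simp add: jprod_distribs jprod_jinv)
  ultimately show "jinvertible e (c *\<^sub>R a)" "jinv e (c *\<^sub>R a) = (1 / c) *\<^sub>R jinv e a"
    by (rule gen_inverse)+
qed

lemma jinv_unit_plus:
  assumes "a \<in> jpos"
  shows "spos (jinv e (e + a))" "jinv e (e + a) \<preceq> e" "jinvertible e (e + a)"
proof -
  have s: "spos (e + a)" using assms by (intro spos_add spos_unit)
  then show "spos (jinv e (e + a))" "jinvertible e (e + a)" by (auto intro: spos_jinv spos_invertible)
  show "jinv e (e + a) \<preceq> e" using assms by (intro jinv_le_unit) (simp add: jle_def)
qed

lemma cone_to_interval: "janti_iso_on jpos (junit_interval_inv e) (\<lambda>x. jinv e (e + x))"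
  and interval_to_cone: "janti_iso_on (junit_interval_inv e) jpos (\<lambda>y. jinv e y - e)"
proof -
  have 1: "jinv e y - e \<in> jpos" "jinv e (e + (jinv e y - e)) = y" if "y \<in> junit_interval_inv e" for y
    using that jinv_antimono[of y e]
    by (auto simp: junit_interval_inv_iff jinv_unit jle_def jinv_jinv spos_invertible)
  have 2: "jinv e (e + x) \<in> junit_interval_inv e" "jinv e (jinv e (e + x)) - e = x" if "x \<in> jpos" for x
    using that by (auto simp: junit_interval_inv_iff jinv_unit_plus jinv_jinv)
  have 3: "x \<preceq> y \<longleftrightarrow> jinv e (e + y) \<preceq> jinv e (e + x)" if "x \<in> jpos" "y \<in> jpos" for x y
    using that jinv_le_iff[of "e + x" "e + y"] by (simp add: spos_add spos_unit)
  have 4: "x \<preceq> y \<longleftrightarrow> jinv e y - e \<preceq> jinv e x - e" if "x \<in> junit_interval_inv e" "y \<in> junit_interval_inv e" for x y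
  proof -
    have "jinv e y - e \<preceq> jinv e x - e \<longleftrightarrow> jinv e y \<preceq> jinv e x" by (simp add: jle_def)
    then show ?thesis using that jinv_le_iff[of x y] by (simp add: junit_interval_inv_iff)
  qed
  have "bij_betw (\<lambda>x. jinv e (e + x)) jpos (junit_interval_inv e)"
    by (rule bij_betw_byWitness[where f'="\<lambda>y. jinv e y - e"]) (use 1 2 in auto)
  then show "janti_iso_on jpos (junit_interval_inv e) (\<lambda>x. jinv e (e + x))"
    using 3 by (simp add: janti_iso_on_def)
  have "bij_betw (\<lambda>y. jinv e y - e) (junit_interval_inv e) jpos"
    by (rule bij_betw_byWitness[where f'="\<lambda>x. jinv e (e + x)"]) (use 1 2 in auto)
  then show "janti_iso_on (junit_interval_inv e) jpos (\<lambda>y. jinv e y - e)"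
    using 4 by (simp add: janti_iso_on_def)
qed

text \<open>A geometric series whose remainder is a triple product of a with the inverse, which has
  norm at most 1. The quadratic term is what later recovers the Jordan product from
  inversion.\<close>

lemma jinv_unit_plus_expansion:
  assumes a: "a \<in> jpos"
  shows "norm (jinv e (e + a) - (e - a + a \<odot> a)) \<le> norm a ^ 3"
proof -
  let ?y = "jinv e (e + a)"
  have "(e + a) \<odot> ?y = e" using jinv_unit_plus(3)[OF a] by (rule jprod_jinv)
  then have y: "?y = e - a \<odot> ?y" by (simp add: jprod_distribs eq_diff_eq)
  have ay: "a \<odot> ?y = a - a \<odot> (a \<odot> ?y)" by (subst y) (simp add: jprod_distribs)
  have aay: "a \<odot> (a \<odot> ?y) = a \<odot> a - a \<odot> (a \<odot> (a \<odot> ?y))" by (subst ay) (simp add: jprod_distribs)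
  have "?y - (e - a + a \<odot> a) = - (a \<odot> (a \<odot> (a \<odot> ?y)))"
  proof (rule linear_functional_eqI)
    fix \<phi> :: "'a \<Rightarrow> real" assume "linear \<phi>"
    then show "\<phi> (?y - (e - a + a \<odot> a)) = \<phi> (- (a \<odot> (a \<odot> (a \<odot> ?y))))"
      using arg_cong[OF y, of \<phi>] arg_cong[OF ay, of \<phi>] arg_cong[OF aay, of \<phi>]
      by (simp only: linear_diff linear_add linear_neg)
  qed
  then have "norm (?y - (e - a + a \<odot> a)) = norm (a \<odot> (a \<odot> (a \<odot> ?y)))" by simp
  also have "\<dots> \<le> norm a * (norm a * (norm a * norm ?y))"
    by (meson norm_jprod_le mult_left_mono norm_ge_zero order_trans)
  also have "\<dots> \<le> norm a * (norm a * (norm a * 1))"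
  proof -
    have "norm ?y \<le> norm e" using jinv_unit_plus[OF a] by (intro norm_mono spos_pos)
    then show ?thesis using norm_unit_le by (intro mult_left_mono) auto
  qed
  finally show ?thesis by (simp add: power3_eq_cube)
qed

end

lemma second_order_vanishing:
  fixes u v :: "'a::real_normed_vector"
  assumes C: "\<And>s. 0 < s \<Longrightarrow> norm (s *\<^sub>R u + s\<^sup>2 *\<^sub>R v) \<le> C * s ^ 3"
  shows "u = 0" "v = 0"
proof -
  have lim: "(\<lambda>n. 1 / real (Suc n)) \<longlonglongrightarrow> 0"
    using LIMSEQ_inverse_real_of_nat by (simp add: inverse_eq_divide)
  have 1: "norm (u + s *\<^sub>R v) \<le> C * s\<^sup>2" if s: "0 < s" for s
  proof -
    have "s * norm (u + s *\<^sub>R v) = norm (s *\<^sub>R (u + s *\<^sub>R v))" using s by simp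
    also have "\<dots> = norm (s *\<^sub>R u + s\<^sup>2 *\<^sub>R v)" by (simp add: scaleR_add_right power2_eq_square)
    also have "\<dots> \<le> s * (C * s\<^sup>2)" using C[OF s] by (simp add: power3_eq_cube power2_eq_square mult_ac)
    finally show ?thesis using s by simp
  qed
  have "norm (u + 0 *\<^sub>R v) \<le> C * 0\<^sup>2"
  proof (rule LIMSEQ_le)
    show "(\<lambda>n. norm (u + (1 / real (Suc n)) *\<^sub>R v)) \<longlonglongrightarrow> norm (u + 0 *\<^sub>R v)"
      by (intro tendsto_intros lim)
    show "(\<lambda>n. C * (1 / real (Suc n))\<^sup>2) \<longlonglongrightarrow> C * 0\<^sup>2"
      by (intro tendsto_intros lim)
  qed (use 1 in auto)
  then show u: "u = 0" by simp
  have 2: "norm v \<le> C * s" if s: "0 < s" for s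
    using 1[OF s] s by (simp add: u power2_eq_square)
  have "norm v \<le> C * 0"
  proof (rule LIMSEQ_le_const)
    show "(\<lambda>n. C * (1 / real (Suc n))) \<longlonglongrightarrow> C * 0" by (intro tendsto_intros lim)
    show "\<exists>N. \<forall>n\<ge>N. norm v \<le> C * (1 / real (Suc n))" by (intro exI allI impI 2) simp
  qed
  then show "v = 0" by simp
qed

lemma (in jbw_pair) cone_iso_intro: "jorder_iso_on jpos jpos f \<Longrightarrow> cone_iso eM eN f"
  by (intro cone_iso.intro cone_iso_axioms.intro jbw_pair_axioms)

locale unital_pair = M: unital_jb eM + N: unital_jb eN
  for eM :: "'a::jb_algebra" and eN :: "'b::jb_algebra"
begin

lemma spos_order_iso:
  assumes T: "linear_order_iso T" and u: "N.spos (T eM)"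
  shows "N.spos (T x) \<longleftrightarrow> M.spos x"
proof
  have lin: "linear T" using T by (simp add: linear_order_iso_def)
  have TK: "T (K *\<^sub>R eM - y) \<in> jpos \<longleftrightarrow> K *\<^sub>R eM - y \<in> jpos" for K y using T by (simp add: linear_order_iso_def)
  assume "N.spos (T x)"
  then obtain \<epsilon> where \<epsilon>: "\<epsilon> > 0" "T x - \<epsilon> *\<^sub>R eN \<in> jpos" by (auto simp: N.spos_def)
  define K where "K = norm (T eM) + 1"
  have K: "K > 0" by (simp add: K_def add_nonneg_pos)
  have "K *\<^sub>R eN - T eM \<in> jpos" by (rule N.unit_minus_pos) (simp add: K_def)
  then have "(\<epsilon> / K) *\<^sub>R (K *\<^sub>R eN - T eM) \<in> jpos" using \<epsilon> K by (intro N.jpos_scaleR) auto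
  then have "\<epsilon> *\<^sub>R eN - (\<epsilon> / K) *\<^sub>R T eM \<in> jpos" using K by (simp add: scaleR_diff_right)
  from N.jpos_add[OF \<epsilon>(2) this] have "T (x - (\<epsilon> / K) *\<^sub>R eM) \<in> jpos"
    by (simp add: linear_diff[OF lin] linear_cmul[OF lin])
  then have "x - (\<epsilon> / K) *\<^sub>R eM \<in> jpos" using T by (simp add: linear_order_iso_def)
  then show "M.spos x" using \<epsilon> K by (auto simp: M.spos_def intro!: exI[of _ "\<epsilon> / K"])
next
  have lin: "linear T" using T by (simp add: linear_order_iso_def)
  assume "M.spos x"
  then obtain \<epsilon> where \<epsilon>: "\<epsilon> > 0" "x - \<epsilon> *\<^sub>R eM \<in> jpos" by (auto simp: M.spos_def)
  then have "T (x - \<epsilon> *\<^sub>R eM) \<in> jpos" using T by (simp add: linear_order_iso_def)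
  then have "\<epsilon> *\<^sub>R T eM \<preceq> T x" by (simp add: linear_diff[OF lin] linear_cmul[OF lin] jle_def)
  then show "N.spos (T x)" using N.spos_mono N.spos_scaleR[OF u \<epsilon>(1)] by blast
qed

lemma spos_order_iso_unit:
  assumes T: "linear_order_iso T"
  shows "N.spos (T eM)"
proof -
  have lin: "linear T" and b: "bij T" using T by (auto simp: linear_order_iso_def)
  let ?y = "inv T eN"
  have y: "T ?y = eN" using b by (simp add: bij_is_surj surj_f_inv_f)
  define K where "K = norm ?y + 1"
  have K: "K > 0" by (simp add: K_def add_nonneg_pos)
  have "K *\<^sub>R eM - ?y \<in> jpos" by (rule M.unit_minus_pos) (simp add: K_def)
  then have "T (K *\<^sub>R eM - ?y) \<in> jpos" using T by (simp add: linear_order_iso_def)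
  then have "K *\<^sub>R T eM - eN \<in> jpos" by (simp add: linear_diff[OF lin] linear_cmul[OF lin] y)
  from N.jpos_scaleR[OF this, of "1 / K"] K have "T eM - (1 / K) *\<^sub>R eN \<in> jpos"
    by (simp add: scaleR_diff_right)
  then show ?thesis using K by (auto simp: N.spos_def intro!: exI[of _ "1 / K"])
qed

lemma order_iso_unit_interval_inv:
  assumes T: "linear_order_iso T" and u: "T eM = eN"
  shows "jorder_iso_on (junit_interval_inv eM) (junit_interval_inv eN) T"
proof -
  have "T ` junit_interval_inv eM = junit_interval_inv eN"
  proof -
    have "T x \<in> junit_interval_inv eN \<longleftrightarrow> x \<in> junit_interval_inv eM" for x
      using spos_order_iso[OF T, of x] linear_order_iso_le[OF T, of x eM]
      by (simp add: u N.spos_unit N.junit_interval_inv_iff M.junit_interval_inv_iff)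
    moreover have "surj T" using T by (simp add: linear_order_iso_def bij_def)
    ultimately show ?thesis by (rule image_eq_if_mem_iff)
  qed
  then show ?thesis using linear_order_iso_on[OF T, of "junit_interval_inv eM"] by simp
qed

lemma unital_order_iso_contractive:
  assumes T: "linear_order_iso T" and u: "T eM = eN"
  shows "norm (T x) \<le> norm x"
proof -
  have lin: "linear T" using T by (simp add: linear_order_iso_def)
  have "T (norm x *\<^sub>R eM - x) \<in> jpos" "T (norm x *\<^sub>R eM + x) \<in> jpos"
    using T M.unit_minus_pos[of x "norm x"] M.unit_plus_pos[of x "norm x"] by (auto simp: linear_order_iso_def)
  then show ?thesis
    by (simp add: N.norm_le_iff linear_diff[OF lin] linear_add[OF lin] linear_cmul[OF lin] u)
qed

lemma jordan_iso_unit: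
  assumes J: "jordan_iso J"
  shows "J eM = eN"
proof -
  obtain x where x: "J x = eN" using J unfolding jordan_iso_def by (metis bij_pointE)
  have "J (eM \<odot> x) = J eM \<odot> J x" using J unfolding jordan_iso_def by blast
  then show ?thesis by (simp add: x)
qed

end

lemma jordan_iso_order_iso:
  assumes J: "jordan_iso J"
  shows "linear_order_iso J"
  unfolding linear_order_iso_def
proof (intro conjI allI)
  show "linear J" "bij J" using J by (auto simp: jordan_iso_def)
  have hom: "J (x \<odot> y) = J x \<odot> J y" for x y using J by (simp add: jordan_iso_def)
  show "J x \<in> jpos \<longleftrightarrow> x \<in> jpos" for x
  proof
    assume "J x \<in> jpos"
    then obtain y where y: "J x = y \<odot> y" by (auto simp: jpos_def)
    obtain w where "J w = y" using \<open>bij J\<close> by (metis bij_pointE)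
    with y have "J x = J (w \<odot> w)" by (simp add: hom)
    then have "x = w \<odot> w" using \<open>bij J\<close> by (metis bij_is_inj injD)
    then show "x \<in> jpos" by (auto simp: jpos_def)
  qed (auto simp: jpos_def hom)
qed

context jbw_pair
begin

sublocale unital: unital_pair eM eN
  by unfold_locales

text \<open>The map \<open>h\<close> is an order isomorphism of \<open>M\<^sub>+\<close>, hence linear; comparing the expansions
  \<open>(e + a)\<^sup>-\<^sup>1 = e - a + a\<^sup>2 + O(a\<^sup>3)\<close> on both sides gives \<open>h = id\<close> and \<open>S (x\<^sup>2) = (S x)\<^sup>2\<close>.\<close>

lemma unital_order_iso_is_jordan:
  assumes nc: "\<not> (\<exists>p::'a. jatom p \<and> jcentral p)"
    and S: "linear_order_iso S" and u: "S eM = eN"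
  shows "jordan_iso S"
proof -
  let ?R = "inv S"
  have lin: "linear S" and b: "bij S" using S by (auto simp: linear_order_iso_def)
  have RS: "?R (S x) = x" and SR: "S (?R y) = y" for x y
    using b by (simp_all add: bij_is_inj bij_is_surj surj_f_inv_f)
  have R: "linear_order_iso ?R" using S by (rule linear_order_iso_inv)
  have linR: "linear ?R" using R by (simp add: linear_order_iso_def)
  have uR: "?R eN = eM" using RS[of eM] by (simp add: u)
  interpret NM: unital_pair eN eM by unfold_locales
  interpret MM: jbw_pair eM eM by unfold_locales
  define h where "h x = jinv eM (?R (jinv eN (eN + S x))) - eM" for x
  have "jorder_iso_on jpos jpos S"
    using linear_order_iso_on[OF S, of jpos] linear_order_iso_image_jpos[OF S] by simp
  moreover have "jorder_iso_on jpos jpos (\<lambda>y. jinv eM (?R (jinv eN (eN + y))) - eM)"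
    by (rule jorder_iso_on_conjugate[OF N.cone_to_interval
        NM.order_iso_unit_interval_inv[OF R uR] M.interval_to_cone])
  ultimately have "jorder_iso_on jpos jpos h" unfolding h_def by (rule jorder_iso_on_comp)
  then interpret cone_iso eM eM h by (rule MM.cone_iso_intro)
  obtain K where K: "linear_order_iso K" "\<And>x. x \<in> jpos \<Longrightarrow> h x = K x" using cone_iso_linear[OF nc] by blast
  have linK: "linear K" using K by (simp add: linear_order_iso_def)
  have Sp: "S x \<in> jpos" and Kp: "K x \<in> jpos" if "x \<in> jpos" for x
    using that S K by (auto simp: linear_order_iso_def)
  have key: "?R (jinv eN (eN + S x)) = jinv eM (eM + K x)" if x: "x \<in> jpos" for x
  proof -
    have "M.spos (?R (jinv eN (eN + S x)))"
      using NM.spos_order_iso[OF R, of "jinv eN (eN + S x)"] N.jinv_unit_plus[OF Sp[OF x]] uR M.spos_unit by simp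
    then have "jinv eM (jinv eM (?R (jinv eN (eN + S x)))) = ?R (jinv eN (eN + S x))"
      by (intro M.jinv_jinv M.spos_invertible)
    moreover have "jinv eM (?R (jinv eN (eN + S x))) = eM + K x"
      using K(2)[OF x] by (simp add: h_def algebra_simps)
    ultimately show ?thesis by simp
  qed
  have sq: "S (x \<odot> x) = S x \<odot> S x" if x: "x \<in> jpos" for x
  proof -
    define C where "C = norm (S x) ^ 3 + norm (K x) ^ 3"
    have bound: "norm (s *\<^sub>R (K x - x) + s\<^sup>2 *\<^sub>R (?R (S x \<odot> S x) - K x \<odot> K x)) \<le> C * s ^ 3"
      if s: "0 < s" for s
    proof -
      have sx: "s *\<^sub>R x \<in> jpos" using s x by (intro M.jpos_scaleR) auto
      let ?a = "s *\<^sub>R S x" and ?b = "s *\<^sub>R K x"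
      have a: "?a \<in> jpos" and bb: "?b \<in> jpos"
        using s x by (auto intro!: N.jpos_scaleR M.jpos_scaleR Sp Kp)
      have k: "?R (jinv eN (eN + ?a)) = jinv eM (eM + ?b)"
        using key[OF sx] by (simp add: linear_cmul[OF lin] linear_cmul[OF linK])
      have 1: "norm (?R (jinv eN (eN + ?a) - (eN - ?a + ?a \<odot> ?a))) \<le> norm ?a ^ 3"
        by (rule order_trans[OF NM.unital_order_iso_contractive[OF R uR] N.jinv_unit_plus_expansion[OF a]])
      have 2: "norm (jinv eM (eM + ?b) - (eM - ?b + ?b \<odot> ?b)) \<le> norm ?b ^ 3"
        by (rule M.jinv_unit_plus_expansion[OF bb])
      have "?R (jinv eN (eN + ?a) - (eN - ?a + ?a \<odot> ?a))
          = jinv eM (eM + ?b) - (eM - s *\<^sub>R x + s\<^sup>2 *\<^sub>R ?R (S x \<odot> S x))"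
        by (simp add: linear_diff[OF linR] linear_add[OF linR] linear_cmul[OF linR] k uR RS jprod_distribs
            power2_eq_square)
      moreover have "s *\<^sub>R (K x - x) + s\<^sup>2 *\<^sub>R (?R (S x \<odot> S x) - K x \<odot> K x)
          = (jinv eM (eM + ?b) - (eM - ?b + ?b \<odot> ?b))
            - (jinv eM (eM + ?b) - (eM - s *\<^sub>R x + s\<^sup>2 *\<^sub>R ?R (S x \<odot> S x)))"
        by (simp add: jprod_distribs power2_eq_square algebra_simps)
      ultimately have "norm (s *\<^sub>R (K x - x) + s\<^sup>2 *\<^sub>R (?R (S x \<odot> S x) - K x \<odot> K x)) \<le> norm ?b ^ 3 + norm ?a ^ 3"
        using 1 2 norm_triangle_ineq4 by (smt (verit, best))
      then show ?thesis using s by (simp add: C_def power_mult_distrib algebra_simps)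
    qed
    have "K x - x = 0" "?R (S x \<odot> S x) - K x \<odot> K x = 0"
      using second_order_vanishing[OF bound] by blast+
    then have "?R (S x \<odot> S x) = x \<odot> x" by simp
    then show ?thesis using SR[of "S x \<odot> S x"] by simp
  qed
  \<comment> \<open>A shift by a multiple of the unit moves x into the cone, and the additional
    terms agree because S is linear and unital.\<close>
  have sq': "S (x \<odot> x) = S x \<odot> S x" for x
  proof -
    define l where "l = norm x"
    have "l *\<^sub>R eM + x \<in> jpos" unfolding l_def by (rule M.unit_plus_pos) simp
    from sq[OF this] show ?thesis
      by (simp add: jprod_distribs linear_add[OF lin] linear_cmul[OF lin] u)
  qed
  have "S (x \<odot> y) = S x \<odot> S y" for x y
  proof -
    have "S ((x + y) \<odot> (x + y)) = S (x + y) \<odot> S (x + y)" by (rule sq')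
    then have "S (x \<odot> y) + S (x \<odot> y) = S x \<odot> S y + S x \<odot> S y"
      by (simp add: jprod_distribs linear_add[OF lin] sq' jprod_commute[of y x] jprod_commute[of "S y" "S x"])
    then have "2 *\<^sub>R S (x \<odot> y) = 2 *\<^sub>R (S x \<odot> S y)" by (simp add: scaleR_2)
    then show ?thesis by simp
  qed
  then show ?thesis using lin b by (simp add: jordan_iso_def)
qed

text \<open>With w the positive root of T e, composing T with the inverse of U_w makes it unital, so
  that \<open>unital_order_iso_is_jordan\<close> applies.\<close>

lemma linear_order_iso_decomposition:
  fixes T :: "'a \<Rightarrow> 'b"
  assumes nc: "\<not> (\<exists>p::'a. jatom p \<and> jcentral p)" and T: "linear_order_iso T"
  obtains w J where "N.spos w" "jordan_iso J" "\<And>x. T x = quad_rep w (J x)"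
proof -
  have t: "N.spos (T eM)" using T by (rule unital.spos_order_iso_unit)
  define w where "w = jsqrt eN (T eM)"
  have w: "N.spos w" "w \<odot> w = T eM" using t by (auto simp: w_def N.spos_jsqrt N.jsqrt_square N.spos_pos)
  have wi: "jinvertible eN w" using w by (intro N.spos_invertible)
  define J where "J x = quad_rep (jinv eN w) (T x)" for x
  have "linear_order_iso J"
    unfolding J_def[abs_def]
    by (rule linear_order_iso_comp[OF N.quad_rep_linear_order_iso[OF N.jinvertible_jinv[OF wi]] T])
  moreover have "J eM = eN" using N.quad_rep_jinv_left[OF wi, of eN] by (simp add: J_def w)
  ultimately have "jordan_iso J" by (rule unital_order_iso_is_jordan[OF nc])
  moreover have "T x = quad_rep w (J x)" for x by (simp add: J_def N.quad_rep_jinv_right wi)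
  ultimately show ?thesis by (rule that[OF w(1)])
qed

end

section \<open>Order isomorphisms of unit intervals\<close>

context unital_jb
begin

text \<open>With k the root of d, the product of a and d is U_k a, whose operator is U_k U_a U_k by
  the fundamental formula. Inside one generated subalgebra U_k and U_a commute, which leaves U_a U_k
  U_k = U_a U_d.\<close>

lemma quad_rep_comp_gen:
  assumes a: "a \<in> jb_gen e x" and d: "d \<in> jb_gen e x" "d \<in> jpos"
  shows "quad_rep a (quad_rep d w) = quad_rep (a \<odot> d) w"
proof -
  let ?k = "jsqrt e d"
  have k: "?k \<in> jb_gen e x" using jsqrt_in_gen[OF d(2)] d(1) by (rule jb_gen_trans)
  have kk: "?k \<odot> ?k = d" using d(2) by (rule jsqrt_square)
  note c = jb_gen_operator_commute
  have "quad_rep a (quad_rep ?k v) = quad_rep ?k (quad_rep a v)" for v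
  proof -
    have "a \<odot> (?k \<odot> u) = ?k \<odot> (a \<odot> u)" "a \<odot> (d \<odot> u) = d \<odot> (a \<odot> u)"
      "(a \<odot> a) \<odot> (?k \<odot> u) = ?k \<odot> ((a \<odot> a) \<odot> u)" "(a \<odot> a) \<odot> (d \<odot> u) = d \<odot> ((a \<odot> a) \<odot> u)" for u
      by (intro c[of _ x] a d k jb_gen_jprod)+
    then show ?thesis by (simp add: quad_rep_def kk jprod_distribs algebra_simps)
  qed
  moreover have "quad_rep d w = quad_rep ?k (quad_rep ?k w)"
    using fundamental_formula[of ?k e w] by (simp add: kk)
  moreover have "a \<odot> d = quad_rep ?k a"
    using quad_rep_gen[OF k a] by (simp add: kk jprod_commute)
  ultimately show ?thesis by (simp add: fundamental_formula)
qed

lemma jinvertible_jprod_jinv_iff: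
  assumes d: "d \<in> jb_gen e x" "jinvertible e d"
  shows "jinvertible e (x \<odot> jinv e d) \<longleftrightarrow> jinvertible e x"
proof -
  have i: "jinv e d \<in> jb_gen e x" using jinv_in_gen[OF d(2)] d(1) by (rule jb_gen_trans)
  have xi: "x \<odot> jinv e d \<in> jb_gen e x" by (intro jb_gen_intros i)
  show ?thesis
  proof
    assume "jinvertible e (x \<odot> jinv e d)"
    then obtain y where "y \<in> jb_gen e (x \<odot> jinv e d)" "(x \<odot> jinv e d) \<odot> y = e" by (auto simp: jinvertible_def)
    then have "\<exists>y\<in>jb_gen e x. (x \<odot> jinv e d) \<odot> y = e" using xi jb_gen_trans by blast
    from gen_invertible_factor[OF jb_gen_self i this] show "jinvertible e x" by (simp add: jinvertible_def)
  next
    assume "jinvertible e x"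
    then have "\<exists>y\<in>jb_gen e x. x \<odot> y = e" by (simp add: jinvertible_def)
    moreover have "\<exists>y\<in>jb_gen e x. jinv e d \<odot> y = e"
      using d jprod_jinv[OF d(2)] by (intro bexI[of _ d]) (simp_all add: jprod_commute)
    ultimately obtain y where "y \<in> jb_gen e x" "(x \<odot> jinv e d) \<odot> y = e"
      using gen_invertible_jprod[OF jb_gen_self i] by blast
    with xi show "jinvertible e (x \<odot> jinv e d)" by (rule gen_inverse)
  qed
qed

lemma spos_quad_rep_iff: "jinvertible e a \<Longrightarrow> spos (quad_rep a w) \<longleftrightarrow> spos w"
  using spos_quad_rep[of a w] spos_quad_rep[of "jinv e a" "quad_rep a w"]
  by (auto simp: jinvertible_jinv quad_rep_jinv_left)

text \<open>The function s / (1 + s), written as 1 - 1 / (1 + s): in this form it is monotone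
  because inversion reverses the order.\<close>

definition jcontract :: "'a \<Rightarrow> 'a" where
  "jcontract v = e - jinv e (e + v)"

lemma jcontract_eq: "v \<in> jpos \<Longrightarrow> jcontract v = v \<odot> jinv e (e + v)"
proof -
  assume "v \<in> jpos"
  then have "jinv e (e + v) + v \<odot> jinv e (e + v) = e"
    using jprod_jinv[OF jinv_unit_plus(3), of v] by (simp only: jprod.add_left unit_left)
  then have "jinv e (e + v) + v \<odot> jinv e (e + v) - jinv e (e + v) = e - jinv e (e + v)" by (rule arg_cong)
  then show ?thesis by (simp only: jcontract_def add_diff_cancel_left')
qed

lemma jcontract_le_iff: "v \<in> jpos \<Longrightarrow> w \<in> jpos \<Longrightarrow> jcontract v \<preceq> jcontract w \<longleftrightarrow> v \<preceq> w"
  using jinv_le_iff[of "e + v" "e + w"] by (simp add: jcontract_def jle_def spos_add spos_unit)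

lemma jcontract_pos: "v \<in> jpos \<Longrightarrow> jcontract v \<in> jpos"
  using jinv_unit_plus(2)[of v] by (simp add: jcontract_def jle_def)

lemma jcontract_iso:
  assumes q: "q \<in> jpos"
  shows "jorder_iso_on (jinterval 0 q) (jinterval 0 (jcontract q)) jcontract"
proof -
  \<comment> \<open>Solves u = 1 - 1 / (1 + v) for v. Below \<open>jcontract q\<close> the inverse
    exists because e - u is at least the inverse of e + q.\<close>
  let ?g = "\<lambda>u. jinv e (e - u) - e"
  have g: "?g u \<in> jpos" "jcontract (?g u) = u" if "u \<in> jpos" "u \<preceq> jcontract q" for u
  proof -
    have "jinv e (e + q) \<preceq> e - u" using that(2) by (simp add: jcontract_def jle_def algebra_simps)
    then have s: "spos (e - u)" using jinv_unit_plus(1)[OF q] spos_mono by blast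
    have "e - u \<preceq> e" using that(1) by (simp add: jle_def)
    then show "?g u \<in> jpos" using jinv_antimono[OF s \<open>e - u \<preceq> e\<close>] by (simp add: jinv_unit jle_def)
    show "jcontract (?g u) = u" using s by (simp add: jcontract_def jinv_jinv spos_invertible)
  qed
  have "bij_betw jcontract (jinterval 0 q) (jinterval 0 (jcontract q))"
  proof (rule bij_betw_byWitness[where f'="?g"])
    show "\<forall>a\<in>jinterval 0 q. ?g (jcontract a) = a"
      by (auto simp: jinterval_iff jcontract_def jinv_jinv jinv_unit_plus)
    show "\<forall>u\<in>jinterval 0 (jcontract q). jcontract (?g u) = u" using g by (simp add: jinterval_iff)
    show "jcontract ` jinterval 0 q \<subseteq> jinterval 0 (jcontract q)"
      using q by (auto simp: jinterval_iff jcontract_pos jcontract_le_iff)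
    show "?g ` jinterval 0 (jcontract q) \<subseteq> jinterval 0 q"
    proof
      fix v assume "v \<in> ?g ` jinterval 0 (jcontract q)"
      then obtain u where u: "u \<in> jpos" "u \<preceq> jcontract q" "v = ?g u" by (auto simp: jinterval_iff)
      then show "v \<in> jinterval 0 q"
        using g[OF u(1,2)] jcontract_le_iff[of "?g u" q] q by (simp add: jinterval_iff)
    qed
  qed
  then show ?thesis by (auto simp: jorder_iso_on_def jinterval_iff jcontract_le_iff)
qed

lemma jcontract_spos_iff:
  assumes v: "v \<in> jpos"
  shows "spos (jcontract v) \<longleftrightarrow> spos v"
proof -
  have "e + v \<in> jb_gen e v" by (intro jb_gen_intros)
  from jinvertible_jprod_jinv_iff[OF this jinv_unit_plus(3)[OF v]] show ?thesis
    using v jcontract_pos[OF v] by (simp add: spos_iff jcontract_eq)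
qed

text \<open>The reciprocal of s / (1 + s) is 1 + 1/s: up to inversion the contraction is a
  translation.\<close>

lemma jinv_jcontract:
  assumes v: "spos v"
  shows "jinv e (jcontract v) = e + jinv e v"
proof -
  have v0: "v \<in> jpos" "jinvertible e v" using v by (auto simp: spos_iff)
  let ?i = "jinv e (e + v)"
  have gi: "?i \<in> jb_gen e v"
    by (rule jb_gen_trans[OF jinv_in_gen[OF jinv_unit_plus(3)[OF v0(1)]]]) (intro jb_gen_intros)
  have gj: "jinv e v \<in> jb_gen e v" using v0(2) by (rule jinv_in_gen)
  have "(v \<odot> ?i) \<odot> jinv e v = ?i \<odot> (v \<odot> jinv e v)"
    using jb_gen_assoc[OF gi jb_gen_self gj] by (simp add: jprod_commute)
  then have "(v \<odot> ?i) \<odot> (e + jinv e v) = (e + v) \<odot> ?i"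
    using v0(2) by (simp add: jprod.add_right jprod.add_left jprod_jinv add.commute)
  also have "\<dots> = e" by (rule jprod_jinv[OF jinv_unit_plus(3)[OF v0(1)]])
  finally have 1: "(v \<odot> ?i) \<odot> (e + jinv e v) = e" .
  have "v \<odot> ?i \<in> jb_gen e v" "e + jinv e v \<in> jb_gen e v" by (intro jb_gen_intros gi gj)+
  from gen_inverse(2)[OF this 1] show ?thesis by (simp add: jcontract_eq v0)
qed

section \<open>The fractional linear maps phi_t\<close>

lemma jphi_denominator_spos:
  assumes t: "t < 1" and x: "x \<in> jinterval 0 e"
  shows "spos (t *\<^sub>R x + (1 - t) *\<^sub>R e)"
proof (cases "0 \<le> t")
  case True
  have "spos ((1 - t) *\<^sub>R e + t *\<^sub>R x)"
    using True t x by (intro spos_add spos_scaleR spos_unit jpos_scaleR) (auto simp: jinterval_iff)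
  then show ?thesis by (simp add: add.commute)
next
  case False
  have "spos (e + (- t) *\<^sub>R (e - x))"
    using False x by (intro spos_add spos_unit jpos_scaleR) (auto simp: jinterval_iff jle_def)
  then show ?thesis by (simp add: algebra_simps)
qed

text \<open>In t s / (t s + 1 - t) = 1 - (1 - t) / (t s + 1 - t) the variable occurs only under an
  inverse, so the order behaviour follows from that of inversion. Dividing by t then brings in its
  sign and makes t = 0 a separate case.\<close>

lemma jphi_scaled:
  assumes "t < 1" "x \<in> jinterval 0 e"
  shows "t *\<^sub>R jphi e t x = e - (1 - t) *\<^sub>R jinv e (t *\<^sub>R x + (1 - t) *\<^sub>R e)"
proof -
  let ?d = "t *\<^sub>R x + (1 - t) *\<^sub>R e"
  have "?d \<odot> jinv e ?d = e" using jphi_denominator_spos[OF assms] by (intro jprod_jinv spos_invertible)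
  then show ?thesis by (simp only: jphi_def jprod.add_left jprod.scaleR_left unit_left eq_diff_eq)
qed

lemma jle_scaleR_iff:
  assumes "c > 0"
  shows "c *\<^sub>R x \<preceq> c *\<^sub>R y \<longleftrightarrow> x \<preceq> (y::'a)"
  using jle_scaleR[of x y c] jle_scaleR[of "c *\<^sub>R x" "c *\<^sub>R y" "1 / c"] assms by auto

lemma jle_scaleR_neg_iff:
  assumes "c < 0"
  shows "c *\<^sub>R x \<preceq> c *\<^sub>R y \<longleftrightarrow> y \<preceq> (x::'a)"
  using jle_scaleR_iff[of "- c" y x] assms by (simp add: jle_def)

lemma jphi_parameter_zero: "jphi e 0 x = x"
  by (simp add: jphi_def jinv_unit)

lemma jphi_le_iff:
  assumes t: "t < 1" and x: "x \<in> jinterval 0 e" and y: "y \<in> jinterval 0 e"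
  shows "jphi e t x \<preceq> jphi e t y \<longleftrightarrow> x \<preceq> y"
proof -
  let ?d = "\<lambda>x. t *\<^sub>R x + (1 - t) *\<^sub>R e"
  have s: "spos (?d x)" "spos (?d y)" using t x y by (intro jphi_denominator_spos; simp)+
  have sc: "t *\<^sub>R jphi e t a \<preceq> t *\<^sub>R jphi e t b \<longleftrightarrow> t *\<^sub>R a \<preceq> t *\<^sub>R b"
    if "a \<in> jinterval 0 e" "b \<in> jinterval 0 e" "spos (?d a)" "spos (?d b)" for a b
  proof -
    have "t *\<^sub>R jphi e t a \<preceq> t *\<^sub>R jphi e t b \<longleftrightarrow> (1 - t) *\<^sub>R jinv e (?d b) \<preceq> (1 - t) *\<^sub>R jinv e (?d a)"
      unfolding jphi_scaled[OF t that(1)] jphi_scaled[OF t that(2)] by (simp add: jle_def)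
    also have "\<dots> \<longleftrightarrow> jinv e (?d b) \<preceq> jinv e (?d a)" using t by (intro jle_scaleR_iff) simp
    also have "\<dots> \<longleftrightarrow> ?d a \<preceq> ?d b" using that by (intro jinv_le_iff)
    finally show ?thesis by simp
  qed
  consider "t > 0" | "t = 0" | "t < 0" by linarith
  then show ?thesis
  proof cases
    case 1
    then show ?thesis using sc[OF x y s] by (simp add: jle_scaleR_iff)
  next
    case 2
    then show ?thesis by (simp add: jphi_parameter_zero)
  next
    case 3
    then show ?thesis using sc[OF y x s(2,1)] by (simp add: jle_scaleR_neg_iff)
  qed
qed

lemma jphi_unit: "t < 1 \<Longrightarrow> jphi e t e = e"
proof -
  have "t *\<^sub>R e + (1 - t) *\<^sub>R e = e" by (simp add: algebra_simps)
  then show "jphi e t e = e" by (simp add: jphi_def jinv_unit)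
qed

lemma jphi_zero: "jphi e t 0 = 0"
  by (simp add: jphi_def)

lemma unit_interval_ends: "0 \<in> jinterval 0 e" "e \<in> jinterval 0 e"
  by (simp_all add: jinterval_iff jle_def)

lemma jphi_range:
  assumes t: "t < 1" and x: "x \<in> jinterval 0 e"
  shows "jphi e t x \<in> jinterval 0 e"
  using jphi_le_iff[OF t unit_interval_ends(1) x] jphi_le_iff[OF t x unit_interval_ends(2)] x
  by (simp add: jphi_zero jphi_unit t jinterval_def)

text \<open>The inverse of \<open>\<phi>\<^sub>t\<close> is \<open>\<phi>\<^sub>s\<close> with \<open>1 - s = 1 / (1 - t)\<close>.\<close>

lemma jphi_inverse:
  assumes t: "t < 1" and u: "u \<in> jinterval 0 e"
  shows "jphi e t (jphi e (- t / (1 - t)) u) = u"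
proof (cases "t = 0")
  case True
  then show ?thesis by (simp add: jphi_parameter_zero)
next
  case False
  define s where "s = - t / (1 - t)"
  have s: "s < 1" "1 - s = 1 / (1 - t)" using t by (simp_all add: s_def field_simps)
  let ?x = "jphi e s u"
  have x: "?x \<in> jinterval 0 e" using s(1) u by (rule jphi_range)
  have sp: "spos (s *\<^sub>R u + (1 - s) *\<^sub>R e)" using s(1) u by (rule jphi_denominator_spos)
  have "s *\<^sub>R u + (1 - s) *\<^sub>R e = (1 / (1 - t)) *\<^sub>R (e - t *\<^sub>R u)"
    unfolding s(2) by (simp add: s_def scaleR_diff_right)
  then have "(1 - t) *\<^sub>R (s *\<^sub>R u + (1 - s) *\<^sub>R e) = e - t *\<^sub>R u" using t by simp
  then have i: "jinv e (e - t *\<^sub>R u) = (1 / (1 - t)) *\<^sub>R jinv e (s *\<^sub>R u + (1 - s) *\<^sub>R e)"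
    and ie: "jinvertible e (e - t *\<^sub>R u)"
    using jinv_scaleR[OF spos_invertible[OF sp], of "1 - t"] t by auto
  have "t *\<^sub>R ?x = - ((1 - t) *\<^sub>R (s *\<^sub>R ?x))" using t by (simp add: s_def)
  also have "s *\<^sub>R ?x = e - (1 - s) *\<^sub>R jinv e (s *\<^sub>R u + (1 - s) *\<^sub>R e)" using s(1) u by (rule jphi_scaled)
  also have "(1 - s) *\<^sub>R jinv e (s *\<^sub>R u + (1 - s) *\<^sub>R e) = jinv e (e - t *\<^sub>R u)" by (simp only: i s(2))
  finally have "t *\<^sub>R ?x + (1 - t) *\<^sub>R e = (1 - t) *\<^sub>R jinv e (e - t *\<^sub>R u)" by (simp add: scaleR_diff_right)
  then have "t *\<^sub>R jphi e t ?x = e - (1 - t) *\<^sub>R jinv e ((1 - t) *\<^sub>R jinv e (e - t *\<^sub>R u))"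
    using jphi_scaled[OF t x] by simp
  also have "\<dots> = t *\<^sub>R u" using t ie by (simp add: jinv_scaleR jinvertible_jinv jinv_jinv)
  finally show ?thesis using False by (simp add: s_def)
qed

lemma jphi_iso:
  assumes t: "t < 1"
  shows "jorder_iso_on (jinterval 0 e) (jinterval 0 e) (jphi e t)"
proof -
  have s: "- t / (1 - t) < 1" using t by (simp add: field_simps)
  have "bij_betw (jphi e t) (jinterval 0 e) (jinterval 0 e)"
    unfolding bij_betw_def
  proof
    show "inj_on (jphi e t) (jinterval 0 e)"
    proof (rule inj_onI)
      fix x y assume xy: "x \<in> jinterval 0 e" "y \<in> jinterval 0 e" "jphi e t x = jphi e t y"
      then show "x = y" using jphi_le_iff[OF t xy(1,2)] jphi_le_iff[OF t xy(2,1)] by (intro jle_antisym) simp_all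
    qed
    show "jphi e t ` jinterval 0 e = jinterval 0 e"
    proof
      show "jphi e t ` jinterval 0 e \<subseteq> jinterval 0 e" using jphi_range[OF t] by blast
      show "jinterval 0 e \<subseteq> jphi e t ` jinterval 0 e"
      proof
        fix u assume u: "u \<in> jinterval 0 e"
        show "u \<in> jphi e t ` jinterval 0 e"
          using jphi_inverse[OF t u] jphi_range[OF s u] by (metis image_eqI)
      qed
    qed
  qed
  then show ?thesis using jphi_le_iff[OF t] by (simp add: jorder_iso_on_def)
qed

lemma jphi_spos_iff:
  assumes t: "t < 1" and x: "x \<in> jinterval 0 e"
  shows "spos (jphi e t x) \<longleftrightarrow> spos x"
proof -
  have "t *\<^sub>R x + (1 - t) *\<^sub>R e \<in> jb_gen e x" by (intro jb_gen_intros)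
  from jinvertible_jprod_jinv_iff[OF this spos_invertible[OF jphi_denominator_spos[OF t x]]]
  show ?thesis using x jphi_range[OF t x] by (simp add: spos_iff jphi_def jinterval_iff)
qed

text \<open>The reciprocal of s / (t s + 1 - t) is t + (1 - t) / s.\<close>

lemma jinv_jphi:
  assumes t: "t < 1" and x: "x \<in> jinterval 0 e" "spos x"
  shows "jinv e (jphi e t x) = t *\<^sub>R e + (1 - t) *\<^sub>R jinv e x"
proof -
  let ?d = "t *\<^sub>R x + (1 - t) *\<^sub>R e" and ?j = "jinv e x"
  have di: "jinvertible e ?d" using t x(1) by (intro spos_invertible jphi_denominator_spos)
  have xi: "jinvertible e x" using x(2) by (rule spos_invertible)
  have gi: "jinv e ?d \<in> jb_gen e x"
    by (rule jb_gen_trans[OF jinv_in_gen[OF di]]) (intro jb_gen_intros)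
  have gj: "?j \<in> jb_gen e x" using xi by (rule jinv_in_gen)
  have "(x \<odot> jinv e ?d) \<odot> ?j = jinv e ?d \<odot> (x \<odot> ?j)"
    using jb_gen_assoc[OF gi jb_gen_self gj] by (simp add: jprod_commute)
  then have "(x \<odot> jinv e ?d) \<odot> (t *\<^sub>R e + (1 - t) *\<^sub>R ?j) = ?d \<odot> jinv e ?d"
    by (simp only: jprod.add_right jprod.add_left jprod.scaleR_right jprod.scaleR_left jprod_jinv[OF xi] unit_right unit_left)
  also have "\<dots> = e" by (rule jprod_jinv[OF di])
  finally have 1: "(x \<odot> jinv e ?d) \<odot> (t *\<^sub>R e + (1 - t) *\<^sub>R ?j) = e" .
  have "x \<odot> jinv e ?d \<in> jb_gen e x" "t *\<^sub>R e + (1 - t) *\<^sub>R ?j \<in> jb_gen e x" by (intro jb_gen_intros gi gj)+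
  from gen_inverse(2)[OF this 1] show ?thesis by (simp add: jphi_def)
qed

text \<open>The origin of the root of z^2 + e in the formula: the unit of M arrives at q = z^(-2),
  the contraction sends q to the inverse of z^2 + e, and U of the root brings this top of the
  interval back to e.\<close>

lemma
  assumes z: "spos z"
  shows spos_jsqrt_square_plus: "spos (jsqrt e (z \<odot> z + e))"
    and quad_rep_jcontract_inverse_square:
      "quad_rep (jsqrt e (z \<odot> z + e)) (jcontract (jinv e z \<odot> jinv e z)) = e"
proof -
  let ?m = "z \<odot> z" and ?s = "jsqrt e (z \<odot> z + e)" and ?q = "jinv e z \<odot> jinv e z"
  have zi: "jinvertible e z" using z by (rule spos_invertible)
  have m1: "spos (?m + e)" using spos_add[OF spos_unit jpos_square[of z]] by (simp add: add.commute)
  then show s: "spos ?s" by (rule spos_jsqrt)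
  have q: "?q = quad_rep (jinv e z) e" by simp
  have qs: "spos ?q" unfolding q by (intro spos_quad_rep jinvertible_jinv zi spos_unit)
  have jq: "jinv e ?q = ?m"
    using jinv_quad_rep[OF jinvertible_jinv[OF zi] jinv_unit(1)] by (simp add: zi jinv_unit jinv_jinv)
  have ci: "jinvertible e (jcontract ?q)" using qs by (intro spos_invertible) (simp add: jcontract_spos_iff)
  have "jinv e (jcontract ?q) = ?m + e" using jinv_jcontract[OF qs] by (simp add: jq add.commute)
  then have "jcontract ?q = jinv e (?m + e)" using jinv_jinv[OF ci] by simp
  also have "?m + e = quad_rep ?s e" using m1 by (simp add: jsqrt_square spos_pos)
  also have "jinv e (quad_rep ?s e) = quad_rep (jinv e ?s) e"
    using s by (simp only: jinv_quad_rep spos_invertible jinv_unit)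
  finally have "jcontract ?q = quad_rep (jinv e ?s) e" .
  then show "quad_rep ?s (jcontract ?q) = e" using quad_rep_jinv_right[OF spos_invertible[OF s], of e] by simp
qed

end

lemma jordan_iso_quad_rep: "jordan_iso J \<Longrightarrow> J (quad_rep a b) = quad_rep (J a) (J b)"
  unfolding jordan_iso_def quad_rep_def by (simp add: linear_diff linear_cmul)

section \<open>The map of the asserted formula\<close>

definition interval_map ::
  "'b::jb_algebra \<Rightarrow> real \<Rightarrow> 'b \<Rightarrow> ('a::jb_algebra \<Rightarrow> 'b) \<Rightarrow> 'a \<Rightarrow> 'b" where
  "interval_map e t z J x = jphi e t (quad_rep (jsqrt e (z \<odot> z + e))
     (e - jinv e (e + quad_rep (jinv e z) (J x))))"

context unital_pair
begin

text \<open>\<open>jinvI\<close> describes inverses by equations in quadratic representations, and J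
  preserves those.\<close>

lemma jordan_iso_jinv:
  assumes J: "jordan_iso J" and y: "jinvertible eM y"
  shows "jinv eN (J y) = J (jinv eM y)"
proof (rule N.jinvI)
  show "quad_rep (J y) (J (jinv eM y \<odot> jinv eM y)) = eN"
    using M.quad_rep_jinv_square[OF y] jordan_iso_quad_rep[OF J] jordan_iso_unit[OF J] by metis
  show "quad_rep (J y) (J (jinv eM y)) = J y"
    using M.quad_rep_jinv_self[OF y] jordan_iso_quad_rep[OF J] by metis
qed

context
  fixes t :: real and z :: 'b and J :: "'a \<Rightarrow> 'b"
  assumes t: "t < 1" and z: "N.spos z" and J: "jordan_iso J"
begin

lemma z_invertible: "jinvertible eN z"
  using z by (rule N.spos_invertible)

lemma jsqrt_invertible: "jinvertible eN (jsqrt eN (z \<odot> z + eN))"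
  using N.spos_jsqrt_square_plus[OF z] by (rule N.spos_invertible)

lemma interval_map_stages:
  "jorder_iso_on (jinterval 0 eM) (jinterval 0 (jinv eN z \<odot> jinv eN z)) (\<lambda>x. quad_rep (jinv eN z) (J x))"
  "jorder_iso_on (jinterval 0 eM) (jinterval 0 eN)
    (\<lambda>x. quad_rep (jsqrt eN (z \<odot> z + eN)) (N.jcontract (quad_rep (jinv eN z) (J x))))"
proof -
  let ?q = "jinv eN z \<odot> jinv eN z" and ?s = "jsqrt eN (z \<odot> z + eN)"
  note Z = N.quad_rep_linear_order_iso[OF N.jinvertible_jinv[OF z_invertible]]
  note S = N.quad_rep_linear_order_iso[OF jsqrt_invertible]
  have "linear_order_iso (\<lambda>x. quad_rep (jinv eN z) (J x))"
    by (rule linear_order_iso_comp[OF Z jordan_iso_order_iso[OF J]])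
  note L = linear_order_iso_on[OF this, of "jinterval 0 eM"] linear_order_iso_image_interval[OF this, of eM]
  then show 1: "jorder_iso_on (jinterval 0 eM) (jinterval 0 ?q) (\<lambda>x. quad_rep (jinv eN z) (J x))"
    by (simp add: jordan_iso_unit[OF J])
  have 2: "jorder_iso_on (jinterval 0 ?q) (jinterval 0 (N.jcontract ?q)) N.jcontract"
    by (rule N.jcontract_iso) simp
  have 3: "jorder_iso_on (jinterval 0 (N.jcontract ?q)) (jinterval 0 eN) (quad_rep ?s)"
    using linear_order_iso_on[OF S, of "jinterval 0 (N.jcontract ?q)"] linear_order_iso_image_interval[OF S, of "N.jcontract ?q"]
    by (simp add: N.quad_rep_jcontract_inverse_square[OF z])
  show "jorder_iso_on (jinterval 0 eM) (jinterval 0 eN)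
    (\<lambda>x. quad_rep ?s (N.jcontract (quad_rep (jinv eN z) (J x))))"
    by (rule jorder_iso_on_comp[OF jorder_iso_on_comp[OF 1 2] 3])
qed

lemma interval_map_iso: "jorder_iso_on (jinterval 0 eM) (jinterval 0 eN) (interval_map eN t z J)"
  using jorder_iso_on_comp[OF interval_map_stages(2) N.jphi_iso[OF t]]
  by (simp add: interval_map_def[abs_def] N.jcontract_def)

lemma interval_map_spos:
  assumes x: "x \<in> jinterval 0 eM"
  shows "N.spos (interval_map eN t z J x) \<longleftrightarrow> M.spos x"
proof -
  let ?v = "quad_rep (jinv eN z) (J x)"
  have v: "?v \<in> jpos" and u: "quad_rep (jsqrt eN (z \<odot> z + eN)) (N.jcontract ?v) \<in> jinterval 0 eN"
    using interval_map_stages x by (auto simp: jorder_iso_on_def bij_betw_def N.jinterval_iff)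
  have "N.spos (interval_map eN t z J x) \<longleftrightarrow> N.spos (N.jcontract ?v)"
    using N.jphi_spos_iff[OF t u] by (simp add: interval_map_def N.jcontract_def N.spos_quad_rep_iff jsqrt_invertible)
  also have "\<dots> \<longleftrightarrow> N.spos (J x)"
    using v by (simp add: N.jcontract_spos_iff N.spos_quad_rep_iff N.jinvertible_jinv z_invertible)
  also have "\<dots> \<longleftrightarrow> M.spos x"
    using spos_order_iso[OF jordan_iso_order_iso[OF J]] by (simp add: jordan_iso_unit[OF J] N.spos_unit)
  finally show ?thesis .
qed

lemma interval_map_image: "interval_map eN t z J ` junit_interval_inv eM = junit_interval_inv eN"
proof -
  have img: "interval_map eN t z J ` jinterval 0 eM = jinterval 0 eN"
    using interval_map_iso by (simp add: jorder_iso_on_def bij_betw_def)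
  have M: "junit_interval_inv eM = {x \<in> jinterval 0 eM. M.spos x}"
    by (auto simp: M.junit_interval_inv_iff M.jinterval_iff M.spos_pos)
  have N: "junit_interval_inv eN = {x \<in> jinterval 0 eN. N.spos x}"
    by (auto simp: N.junit_interval_inv_iff N.jinterval_iff N.spos_pos)
  show ?thesis unfolding M N img[symmetric] using interval_map_spos by auto
qed

text \<open>Passing to inverses makes every stage affine in the inverse of y: the contraction adds
  the unit, whence \<open>i \<odot> i\<close>, and phi_t contributes the combination with weights t
  and 1 - t.\<close>

lemma jinv_interval_map:
  assumes y: "y \<in> junit_interval_inv eM"
  defines "i \<equiv> jinv eN (jsqrt eN (z \<odot> z + eN))"
  shows "jinv eN (interval_map eN t z J y)
    = t *\<^sub>R eN + (1 - t) *\<^sub>R (i \<odot> i + quad_rep i (quad_rep z (J (jinv eM y))))"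
proof -
  let ?s = "jsqrt eN (z \<odot> z + eN)" and ?v = "quad_rep (jinv eN z) (J y)"
  have y': "M.spos y" "y \<in> jinterval 0 eM" using y by (auto simp: M.junit_interval_inv_iff M.jinterval_iff M.spos_pos)
  have Jy: "N.spos (J y)"
    using spos_order_iso[OF jordan_iso_order_iso[OF J]] y'(1) by (simp add: jordan_iso_unit[OF J] N.spos_unit)
  have v: "N.spos ?v" using Jy by (simp add: N.spos_quad_rep_iff N.jinvertible_jinv z_invertible)
  have c: "N.spos (N.jcontract ?v)" using v by (simp add: N.jcontract_spos_iff N.spos_pos)
  have u: "quad_rep ?s (N.jcontract ?v) \<in> jinterval 0 eN"
    using interval_map_stages(2) y'(2) by (auto simp: jorder_iso_on_def bij_betw_def)
  have "jinv eN ?v = quad_rep z (J (jinv eM y))"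
    using jordan_iso_jinv[OF J M.spos_invertible[OF y'(1)]] Jy
    by (simp add: N.jinv_quad_rep N.jinvertible_jinv z_invertible N.jinv_jinv N.spos_invertible)
  then have "jinv eN (quad_rep ?s (N.jcontract ?v)) = i \<odot> i + quad_rep i (quad_rep z (J (jinv eM y)))"
    using c v by (simp add: N.jinv_quad_rep jsqrt_invertible N.spos_invertible N.jinv_jcontract quad_rep_add i_def)
  moreover have "N.spos (quad_rep ?s (N.jcontract ?v))" using c by (simp add: N.spos_quad_rep_iff jsqrt_invertible)
  ultimately show ?thesis
    using N.jinv_jphi[OF t u] by (simp add: interval_map_def N.jcontract_def)
qed

end

text \<open>On the invertible elements an order isomorphism is \<open>y \<mapsto> (e + U\<^sub>w J (y\<^sup>-\<^sup>1 - e))\<^sup>-\<^sup>1\<close>. It has the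
  required form with \<open>t = - \<parallel>w\<parallel>\<^sup>2\<close>, \<open>b = (1 - t)\<^sup>-\<^sup>1\<^sup>/\<^sup>2 w\<close> and \<open>z = b (e - b\<^sup>2)\<^sup>-\<^sup>1\<^sup>/\<^sup>2\<close>: the choice of
  \<open>t\<close> makes \<open>e - b\<^sup>2\<close> strictly positive.\<close>

lemma interval_map_parameters:
  assumes w: "N.spos w"
  obtains t z where "t < 1" "N.spos z"
    "\<And>J y. jordan_iso J \<Longrightarrow> y \<in> junit_interval_inv eM \<Longrightarrow>
      jinv eN (interval_map eN t z J y) = eN + quad_rep w (J (jinv eM y - eM))"
proof -
  define t where "t = - (norm w)\<^sup>2"
  have t: "t < 1" "1 - t > 0" unfolding t_def using zero_le_power2[of "norm w"] by linarith+
  define b where "b = (1 / sqrt (1 - t)) *\<^sub>R w"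
  have b: "N.spos b" unfolding b_def using w t by (intro N.spos_scaleR) auto
  have Uw: "quad_rep w a = (1 - t) *\<^sub>R quad_rep b a" for a
    using t by (simp add: b_def quad_rep_scaleR_left power_divide)
  have "N.spos (eN - b \<odot> b)"
  proof -
    have "norm (w \<odot> w) \<le> (norm w)\<^sup>2" by (simp add: norm_jsquare)
    then have "(norm w)\<^sup>2 *\<^sub>R eN - w \<odot> w \<in> jpos" by (rule N.unit_minus_pos)
    then have "(1 / (1 - t)) *\<^sub>R ((norm w)\<^sup>2 *\<^sub>R eN - w \<odot> w) \<in> jpos" using t by (intro N.jpos_scaleR) auto
    moreover have "(1 / (1 - t)) *\<^sub>R ((norm w)\<^sup>2 *\<^sub>R eN - w \<odot> w) = (eN - b \<odot> b) - (1 / (1 - t)) *\<^sub>R eN"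
    proof -
      have "(norm w)\<^sup>2 / (1 - t) = 1 - 1 / (1 - t)" using t by (simp add: t_def field_simps)
      moreover have "b \<odot> b = (1 / (1 - t)) *\<^sub>R (w \<odot> w)"
        using t by (simp add: b_def jprod_distribs real_sqrt_mult_self)
      ultimately show ?thesis by (simp add: scaleR_diff_right scaleR_diff_left)
    qed
    ultimately show ?thesis using t by (auto simp: N.spos_def intro!: exI[of _ "1 / (1 - t)"])
  qed
  \<comment> \<open>With c^2 = e - b^2 and z = b c^(-1), z^2 + e is the square of the inverse of c.
    Then \<open>i\<close> in \<open>jinv_interval_map\<close> is c itself, and U_c U_z =
    U_b.\<close>
  define c where "c = jsqrt eN (eN - b \<odot> b)"
  have c: "N.spos c" "c \<odot> c = eN - b \<odot> b"
    using \<open>N.spos (eN - b \<odot> b)\<close> by (auto simp: c_def N.spos_jsqrt N.jsqrt_square N.spos_pos)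
  let ?i = "jinv eN c"
  have ci: "jinvertible eN c" using c(1) by (rule N.spos_invertible)
  have gb: "b \<in> jb_gen eN b" by (rule jb_gen_self)
  have gc: "c \<in> jb_gen eN b"
    unfolding c_def
    by (rule jb_gen_trans[OF N.jsqrt_in_gen[OF N.spos_pos[OF \<open>N.spos (eN - b \<odot> b)\<close>]]]) (intro jb_gen_intros)
  have gi: "?i \<in> jb_gen eN b" by (rule jb_gen_trans[OF N.jinv_in_gen[OF ci] gc])
  have ip: "N.spos ?i" using c(1) by (rule N.spos_jinv)
  define z where "z = b \<odot> ?i"
  have zp: "N.spos z"
  proof -
    have "z \<in> jpos" unfolding z_def using b ip by (intro N.jpos_jprod[OF gb gi] N.spos_pos)
    moreover have "jinvertible eN z"
      unfolding z_def using N.jinvertible_jprod_jinv_iff[OF gc ci] N.spos_invertible[OF b] by simp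
    ultimately show ?thesis by (simp add: N.spos_iff)
  qed
  have cz: "c \<odot> z = b"
  proof -
    have "c \<odot> z = b \<odot> (c \<odot> ?i)"
      unfolding z_def by (rule N.jb_gen_operator_commute[OF gc gb])
    then show ?thesis by (simp add: N.jprod_jinv ci)
  qed
  have zz: "z \<odot> z + eN = ?i \<odot> ?i"
  proof -
    have "(c \<odot> c) \<odot> (?i \<odot> ?i) = c \<odot> (c \<odot> (?i \<odot> ?i))" by (intro N.jb_gen_assoc[of _ b] gc gi jb_gen_jprod)
    also have "c \<odot> (?i \<odot> ?i) = (c \<odot> ?i) \<odot> ?i" by (intro N.jb_gen_assoc[of _ b, symmetric] gc gi)
    finally have 1: "(c \<odot> c) \<odot> (?i \<odot> ?i) = eN" by (simp add: N.jprod_jinv ci)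
    have "z \<odot> z = b \<odot> (?i \<odot> (b \<odot> ?i))" unfolding z_def by (intro N.jb_gen_assoc[of _ b] gb gi jb_gen_jprod)
    also have "?i \<odot> (b \<odot> ?i) = b \<odot> (?i \<odot> ?i)" by (rule N.jb_gen_operator_commute[OF gi gb])
    also have "b \<odot> (b \<odot> (?i \<odot> ?i)) = (b \<odot> b) \<odot> (?i \<odot> ?i)"
      by (intro N.jb_gen_assoc[of _ b, symmetric] gb gi jb_gen_jprod)
    also have "b \<odot> b = eN - c \<odot> c" by (simp add: c)
    finally show ?thesis by (simp add: jprod.diff_left 1)
  qed
  have s: "jsqrt eN (z \<odot> z + eN) = ?i" using ip by (intro N.jsqrt_unique N.spos_pos) (simp_all add: zz)
  have "jinv eN (interval_map eN t z J y) = eN + quad_rep w (J (jinv eM y - eM))"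
    if J: "jordan_iso J" and y: "y \<in> junit_interval_inv eM" for J y
  proof -
    have lin: "linear J" using J by (simp add: jordan_iso_def)
    have gz: "z \<in> jb_gen eN b" unfolding z_def by (intro jb_gen_jprod gb gi)
    have "quad_rep c (quad_rep z a) = quad_rep b a" for a
      using N.quad_rep_comp_gen[OF gc gz N.spos_pos[OF zp]] by (simp add: cz)
    then have "jinv eN (interval_map eN t z J y)
        = t *\<^sub>R eN + (1 - t) *\<^sub>R ((eN - b \<odot> b) + quad_rep b (J (jinv eM y)))"
      using jinv_interval_map[OF t(1) zp J y] by (simp add: s N.jinv_jinv ci c)
    \<comment> \<open>t e + (1 - t)(e - b^2) = e - (1 - t) U_b e, and e is the image of the unit of
      M under J.\<close>
    also have "\<dots> = eN + (1 - t) *\<^sub>R quad_rep b (J (jinv eM y - eM))"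
      by (simp add: linear_diff[OF lin] jordan_iso_unit[OF J] quad_rep_diff algebra_simps)
    finally show ?thesis by (simp add: Uw)
  qed
  then show ?thesis by (rule that[OF t(1) zp])
qed

text \<open>The reverse inequality follows by exchanging f and F. With F x = f x', every y above x
  where the maps agree satisfies f x' = F x \<preceq> F y = f y, so x' \<preceq> y; such y approach
  x along the segment to the unit.\<close>

lemma order_iso_below_if_eq_on_invertible:
  assumes f: "jorder_iso_on (jinterval 0 eM) (jinterval 0 eN) f"
    and F: "jorder_iso_on (jinterval 0 eM) (jinterval 0 eN) F"
    and eq: "\<And>y. y \<in> junit_interval_inv eM \<Longrightarrow> f y = F y"
    and x: "x \<in> jinterval 0 eM"
  shows "F x \<preceq> f x"
proof -
  have "F x \<in> f ` jinterval 0 eM" using f F x by (auto simp: jorder_iso_on_def bij_betw_def)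
  then obtain x' where x': "x' \<in> jinterval 0 eM" "F x = f x'" by blast
  have fle: "f a \<preceq> f b \<longleftrightarrow> a \<preceq> b" and Fle: "F a \<preceq> F b \<longleftrightarrow> a \<preceq> b"
    if "a \<in> jinterval 0 eM" "b \<in> jinterval 0 eM" for a b using f F that by (auto simp: jorder_iso_on_def)
  have "x' \<preceq> x + \<epsilon> *\<^sub>R (eM - x)" if \<epsilon>: "0 < \<epsilon>" for \<epsilon>
  proof -
    \<comment> \<open>The bound by 1 keeps \<open>?y\<close> below the unit.\<close>
    define \<delta> where "\<delta> = min \<epsilon> 1"
    have \<delta>: "0 < \<delta>" "\<delta> \<le> 1" "\<delta> \<le> \<epsilon>" using \<epsilon> by (auto simp: \<delta>_def)
    let ?y = "x + \<delta> *\<^sub>R (eM - x)"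
    have ex: "eM - x \<in> jpos" "x \<in> jpos" using x by (auto simp: M.jinterval_iff jle_def)
    have y_eq: "?y = \<delta> *\<^sub>R eM + (1 - \<delta>) *\<^sub>R x" "eM - ?y = (1 - \<delta>) *\<^sub>R (eM - x)" by (simp_all add: algebra_simps)
    have "M.spos ?y" unfolding y_eq(1) using \<delta> ex by (intro M.spos_add M.spos_scaleR M.spos_unit M.jpos_scaleR) auto
    moreover have "?y \<preceq> eM" unfolding jle_def y_eq(2) using \<delta> ex by (intro M.jpos_scaleR) auto
    ultimately have y: "?y \<in> junit_interval_inv eM" "?y \<in> jinterval 0 eM"
      by (auto simp: M.junit_interval_inv_iff M.jinterval_iff M.spos_pos)
    have "x \<preceq> ?y" using \<delta> ex by (simp add: jle_def M.jpos_scaleR)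
    then have "F x \<preceq> F ?y" using x y by (simp add: Fle)
    then have "f x' \<preceq> f ?y" unfolding eq[OF y(1)] x'(2) .
    then have "x' \<preceq> ?y" unfolding fle[OF x'(1) y(2)] .
    also have "?y \<preceq> x + \<epsilon> *\<^sub>R (eM - x)" using \<delta> ex by (simp add: M.jle_scaleR_left)
    finally show ?thesis .
  qed
  then have "x' \<preceq> x" by (rule M.jle_closed)
  then show ?thesis using x x' by (simp add: fle)
qed

end

lemma (in jbw_pair) interval_order_iso_form:
  assumes nc: "\<not> (\<exists>p::'a. jatom p \<and> jcentral p)"
    and f: "jorder_iso_on (jinterval 0 eM) (jinterval 0 eN) f"
    and img: "f ` junit_interval_inv eM = junit_interval_inv eN"
  obtains t z J where "t < 1" "N.spos z" "jordan_iso J"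
    "\<And>x. x \<in> jinterval 0 eM \<Longrightarrow> f x = interval_map eN t z J x"
proof -
  have sub: "junit_interval_inv eM \<subseteq> jinterval 0 eM" by (auto simp: junit_interval_inv_def)
  then have "jorder_iso_on (junit_interval_inv eM) (junit_interval_inv eN) f"
    using f img unfolding jorder_iso_on_def bij_betw_def by (meson inj_on_subset subsetD)
  from jorder_iso_on_conjugate[OF M.cone_to_interval this N.interval_to_cone]
  interpret cone_iso eM eN "\<lambda>x. jinv eN (f (jinv eM (eM + x))) - eN" by (rule cone_iso_intro)
  obtain T where T: "linear_order_iso T" "\<And>x. x \<in> jpos \<Longrightarrow> jinv eN (f (jinv eM (eM + x))) - eN = T x"
    using cone_iso_linear[OF nc] by blast
  obtain w J where w: "N.spos w" and J: "jordan_iso J" and TwJ: "\<And>x. T x = quad_rep w (J x)"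
    using linear_order_iso_decomposition[OF nc T(1)] by blast
  obtain t z where t: "t < 1" and z: "N.spos z" and
    F: "\<And>y. y \<in> junit_interval_inv eM \<Longrightarrow>
      jinv eN (interval_map eN t z J y) = eN + quad_rep w (J (jinv eM y - eM))"
    using unital.interval_map_parameters[OF w] J by metis
  note Fiso = unital.interval_map_iso[OF t z J]
  have eq: "f y = interval_map eN t z J y" if y: "y \<in> junit_interval_inv eM" for y
  proof -
    have yi: "M.spos y" using y by (simp add: M.junit_interval_inv_iff)
    have "jinv eM y - eM \<in> jpos"
      using M.interval_to_cone y by (auto simp: janti_iso_on_def bij_betw_def)
    from T(2)[OF this] have "jinv eN (f y) - eN = quad_rep w (J (jinv eM y - eM))"
      using yi by (simp add: TwJ M.jinv_jinv M.spos_invertible)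
    then have "jinv eN (f y) = jinv eN (interval_map eN t z J y)" using F[OF y] by (simp add: algebra_simps)
    moreover have "f y \<in> junit_interval_inv eN" using img y by blast
    moreover have "interval_map eN t z J y \<in> junit_interval_inv eN"
      using unital.interval_map_image[OF t z J] y by blast
    ultimately show ?thesis by (metis N.jinv_jinv N.junit_interval_inv_iff N.spos_invertible)
  qed
  have "f x = interval_map eN t z J x" if x: "x \<in> jinterval 0 eM" for x
    using unital.order_iso_below_if_eq_on_invertible[OF f Fiso eq x]
      unital.order_iso_below_if_eq_on_invertible[OF Fiso f eq[symmetric] x]
    by (intro N.jle_antisym)
  then show ?thesis by (rule that[OF t z J])
qed

lemma atomic_jbwI:
  fixes e :: "'a::jb_algebra"
  assumes "jbw_algebra TYPE('a) TYPE('p::banach)" "is_junit e" "jatomic TYPE('a)"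
  shows "atomic_jbw e"
proof -
  interpret unital_jb e by unfold_locales (rule assms)
  show ?thesis
    by unfold_locales (rule chain_supremum[OF assms(1)] assms(3); blast)+
qed

theorem theorem4p5:
  fixes eM :: "'a::jb_algebra" and eN :: "'b::jb_algebra" and f :: "'a \<Rightarrow> 'b"
  assumes "jbw_algebra TYPE('a) TYPE('p::banach)"
    and "jbw_algebra TYPE('b) TYPE('q::banach)"
    and "is_junit eM" and "is_junit eN"
    and "jatomic TYPE('a)" and "jatomic TYPE('b)"
    and "\<not> (\<exists>p::'a. jatom p \<and> jcentral p)"
  shows "(jorder_iso_on (jinterval 0 eM) (jinterval 0 eN) f \<and>
            f ` junit_interval_inv eM = junit_interval_inv eN)
    \<longleftrightarrow>
         (\<exists>t z J. t < 1 \<and> z \<in> interior (jpos :: 'b set) \<and> jordan_iso J \<and>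
            (\<forall>x\<in>jinterval 0 eM.
               f x = jphi eN t
                       (quad_rep (jsqrt eN (z \<odot> z + eN))
                         (eN - jinv eN (eN + quad_rep (jinv eN z) (J x))))))"
    (is "?iso \<longleftrightarrow> ?form")
proof -
  interpret jbw_pair eM eN
    by (intro jbw_pair.intro atomic_jbwI[OF assms(1,3,5)] atomic_jbwI[OF assms(2,4,6)])
  have sub: "junit_interval_inv eM \<subseteq> jinterval 0 eM" by (auto simp: junit_interval_inv_def)
  show ?thesis
    unfolding interval_map_def[symmetric] N.interior_jpos
  proof
    assume ?iso
    then show "\<exists>t z J. t < 1 \<and> N.spos z \<and> jordan_iso J \<and>
        (\<forall>x\<in>jinterval 0 eM. f x = interval_map eN t z J x)"
      using interval_order_iso_form[OF assms(7)] by metis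
  next
    assume "\<exists>t z J. t < 1 \<and> N.spos z \<and> jordan_iso J \<and>
        (\<forall>x\<in>jinterval 0 eM. f x = interval_map eN t z J x)"
    then obtain t z J where p: "t < 1" "N.spos z" "jordan_iso J"
      and eq: "\<And>x. x \<in> jinterval 0 eM \<Longrightarrow> f x = interval_map eN t z J x" by blast
    have "jorder_iso_on (jinterval 0 eM) (jinterval 0 eN) f"
      using unital.interval_map_iso[OF p] eq
      by (simp add: jorder_iso_on_def cong: bij_betw_cong)
    moreover have "f ` junit_interval_inv eM = junit_interval_inv eN"
      using unital.interval_map_image[OF p] eq sub by (metis (no_types, lifting) image_cong subsetD)
    ultimately show ?iso ..
  qed
qed

end
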